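(* Let $\mathcal Z=\mathbb{R}^d$, $Q$ a Borel probability measure on $\mathcal Z$, and $k$ a bounded, continuous, characteristic, shift-invariant kernel with $\sup_zk(z,z)\le1$, with spectral density $p_k$ and $c_k=\int p_k$ (so $k(z,z')=\int p_k(w)\cos\langle w,z-z'\rangle dw$). Let $\mathcal M$, $(P_i,l_i)_{i=1}^n$, $(S_i)_{i=1}^n$ with $|S_i|=n_i$ be as in the distributional learning setup (pairs i.i.d. from $\mathcal M$ on $\mathcal P\times\{-1,1\}$, $S_i$ i.i.d. from $P_i$). Let $\mathcal F_Q$ be a class of functionals $L^2(Q)\to\mathbb{R}$ with Lipschitz constants (w.r.t. $\|\cdot\|_{L^2(Q)}$) bounded by $L_Q$; let $\varphi:\mathbb{R}\to\mathbb{R}_+$ be $L_\varphi$-Lipschitz with $\varphi(z)\ge\mathbb 1_{z>0}$ and $\varphi(-f(h)l)\le B$ for all $f\in\mathcal F_Q$, $h\in L^2(Q)$, $l\in\{-1,1\}$. Independently of all else draw $(w_j,b_j)_{j=1}^m$ i.i.d. with $w_j\sim p_k/c_k$, $b_j\sim\mathcal U[0,2\pi]$, and let $\hat g^z_m=\frac1m\sum_j 2c_k\cos(\langle w_j,z\rangle+b_j)\cos(\langle w_j,\cdot\rangle+b_j)$. Let $R_\varphi(f)=\mathbb{E}_{(P,l)\sim\mathcal M}[\varphi(-f(\mu_k(P))l)]$, $f^*\in\arg\min_{\mathcal F_Q}R_\varphi$, and $$\tilde f^m_n\in\arg\min_{f\in\mathcal F_Q}\frac1n\sum_{i=1}^n\varphi\Big(-f\Big(\frac1{n_i}\sum_{z\in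 S_i}\hat g^z_m\Big)l_i\Big)$$ (minimizers assumed to exist, all maps measurable). Then for every $\delta\in(0,1)$, with probability at least $1-\delta$ over all sources of randomness, $$R_\varphi(\tilde f^m_n)-R_\varphi(f^* )\le4L_\varphi\mathfrak R_n(\mathcal F_Q)+2B\sqrt{\frac{\log(3/\delta)}{2n}}+\frac{4L_\varphi L_Q}{n}\sum_{i=1}^n\Big(\sqrt{\frac{\mathbb{E}_{z\sim P_i}k(z,z)}{n_i}}+\sqrt{\frac{\log(3n/\delta)}{2n_i}}\Big)+\frac{2L_\varphi L_Q}{n}\sum_{i=1}^n\frac{2c_k}{\sqrt m}\Big(1+\sqrt{2\log(3n\,n_i/\delta)}\Big).$$
   Context: $\mu_k(P)=\int k(z,\cdot)\,dP(z)$ is the kernel mean embedding, an element of $\mathcal H_k\subseteq L^2(Q)$. $\mathfrak R_n(\mathcal F_Q)=\mathbb{E}\big[\sup_{f\in\mathcal F_Q}\big|\frac1n\sum_{i=1}^n\sigma_if(\mu_k(P_i))\big|\big]$ with $\sigma_i$ i.i.d. uniform on $\{-1,1\}$ independent of $(P_i,l_i)$. A kernel is characteristic if $P\mapsto\mu_k(P)$ is injective. *)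

theory Defs
  imports "HOL-Probability.Probability"
begin

definition kme :: "('d \<Rightarrow> 'd \<Rightarrow> real) \<Rightarrow> 'd measure \<Rightarrow> ('d \<Rightarrow> real)" where
  "kme k P = (\<lambda>x. LINT z|P. k z x)"

definition L2 :: "'d measure \<Rightarrow> ('d \<Rightarrow> real) set" where
  "L2 Q = {h. h \<in> borel_measurable Q \<and> integrable Q (\<lambda>x. (h x)^2)}"

definition L2norm :: "'d measure \<Rightarrow> ('d \<Rightarrow> real) \<Rightarrow> real" where
  "L2norm Q h = sqrt (LINT x|Q. (h x)^2)"

definition characteristic :: "('d::topological_space \<Rightarrow> 'd \<Rightarrow> real) \<Rightarrow> bool" where
  "characteristic k \<longleftrightarrow> inj_on (kme k) (space (prob_algebra (borel :: 'd measure)))"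

definition rf_measure :: "('d::euclidean_space \<Rightarrow> real) \<Rightarrow> real \<Rightarrow> ('d \<times> real) measure" where
  "rf_measure p c = density lborel (\<lambda>w. ennreal (p w / c)) \<Otimes>\<^sub>M uniform_measure lborel {0..2*pi}"

text \<open>Random Fourier feature approximation hat g^z_m of k(z,.) built from features W 0, ..., W (m-1).\<close>
definition ghat :: "real \<Rightarrow> nat \<Rightarrow> (nat \<Rightarrow> 'd::euclidean_space \<times> real) \<Rightarrow> 'd \<Rightarrow> 'd \<Rightarrow> real" where
  "ghat c m W z = (\<lambda>x. (1 / real m) * (\<Sum>j<m. 2 * c * cos (fst (W j) \<bullet> z + snd (W j))
                                                  * cos (fst (W j) \<bullet> x + snd (W j))))"

definition emp_obj :: "(real \<Rightarrow> real) \<Rightarrow> real \<Rightarrow> nat \<Rightarrow> nat \<Rightarrow> (nat \<Rightarrow> nat)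
    \<Rightarrow> (nat \<Rightarrow> 'd measure \<times> real) \<Rightarrow> (nat \<Rightarrow> nat \<Rightarrow> 'd::euclidean_space) \<Rightarrow> (nat \<Rightarrow> 'd \<times> real)
    \<Rightarrow> (('d \<Rightarrow> real) \<Rightarrow> real) \<Rightarrow> real" where
  "emp_obj \<phi> c m n ns D S W f =
     (1 / real n) * (\<Sum>i<n. \<phi> (- f (\<lambda>x. (1 / real (ns i)) * (\<Sum>j<ns i. ghat c m W (S i j) x)) * snd (D i)))"

definition risk :: "('d measure \<times> real) measure \<Rightarrow> (real \<Rightarrow> real) \<Rightarrow> ('d \<Rightarrow> 'd \<Rightarrow> real)
    \<Rightarrow> (('d \<Rightarrow> real) \<Rightarrow> real) \<Rightarrow> real" where
  "risk M \<phi> k f = (LINT x|M. \<phi> (- f (kme k (fst x)) * snd x))"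

definition rademacher_signs :: "nat \<Rightarrow> (nat \<Rightarrow> real) measure" where
  "rademacher_signs n = PiM {..<n} (\<lambda>_. measure_pmf (pmf_of_set {-1, 1}))"

definition rad_sup :: "('d \<Rightarrow> 'd \<Rightarrow> real) \<Rightarrow> nat \<Rightarrow> (('d \<Rightarrow> real) \<Rightarrow> real) set
    \<Rightarrow> (nat \<Rightarrow> 'd measure \<times> real) \<times> (nat \<Rightarrow> real) \<Rightarrow> ennreal" where
  "rad_sup k n F x = (\<Squnion>f\<in>F. ennreal \<bar>(1 / real n) * (\<Sum>i<n. snd x i * f (kme k (fst (fst x i))))\<bar>)"

definition rademacher :: "('d measure \<times> real) measure \<Rightarrow> ('d \<Rightarrow> 'd \<Rightarrow> real) \<Rightarrow> nat
    \<Rightarrow> (('d \<Rightarrow> real) \<Rightarrow> real) set \<Rightarrow> ennreal" where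
  "rademacher M k n F = (\<integral>\<^sup>+ x. rad_sup k n F x \<partial>(PiM {..<n} (\<lambda>_. M) \<Otimes>\<^sub>M rademacher_signs n))"

definition sample_space :: "('d::euclidean_space measure \<times> real) measure \<Rightarrow> nat \<Rightarrow> (nat \<Rightarrow> nat)
    \<Rightarrow> ('d \<times> real) measure \<Rightarrow> nat
    \<Rightarrow> ((nat \<Rightarrow> 'd measure \<times> real) \<times> (nat \<Rightarrow> nat \<Rightarrow> 'd) \<times> (nat \<Rightarrow> 'd \<times> real)) measure" where
  "sample_space M n ns RF m =
     PiM {..<n} (\<lambda>_. M) \<Otimes>\<^sub>M PiM {..<n} (\<lambda>i. PiM {..<ns i} (\<lambda>_. (borel :: 'd measure)))
        \<Otimes>\<^sub>M PiM {..<m} (\<lambda>_. RF)"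

definition joint_measure :: "('d::euclidean_space measure \<times> real) measure \<Rightarrow> nat \<Rightarrow> (nat \<Rightarrow> nat)
    \<Rightarrow> ('d \<times> real) measure \<Rightarrow> nat
    \<Rightarrow> ((nat \<Rightarrow> 'd measure \<times> real) \<times> (nat \<Rightarrow> nat \<Rightarrow> 'd) \<times> (nat \<Rightarrow> 'd \<times> real)) measure" where
  "joint_measure M n ns RF m =
     PiM {..<n} (\<lambda>_. M) \<bind> (\<lambda>D.
       PiM {..<n} (\<lambda>i. PiM {..<ns i} (\<lambda>_. fst (D i))) \<bind> (\<lambda>S.
         PiM {..<m} (\<lambda>_. RF) \<bind> (\<lambda>W.
           return (sample_space M n ns RF m) (D, S, W))))"

end

theory Submission
  imports Defs
begin

text \<open>The excess risk of the learned functional splits into the excess of the empirical risk at the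
  true mean embeddings and the error of replacing each embedding by its random feature estimate.
  The first part is controlled one-sidedly: McDiarmid's inequality is applied to
  \<open>sup f. (R f - R\<^sub>n f) - (R f\<^sup>* - R\<^sub>n f\<^sup>*)\<close>, whose expectation is at most twice the
  Rademacher average of the loss class, and the one-sided contraction principle (no absolute values,
  hence no factor 2 and no normalisation of the loss at 0) passes to \<open>F\<close>. The second part is,
  by the Lipschitz conditions, an average of \<open>L2 Q\<close> distances, and both the sampling error and the
  random feature error are instances of one concentration inequality for averages of i.i.d. bounded
  \<open>L2 Q\<close>-valued variables, again by McDiarmid.\<close>

section \<open>The bounded differences inequality\<close>

text \<open>Subtracting the deviation of \<open>fstar\<close> costs nothing in expectation, because
  it has mean zero; it only doubles the bounded differences, which accounts for the factor
  \<open>2 * B\<close> of the confidence term. The obstacle is measurability: \<open>F\<close> may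
  be uncountable, and a one-sided supremum over it need not be measurable. Since the functionals in
  \<open>F\<close> share a Lipschitz constant and the mean embeddings form a separable subset of
  \<open>L2 Q\<close>, a countable subclass controls the deviations of all of \<open>F\<close>; it
  is exhausted by finite subclasses, where suprema are maxima. The confidence \<delta> is spent in
  three equal parts: on the deviation, on the \<open>n\<close> bags of samples, and on the random
  features at all sample points. The features are shared by all points but independent of them, so a
  union bound taken conditionally on the points suffices. Finally, the kernel diagonal is constantly
  \<open>c\<close> with \<open>0 < c \<le> 1\<close>; so \<open>c \<le> sqrt c\<close>, which turns
  bounds in \<open>c\<close> into the stated ones.\<close>

lemma (in prob_space) hoeffding_oscillation:
  fixes f :: "'a \<Rightarrow> real"
  assumes f [measurable]: "f \<in> borel_measurable M"
    and osc: "\<And>x y. x \<in> space M \<Longrightarrow> y \<in> space M \<Longrightarrow> \<bar>f x - f y\<bar> \<le> c"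
    and l: "l > 0"
  shows "(\<integral>\<^sup>+x. ennreal (exp (l * f x)) \<partial>M) \<le> ennreal (exp (l * expectation f + l\<^sup>2 * c\<^sup>2 / 8))"
proof -
  \<comment> \<open>Hoeffding's lemma is stated for an interval with explicit endpoints. Infimum and
    supremum give the shortest one, and the oscillation bound controls its length without fixing its
    position.\<close>
  define a where "a = (INF x\<in>space M. f x)"
  define b where "b = (SUP x\<in>space M. f x)"
  obtain x0 where x0: "x0 \<in> space M" using not_empty by auto
  have bdd: "bdd_below (f ` space M)" "bdd_above (f ` space M)"
    using osc[OF _ x0] by (force intro!: bdd_belowI2[of _ "f x0 - c"] bdd_aboveI2[of _ _ "f x0 + c"] simp: abs_le_iff)+
  have ab: "a \<le> f x" "f x \<le> b" if "x \<in> space M" for x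
    unfolding a_def b_def using bdd that by (auto intro: cINF_lower cSUP_upper)
  have "b \<le> a + c"
    unfolding b_def
  proof (rule cSUP_least)
    fix x assume x: "x \<in> space M"
    have "f x - c \<le> a" unfolding a_def
      by (rule cINF_greatest) (use x0 osc[OF x] in \<open>force simp: abs_le_iff\<close>)+
    then show "f x \<le> a + c" by simp
  qed (use x0 in auto)
  then have bac: "b - a \<le> c" by simp
  have ba: "0 \<le> b - a" using ab[OF x0] by simp
  interpret interval_bounded_random_variable M f a b
    by unfold_locales (use ab in auto)
  have "(\<integral>\<^sup>+x. ennreal (exp (l * f x)) \<partial>M)
      = (\<integral>\<^sup>+x. ennreal (exp (l * expectation f)) * ennreal (exp (l * (f x - expectation f))) \<partial>M)"
    by (intro nn_integral_cong) (simp add: ennreal_mult'[symmetric] exp_add[symmetric] algebra_simps)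
  also have "\<dots> = ennreal (exp (l * expectation f)) * (\<integral>\<^sup>+x. ennreal (exp (l * (f x - expectation f))) \<partial>M)"
    by (rule nn_integral_cmult) simp
  also have "\<dots> \<le> ennreal (exp (l * expectation f)) * ennreal (exp (l\<^sup>2 * (b - a)\<^sup>2 / 8))"
    using Hoeffdings_lemma_nn_integral[OF l] by (intro mult_left_mono) (auto simp: algebra_simps)
  also have "\<dots> = ennreal (exp (l * expectation f + l\<^sup>2 * (b - a)\<^sup>2 / 8))"
    by (simp add: ennreal_mult'[symmetric] exp_add)
  also have "\<dots> \<le> ennreal (exp (l * expectation f + l\<^sup>2 * c\<^sup>2 / 8))"
    using bac ba by (intro ennreal_leI) (auto intro!: mult_left_mono power_mono)
  finally show ?thesis .
qed

text \<open>The martingale argument with Fubini in place of conditional expectations: the new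
  coordinate is integrated out, Hoeffding's lemma pays
  \<open>exp (l\<^sup>2 * (c i)\<^sup>2 / 8)\<close> for it, and the partial mean \<open>h\<close>
  inherits the bound \<open>K\<close> and the bounded differences in the remaining
  coordinates.\<close>

lemma bounded_differences_mgf:
  fixes N :: "'i \<Rightarrow> 'a measure" and g :: "('i \<Rightarrow> 'a) \<Rightarrow> real"
  assumes N: "\<And>i. prob_space (N i)" and I: "finite I"
    and g: "g \<in> borel_measurable (PiM I N)"
    and bdd: "\<And>x. x \<in> space (PiM I N) \<Longrightarrow> \<bar>g x\<bar> \<le> K"
    and diff: "\<And>x i y. x \<in> space (PiM I N) \<Longrightarrow> i \<in> I \<Longrightarrow> y \<in> space (N i) \<Longrightarrow> \<bar>g (x(i := y)) - g x\<bar> \<le> c i"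
    and l: "l > 0"
  shows "(\<integral>\<^sup>+x. ennreal (exp (l * g x)) \<partial>PiM I N)
           \<le> ennreal (exp (l * (\<integral>x. g x \<partial>PiM I N) + l\<^sup>2 * (\<Sum>i\<in>I. (c i)\<^sup>2) / 8))"
  using I g bdd diff
proof (induction I arbitrary: g rule: finite_induct)
  case empty
  interpret product_prob_space N "{}"
    using N by (auto simp: product_prob_space_def product_prob_space_axioms_def product_sigma_finite_def
        intro: prob_space_imp_sigma_finite)
  show ?case by (simp add: PiM_empty nn_integral_count_space_finite lebesgue_integral_count_space_finite)
next
  case (insert i I)
  interpret product_prob_space N "insert i I"
    using N by (auto simp: product_prob_space_def product_prob_space_axioms_def product_sigma_finite_def
        intro: prob_space_imp_sigma_finite)
  interpret PI: prob_space "PiM I N" using N by (intro prob_space_PiM)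
  have PiI: "prob_space (PiM (insert i I) N)" using N by (intro prob_space_PiM)
  note [measurable] = insert.prems(1)
  define h where "h x = (\<integral>y. g (x(i := y)) \<partial>N i)" for x
  have upd: "x(i := y) \<in> space (PiM (insert i I) N)" if "x \<in> space (PiM I N)" "y \<in> space (N i)" for x y
    using that by (auto simp: space_PiM PiE_iff extensional_def)
  have gm: "(\<lambda>(x,y). g (x(i := y))) \<in> borel_measurable (PiM I N \<Otimes>\<^sub>M N i)"
    using measurable_compose[OF measurable_add_dim insert.prems(1)] by (simp add: case_prod_unfold)
  have gm1: "(\<lambda>y. g (x(i := y))) \<in> borel_measurable (N i)" if "x \<in> space (PiM I N)" for x
    using measurable_compose[OF measurable_Pair1'[OF that] gm] by simp
  have gint: "integrable (N i) (\<lambda>y. g (x(i := y)))" if "x \<in> space (PiM I N)" for x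
    using gm1[OF that] insert.prems(2) upd[OF that]
    by (intro M.integrable_const_bound[where B=K]) (auto intro!: AE_I2)
  have hm [measurable]: "h \<in> borel_measurable (PiM I N)"
    unfolding h_def by (rule M.borel_measurable_lebesgue_integral[OF gm])
  have hb: "\<bar>h x\<bar> \<le> K" if "x \<in> space (PiM I N)" for x
  proof -
    have "\<bar>h x\<bar> \<le> (\<integral>y. \<bar>g (x(i := y))\<bar> \<partial>N i)" unfolding h_def by (rule integral_abs_bound)
    also have "\<dots> \<le> (\<integral>y. K \<partial>N i)"
      using gint[OF that] insert.prems(2) upd[OF that] by (intro integral_mono) auto
    finally show ?thesis by (simp add: M.prob_space)
  qed
  have hd: "\<bar>h (x(j := z)) - h x\<bar> \<le> c j" if x: "x \<in> space (PiM I N)" and j: "j \<in> I" and z: "z \<in> space (N j)" for x j z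
  proof -
    have ij: "i \<noteq> j" using j insert by auto
    have xj: "x(j := z) \<in> space (PiM I N)" using x j z by (auto simp: space_PiM PiE_iff extensional_def)
    have "h (x(j := z)) - h x = (\<integral>y. g (x(j := z, i := y)) - g (x(i := y)) \<partial>N i)"
      unfolding h_def using gint[OF x] gint[OF xj] by simp
    also have "\<bar>\<dots>\<bar> \<le> (\<integral>y. \<bar>g (x(j := z, i := y)) - g (x(i := y))\<bar> \<partial>N i)" by (rule integral_abs_bound)
    also have "\<dots> \<le> (\<integral>y. c j \<partial>N i)"
    proof (rule integral_mono)
      fix y assume y: "y \<in> space (N i)"
      show "\<bar>g (x(j := z, i := y)) - g (x(i := y))\<bar> \<le> c j"
        \<comment> \<open>Updates at distinct coordinates commute, so the change in \<open>j\<close>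
          can be read at the point \<open>x(i := y)\<close>.\<close>
        unfolding fun_upd_twist[OF ij[symmetric], of x z y]
        by (rule insert.prems(3)[OF upd[OF x y]]) (use j z in auto)
    qed (use gint[OF x] gint[OF xj] in auto)
    finally show ?thesis by (simp add: M.prob_space)
  qed
  have "(\<integral>\<^sup>+x. ennreal (exp (l * g x)) \<partial>PiM (insert i I) N)
      = (\<integral>\<^sup>+x. (\<integral>\<^sup>+y. ennreal (exp (l * g (x(i := y)))) \<partial>N i) \<partial>PiM I N)"
    using insert.hyps by (subst product_nn_integral_insert) auto
  also have "\<dots> \<le> (\<integral>\<^sup>+x. ennreal (exp (l * h x)) * ennreal (exp (l\<^sup>2 * (c i)\<^sup>2 / 8)) \<partial>PiM I N)"
  proof (rule nn_integral_mono)
    fix x assume x: "x \<in> space (PiM I N)"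
    have "(\<integral>\<^sup>+y. ennreal (exp (l * g (x(i := y)))) \<partial>N i) \<le> ennreal (exp (l * h x + l\<^sup>2 * (c i)\<^sup>2 / 8))"
      unfolding h_def
    proof (rule M.hoeffding_oscillation[OF gm1[OF x] _ l])
      fix y z assume "y \<in> space (N i)" "z \<in> space (N i)"
      then show "\<bar>g (x(i := y)) - g (x(i := z))\<bar> \<le> c i"
        using insert.prems(3)[OF upd[OF x], of z i y] fun_upd_upd[of x i z y]
        by (metis insertI1)
    qed
    then show "(\<integral>\<^sup>+y. ennreal (exp (l * g (x(i := y)))) \<partial>N i) \<le> ennreal (exp (l * h x)) * ennreal (exp (l\<^sup>2 * (c i)\<^sup>2 / 8))"
      by (simp add: ennreal_mult'[symmetric] exp_add)
  qed
  also have "\<dots> = (\<integral>\<^sup>+x. ennreal (exp (l * h x)) \<partial>PiM I N) * ennreal (exp (l\<^sup>2 * (c i)\<^sup>2 / 8))"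
    by (rule nn_integral_multc) measurable
  also have "\<dots> \<le> ennreal (exp (l * (\<integral>x. h x \<partial>PiM I N) + l\<^sup>2 * (\<Sum>i\<in>I. (c i)\<^sup>2) / 8)) * ennreal (exp (l\<^sup>2 * (c i)\<^sup>2 / 8))"
    by (intro mult_right_mono insert.IH hm hb hd) auto
  also have "(\<integral>x. h x \<partial>PiM I N) = (\<integral>x. g x \<partial>PiM (insert i I) N)"
    unfolding h_def using insert.hyps insert.prems(2)
    by (subst product_integral_insert)
       (auto intro!: finite_measure.integrable_const_bound[OF prob_space.finite_measure[OF PiI], where B=K] AE_I2)
  finally show ?case using insert.hyps
    by (simp add: ennreal_mult'[symmetric] exp_add[symmetric] algebra_simps add_divide_distrib)
qed

text \<open>Chernoff's method with the best exponent. The strict threshold keeps the statement true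
  in the degenerate case where all \<open>c i\<close> vanish and \<open>g\<close> equals its
  mean.\<close>

lemma bounded_differences:
  fixes N :: "'i \<Rightarrow> 'a measure" and g :: "('i \<Rightarrow> 'a) \<Rightarrow> real"
  assumes N: "\<And>i. prob_space (N i)" and I: "finite I"
    and g: "g \<in> borel_measurable (PiM I N)"
    and bdd: "\<And>x. x \<in> space (PiM I N) \<Longrightarrow> \<bar>g x\<bar> \<le> K"
    and diff: "\<And>x i y. x \<in> space (PiM I N) \<Longrightarrow> i \<in> I \<Longrightarrow> y \<in> space (N i) \<Longrightarrow> \<bar>g (x(i := y)) - g x\<bar> \<le> c i"
    and \<eta>: "0 < \<eta>" "\<eta> < 1"
  shows "measure (PiM I N) {x \<in> space (PiM I N). g x > (\<integral>x. g x \<partial>PiM I N) + sqrt ((\<Sum>i\<in>I. (c i)\<^sup>2) * ln (1 / \<eta>) / 2)} \<le> \<eta>"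
proof -
  interpret P: prob_space "PiM I N" using N by (intro prob_space_PiM)
  note [measurable] = g
  define m where "m = (\<integral>x. g x \<partial>PiM I N)"
  define C where "C = (\<Sum>i\<in>I. (c i)\<^sup>2)"
  define L where "L = ln (1 / \<eta>)"
  have L: "L > 0" unfolding L_def using \<eta> by simp
  have C0: "C \<ge> 0" unfolding C_def by (intro sum_nonneg) auto
  have eL: "exp (- L) = \<eta>" unfolding L_def using \<eta> by (simp add: ln_div)
  have chernoff: "measure (PiM I N) {x \<in> space (PiM I N). g x \<ge> m + t} \<le> exp (l\<^sup>2 * C / 8 - l * t)" if l: "l > 0" for l t
  proof -
    have "emeasure (PiM I N) {x \<in> space (PiM I N). g x \<ge> m + t}
        \<le> ennreal (exp (- l * (m + t))) * (\<integral>\<^sup>+x. ennreal (exp (l * g x)) * indicator (space (PiM I N)) x \<partial>PiM I N)"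
      by (rule Chernoff_ineq_nn_integral_ge[OF l]) auto
    also have "(\<integral>\<^sup>+x. ennreal (exp (l * g x)) * indicator (space (PiM I N)) x \<partial>PiM I N) = (\<integral>\<^sup>+x. ennreal (exp (l * g x)) \<partial>PiM I N)"
      by (intro nn_integral_cong) (auto simp: indicator_def)
    also have "ennreal (exp (- l * (m + t))) * \<dots> \<le> ennreal (exp (- l * (m + t))) * ennreal (exp (l * m + l\<^sup>2 * C / 8))"
      unfolding m_def C_def using bounded_differences_mgf[OF N I g bdd diff l] by (intro mult_left_mono) auto
    also have "\<dots> = ennreal (exp (l\<^sup>2 * C / 8 - l * t))"
      by (simp add: ennreal_mult'[symmetric] exp_add[symmetric] algebra_simps)
    finally show ?thesis by (simp add: P.emeasure_eq_measure)
  qed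
  define t where "t = sqrt (C * L / 2)"
  show ?thesis
  proof (cases "C = 0")
    case False
    then have C: "C > 0" using C0 by simp
    have t: "t > 0" unfolding t_def using C L by simp
    have tt: "t\<^sup>2 = C * L / 2" unfolding t_def using C L by simp
    \<comment> \<open>\<open>l = 4 * t / C\<close> minimises the quadratic exponent
      \<open>l\<^sup>2 * C / 8 - l * t\<close>, and \<open>t\<close> was chosen to make the minimum
      \<open>- L\<close>.\<close>
    have ex: "(4 * t / C)\<^sup>2 * C / 8 - (4 * t / C) * t = - L"
    proof -
      have "(4 * t / C)\<^sup>2 * C / 8 - (4 * t / C) * t = - 2 * t\<^sup>2 / C"
        using C by (simp add: field_simps power2_eq_square)
      also have "\<dots> = - L" unfolding tt using C by simp
      finally show ?thesis .
    qed
    have "measure (PiM I N) {x \<in> space (PiM I N). g x > m + t} \<le> measure (PiM I N) {x \<in> space (PiM I N). g x \<ge> m + t}"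
      by (intro P.finite_measure_mono) auto
    also have "\<dots> \<le> exp (- L)"
      using chernoff[of "4 * t / C" t] t C unfolding ex by simp
    finally show ?thesis unfolding eL by (simp add: m_def C_def L_def t_def)
  next
    case True
    \<comment> \<open>With \<open>C = 0\<close> the exponent is linear in \<open>l\<close>, so
      \<open>l = L / t\<close> already yields \<eta> for every positive margin \<open>t\<close>. The
      event that \<open>g\<close> strictly exceeds its mean is the increasing union of the events
      with margins \<open>1 / (n + 1)\<close>.\<close>
    have null: "measure (PiM I N) {x \<in> space (PiM I N). g x \<ge> m + t} \<le> \<eta>" if t: "t > 0" for t
      using chernoff[of "L / t" t] t L by (simp add: True eL)
    have lim: "(\<lambda>n. measure (PiM I N) {x \<in> space (PiM I N). g x \<ge> m + inverse (real (Suc n))}) \<longlonglongrightarrow>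
        measure (PiM I N) (\<Union>n. {x \<in> space (PiM I N). g x \<ge> m + inverse (real (Suc n))})"
    proof (rule P.finite_Lim_measure_incseq)
      show "incseq (\<lambda>n. {x \<in> space (PiM I N). g x \<ge> m + inverse (real (Suc n))})"
      proof (rule incseq_SucI, safe)
        fix n x assume "m + inverse (real (Suc n)) \<le> g x"
        moreover have "inverse (real (Suc (Suc n))) \<le> inverse (real (Suc n))" by (intro le_imp_inverse_le) auto
        ultimately show "m + inverse (real (Suc (Suc n))) \<le> g x" by linarith
      qed
    qed auto
    have "measure (PiM I N) (\<Union>n. {x \<in> space (PiM I N). g x \<ge> m + inverse (real (Suc n))}) \<le> \<eta>"
      by (rule LIMSEQ_le_const2[OF lim]) (auto intro!: null)
    also have "(\<Union>n. {x \<in> space (PiM I N). g x \<ge> m + inverse (real (Suc n))}) = {x \<in> space (PiM I N). g x > m + t}"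
    proof (intro equalityI subsetI)
      fix x assume "x \<in> {x \<in> space (PiM I N). g x > m + t}"
      then have x: "x \<in> space (PiM I N)" "g x - m > 0" by (auto simp: t_def True)
      then obtain n where "inverse (real (Suc n)) < g x - m" using reals_Archimedean by blast
      then show "x \<in> (\<Union>n. {x \<in> space (PiM I N). g x \<ge> m + inverse (real (Suc n))})" using x by (auto intro!: exI[of _ n])
    next
      fix x assume "x \<in> (\<Union>n. {x \<in> space (PiM I N). g x \<ge> m + inverse (real (Suc n))})"
      then obtain n where n: "x \<in> space (PiM I N)" "g x \<ge> m + inverse (real (Suc n))" by auto
      moreover have "0 < inverse (real (Suc n))" by simp
      ultimately have "g x > m" by linarith
      then show "x \<in> {x \<in> space (PiM I N). g x > m + t}" using n by (simp add: t_def True)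
    qed
    finally show ?thesis by (simp add: m_def C_def L_def t_def)
  qed
qed

section \<open>Concentration of averages in \<open>L2 Q\<close>\<close>

lemma L2norm_nonneg [simp]: "0 \<le> L2norm Q h"
  by (simp add: L2norm_def)

lemma L2norm_power2: "(L2norm Q h)\<^sup>2 = (LINT x|Q. (h x)\<^sup>2)"
  by (simp add: L2norm_def)

lemma (in prob_space) L2_boundedI:
  assumes "h \<in> borel_measurable M" "\<And>x. x \<in> space M \<Longrightarrow> \<bar>h x\<bar> \<le> b"
  shows "h \<in> L2 M"
proof -
  have "norm ((h x)\<^sup>2) \<le> b\<^sup>2" if "x \<in> space M" for x
    using power_mono[OF assms(2)[OF that], of 2] by simp
  then show ?thesis
    unfolding L2_def using assms(1) by (auto intro!: integrable_const_bound[where B="b\<^sup>2"] AE_I2)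
qed

lemma (in prob_space) L2norm_bounded:
  assumes "h \<in> borel_measurable M" "\<And>x. x \<in> space M \<Longrightarrow> \<bar>h x\<bar> \<le> b" "0 \<le> b"
  shows "L2norm M h \<le> b"
proof -
  have "(LINT x|M. (h x)\<^sup>2) \<le> (LINT x|M. b\<^sup>2)"
    using L2_boundedI[OF assms(1,2)] assms
    by (intro integral_mono) (auto simp: L2_def abs_le_square_iff[symmetric])
  then show ?thesis using assms(3)
    by (simp add: L2norm_def prob_space real_le_lsqrt)
qed

lemma L2_add:
  assumes "u \<in> L2 Q" "v \<in> L2 Q"
  shows "(\<lambda>x. u x + v x) \<in> L2 Q"
proof -
  have [measurable]: "u \<in> borel_measurable Q" "v \<in> borel_measurable Q" using assms by (auto simp: L2_def)
  have "integrable Q (\<lambda>x. 2 * (u x)\<^sup>2 + 2 * (v x)\<^sup>2)" using assms by (auto simp: L2_def)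
  then have "integrable Q (\<lambda>x. (u x + v x)\<^sup>2)"
  proof (rule Bochner_Integration.integrable_bound)
    show "AE x in Q. norm ((u x + v x)\<^sup>2) \<le> norm (2 * (u x)\<^sup>2 + 2 * (v x)\<^sup>2)"
    proof (rule AE_I2)
      fix x
      have "0 \<le> (u x - v x)\<^sup>2" by simp
      then have "(u x + v x)\<^sup>2 \<le> 2 * (u x)\<^sup>2 + 2 * (v x)\<^sup>2" by (simp add: power2_eq_square algebra_simps)
      then show "norm ((u x + v x)\<^sup>2) \<le> norm (2 * (u x)\<^sup>2 + 2 * (v x)\<^sup>2)" by simp
    qed
  qed measurable
  then show ?thesis by (simp add: L2_def)
qed

lemma L2_scale: "u \<in> L2 Q \<Longrightarrow> (\<lambda>x. a * u x) \<in> L2 Q"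
  by (auto simp: L2_def power_mult_distrib)

lemma L2_diff:
  assumes "u \<in> L2 Q" "v \<in> L2 Q"
  shows "(\<lambda>x. u x - v x) \<in> L2 Q"
  using L2_add[OF assms(1) L2_scale[OF assms(2), of "-1"]] by simp

lemma L2_sum:
  assumes "\<And>j. j \<in> J \<Longrightarrow> u j \<in> L2 Q"
  shows "(\<lambda>x. \<Sum>j\<in>J. u j x) \<in> L2 Q"
  using assms
proof (induction J rule: infinite_finite_induct)
  case (insert j J)
  then show ?case using L2_add[of "u j" Q "\<lambda>x. \<Sum>j\<in>J. u j x"] by simp
qed (auto simp: L2_def)

text \<open>Minkowski's inequality from the pointwise convexity bound \<open>(u + v)\<^sup>2 \<le>
  (A + B) * (u\<^sup>2 / A + v\<^sup>2 / B)\<close>: with \<open>A\<close> and \<open>B\<close> just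
  above the two norms, integration gives \<open>(A + B)\<^sup>2\<close>. The margin
  \<open>e / 2\<close> keeps the divisors positive when a norm vanishes.\<close>

lemma L2norm_triangle:
  assumes "u \<in> L2 Q" "v \<in> L2 Q"
  shows "L2norm Q (\<lambda>x. u x + v x) \<le> L2norm Q u + L2norm Q v"
proof (rule field_le_epsilon)
  fix e :: real assume e: "e > 0"
  define A where "A = L2norm Q u + e / 2"
  define B where "B = L2norm Q v + e / 2"
  have A: "A > 0" and B: "B > 0" unfolding A_def B_def using e by (auto intro: add_nonneg_pos)
  have Au: "(LINT x|Q. (u x)\<^sup>2) \<le> A\<^sup>2" and Bv: "(LINT x|Q. (v x)\<^sup>2) \<le> B\<^sup>2"
    unfolding L2norm_power2[symmetric] A_def B_def using e by (auto intro!: power_mono)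
  have pw: "(u x + v x)\<^sup>2 \<le> (A + B) * ((u x)\<^sup>2 / A + (v x)\<^sup>2 / B)" for x
  proof -
    have "(A + B) * ((u x)\<^sup>2 / A + (v x)\<^sup>2 / B) - (u x + v x)\<^sup>2 = (B * u x - A * v x)\<^sup>2 / (A * B)"
      using A B by (simp add: field_simps power2_eq_square)
    also have "\<dots> \<ge> 0" using A B by simp
    finally show ?thesis by simp
  qed
  have "(LINT x|Q. (u x + v x)\<^sup>2) \<le> (LINT x|Q. (A + B) * ((u x)\<^sup>2 / A + (v x)\<^sup>2 / B))"
    using assms L2_add[OF assms] by (intro integral_mono pw) (auto simp: L2_def)
  also have "\<dots> = (A + B) * ((LINT x|Q. (u x)\<^sup>2) / A + (LINT x|Q. (v x)\<^sup>2) / B)"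
    using assms by (auto simp: L2_def)
  also have "\<dots> \<le> (A + B) * (A\<^sup>2 / A + B\<^sup>2 / B)"
    using A B Au Bv by (intro mult_left_mono add_mono divide_right_mono) auto
  also have "\<dots> = (A + B)\<^sup>2" using A B by (simp add: power2_eq_square)
  finally have "L2norm Q (\<lambda>x. u x + v x) \<le> A + B"
    unfolding L2norm_def using A B by (intro real_le_lsqrt) auto
  then show "L2norm Q (\<lambda>x. u x + v x) \<le> L2norm Q u + L2norm Q v + e" by (simp add: A_def B_def)
qed

lemma L2norm_minus_commute: "L2norm Q (\<lambda>x. u x - v x) = L2norm Q (\<lambda>x. v x - u x)"
  by (simp add: L2norm_def power2_commute)

lemma L2norm_scale: "L2norm Q (\<lambda>x. a * u x) = \<bar>a\<bar> * L2norm Q u"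
  by (simp add: L2norm_def power_mult_distrib real_sqrt_mult)

lemma L2norm_diff_le:
  assumes "u \<in> L2 Q" "v \<in> L2 Q" "w \<in> L2 Q"
  shows "L2norm Q (\<lambda>x. u x - w x) \<le> L2norm Q (\<lambda>x. u x - v x) + L2norm Q (\<lambda>x. v x - w x)"
  using L2norm_triangle[OF L2_diff[OF assms(1,2)] L2_diff[OF assms(2,3)]] by simp

lemma L2norm_abs_diff_le:
  assumes "u \<in> L2 Q" "v \<in> L2 Q"
  shows "\<bar>L2norm Q u - L2norm Q v\<bar> \<le> L2norm Q (\<lambda>x. u x - v x)"
proof -
  have z: "(\<lambda>x. 0) \<in> L2 Q" by (simp add: L2_def)
  show ?thesis
    using L2norm_diff_le[OF assms z] L2norm_diff_le[OF assms(2,1) z] L2norm_minus_commute[of Q u v]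
    by simp
qed

lemma L2norm_sum:
  assumes "\<And>j. j \<in> J \<Longrightarrow> u j \<in> L2 Q"
  shows "L2norm Q (\<lambda>x. \<Sum>j\<in>J. u j x) \<le> (\<Sum>j\<in>J. L2norm Q (u j))"
  using assms
proof (induction J rule: infinite_finite_induct)
  case (insert j J)
  then show ?case
    using L2norm_triangle[of "u j" Q "\<lambda>x. \<Sum>j\<in>J. u j x"] L2_sum[of J u Q] by simp
qed (auto simp: L2norm_def)

text \<open>Orthogonality of centred independent variables: integrating over the new coordinate
  first kills the mixed term \<open>2 * S * h y\<close>, so each index adds one variance.\<close>

lemma (in prob_space) integral_iid_sum_power2:
  fixes h :: "'a \<Rightarrow> real"
  assumes I: "finite I" and h: "h \<in> borel_measurable M" and hb: "\<And>z. z \<in> space M \<Longrightarrow> \<bar>h z\<bar> \<le> b"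
    and mean: "expectation h = 0"
  shows "(\<integral>X. (\<Sum>j\<in>I. h (X j))\<^sup>2 \<partial>PiM I (\<lambda>_. M)) = real (card I) * expectation (\<lambda>z. (h z)\<^sup>2)"
  using I
proof (induction I rule: finite_induct)
  case empty
  then show ?case by simp
next
  case (insert i I)
  note [measurable] = h
  interpret PS: product_prob_space "\<lambda>_. M" "insert i I" by unfold_locales
  interpret PI: prob_space "PiM I (\<lambda>_. M)" by (intro prob_space_PiM) unfold_locales
  have PiI: "prob_space (PiM (insert i I) (\<lambda>_. M))" by (intro prob_space_PiM) unfold_locales
  have hi: "integrable M h" and h2: "integrable M (\<lambda>z. (h z)\<^sup>2)"
    using L2_boundedI[OF h hb] hb by (auto simp: L2_def intro!: integrable_const_bound[where B=b])
  have Sb: "\<bar>\<Sum>j\<in>J. h (X j)\<bar> \<le> real (card J) * b" if "X \<in> space (PiM J (\<lambda>_. M))" for J and X :: "'b \<Rightarrow> 'a"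
    using that hb by (intro order.trans[OF sum_abs] sum_bounded_above) (auto simp: space_PiM PiE_iff)
  have S2: "integrable (PiM I (\<lambda>_. M)) (\<lambda>X. (\<Sum>j\<in>I. h (X j))\<^sup>2)"
    using PI.L2_boundedI[OF _ Sb] by (auto simp: L2_def)
  have S2': "integrable (PiM (insert i I) (\<lambda>_. M)) (\<lambda>X. (\<Sum>j\<in>insert i I. h (X j))\<^sup>2)"
  proof -
    have "(\<lambda>X. \<Sum>j\<in>insert i I. h (X j)) \<in> L2 (PiM (insert i I) (\<lambda>_. M))"
      by (rule prob_space.L2_boundedI[OF PiI _ Sb]) measurable
    then show ?thesis by (simp add: L2_def)
  qed
  have "(\<integral>X. (\<Sum>j\<in>insert i I. h (X j))\<^sup>2 \<partial>PiM (insert i I) (\<lambda>_. M))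
     = (\<integral>X. (\<integral>y. (\<Sum>j\<in>insert i I. h ((X(i := y)) j))\<^sup>2 \<partial>M) \<partial>PiM I (\<lambda>_. M))"
    using insert.hyps S2' by (subst PS.product_integral_insert) auto
  also have "\<dots> = (\<integral>X. (\<Sum>j\<in>I. h (X j))\<^sup>2 + expectation (\<lambda>z. (h z)\<^sup>2) \<partial>PiM I (\<lambda>_. M))"
  proof (rule Bochner_Integration.integral_cong[OF refl])
    fix X :: "'b \<Rightarrow> 'a"
    define S where "S = (\<Sum>j\<in>I. h (X j))"
    have "(\<Sum>j\<in>I. h ((X(i := y)) j)) = S" for y
      unfolding S_def using insert.hyps by (intro sum.cong) auto
    then have "(\<integral>y. (\<Sum>j\<in>insert i I. h ((X(i := y)) j))\<^sup>2 \<partial>M) = (\<integral>y. S\<^sup>2 + 2 * S * h y + (h y)\<^sup>2 \<partial>M)"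
      using insert.hyps by (intro Bochner_Integration.integral_cong) (auto simp: power2_eq_square algebra_simps)
    also have "\<dots> = S\<^sup>2 + expectation (\<lambda>z. (h z)\<^sup>2)"
      using hi h2 by (simp add: mean prob_space)
    finally show "(\<integral>y. (\<Sum>j\<in>insert i I. h ((X(i := y)) j))\<^sup>2 \<partial>M) = S\<^sup>2 + expectation (\<lambda>z. (h z)\<^sup>2)" .
  qed
  also have "\<dots> = (\<integral>X. (\<Sum>j\<in>I. h (X j))\<^sup>2 \<partial>PiM I (\<lambda>_. M)) + expectation (\<lambda>z. (h z)\<^sup>2)"
    using S2 by (simp add: PI.prob_space)
  finally show ?case using insert by (simp add: algebra_simps)
qed

text \<open>At each fixed \<open>x\<close> the average of \<open>N\<close> independent copies has
  variance at most \<open>b\<^sup>2 / N\<close>, and Fubini carries this into the squared norm. The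
  bound on the mean of \<psi> serves twice: as the centre for the bounded differences inequality,
  and to produce good samples in the separability argument.\<close>

lemma (in prob_space) L2norm_average_mean_square:
  fixes G :: "'a \<Rightarrow> 'x \<Rightarrow> real"
  assumes Q: "prob_space Q" and N: "N > 0"
    and G: "(\<lambda>(z, x). G z x) \<in> borel_measurable (M \<Otimes>\<^sub>M Q)"
    and Gb: "\<And>z x. z \<in> space M \<Longrightarrow> x \<in> space Q \<Longrightarrow> \<bar>G z x\<bar> \<le> b"
  defines "\<psi> \<equiv> \<lambda>X. L2norm Q (\<lambda>x. (1 / real N) * (\<Sum>j<N. G (X j) x) - expectation (\<lambda>z. G z x))"
  shows "\<psi> \<in> borel_measurable (PiM {..<N} (\<lambda>_. M))"
    and "\<And>X. X \<in> space (PiM {..<N} (\<lambda>_. M)) \<Longrightarrow> \<psi> X \<le> 2 * b"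
    and "(\<integral>X. (\<psi> X)\<^sup>2 \<partial>PiM {..<N} (\<lambda>_. M)) \<le> b\<^sup>2 / real N"
    and "(\<integral>X. \<psi> X \<partial>PiM {..<N} (\<lambda>_. M)) \<le> b / sqrt (real N)"
proof -
  interpret Q: prob_space Q by fact
  let ?P = "PiM {..<N} (\<lambda>_. M)"
  interpret P: prob_space ?P by (intro prob_space_PiM) unfold_locales
  interpret PQ: pair_sigma_finite ?P Q by unfold_locales
  interpret PQ': prob_space "?P \<Otimes>\<^sub>M Q" by (intro prob_space_pair P.prob_space_axioms Q)
  obtain z0 x0 where "z0 \<in> space M" "x0 \<in> space Q" using not_empty Q.not_empty by blast
  then have b: "b \<ge> 0" using Gb[of z0 x0] by linarith
  note [measurable] = G
  define g where "g x = expectation (\<lambda>z. G z x)" for x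
  have Gx [measurable]: "(\<lambda>z. G z x) \<in> borel_measurable M" if "x \<in> space Q" for x
    using measurable_compose[OF measurable_Pair2'[OF that] G] by simp
  have Gint: "integrable M (\<lambda>z. G z x)" if "x \<in> space Q" for x
    using that Gb by (intro integrable_const_bound[where B=b]) auto
  have gb: "\<bar>g x\<bar> \<le> b" if "x \<in> space Q" for x
  proof -
    have "\<bar>g x\<bar> \<le> (\<integral>z. \<bar>G z x\<bar> \<partial>M)" unfolding g_def by (rule integral_abs_bound)
    also have "\<dots> \<le> (\<integral>z. b \<partial>M)" using Gint[OF that] Gb that by (intro integral_mono) auto
    finally show ?thesis by (simp add: prob_space)
  qed
  have gm [measurable]: "g \<in> borel_measurable Q"
    unfolding g_def by (rule borel_measurable_lebesgue_integral) simp
  let ?A = "\<lambda>X x. (1 / real N) * (\<Sum>j<N. G (X j) x) - g x"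
  have Am [measurable]: "(\<lambda>(X, x). ?A X x) \<in> borel_measurable (?P \<Otimes>\<^sub>M Q)"
  proof -
    have "(\<lambda>p. G (fst p j) (snd p)) \<in> borel_measurable (?P \<Otimes>\<^sub>M Q)" if "j < N" for j
      using that measurable_compose[OF _ G, of "\<lambda>p. (fst p j, snd p)" "?P \<Otimes>\<^sub>M Q"] by simp
    then show ?thesis by (simp add: case_prod_unfold)
  qed
  have Xj: "X j \<in> space M" if "X \<in> space ?P" "j < N" for X j using that by (auto simp: space_PiM)
  have avg: "\<bar>(1 / real N) * (\<Sum>j<N. G (X j) x)\<bar> \<le> b" if "X \<in> space ?P" "x \<in> space Q" for X x
  proof -
    have "\<bar>\<Sum>j<N. G (X j) x\<bar> \<le> real N * b"
      using sum_bounded_above[of "{..<N}" "\<lambda>j. \<bar>G (X j) x\<bar>" b] Gb Xj that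
      by (intro order.trans[OF sum_abs]) auto
    then show ?thesis using N by (simp add: abs_mult field_simps)
  qed
  have Ab: "\<bar>?A X x\<bar> \<le> 2 * b" if "X \<in> space ?P" "x \<in> space Q" for X x
    using avg[OF that] gb[OF that(2)] by linarith
  have AX: "?A X \<in> borel_measurable Q" if "X \<in> space ?P" for X
    using measurable_compose[OF measurable_Pair1'[OF that] Am] by simp
  have A2b: "(?A X x)\<^sup>2 \<le> (2 * b)\<^sup>2" if "X \<in> space ?P" "x \<in> space Q" for X x
    using power_mono[OF Ab[OF that], of 2] by (simp only: power2_abs)
  have A2: "integrable (?P \<Otimes>\<^sub>M Q) (\<lambda>(X, x). (?A X x)\<^sup>2)"
    using A2b by (intro PQ'.integrable_const_bound[where B="(2 * b)\<^sup>2"] AE_I2) (auto simp: space_pair_measure)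
  have \<psi>: "\<psi> = (\<lambda>X. sqrt (\<integral>x. (?A X x)\<^sup>2 \<partial>Q))" unfolding \<psi>_def g_def L2norm_def by simp
  have \<psi>L: "\<psi> X = L2norm Q (?A X)" for X unfolding \<psi>_def g_def by simp
  have "(\<lambda>X. \<integral>x. (?A X x)\<^sup>2 \<partial>Q) \<in> borel_measurable ?P"
    by (rule Q.borel_measurable_lebesgue_integral) (use Am in measurable)
  then show m [measurable]: "\<psi> \<in> borel_measurable ?P"
    unfolding \<psi> by measurable
  show bd: "\<psi> X \<le> 2 * b" if "X \<in> space ?P" for X
    unfolding \<psi>L by (rule Q.L2norm_bounded[OF AX[OF that] Ab[OF that]]) (use b in auto)
  have "(\<integral>X. (\<psi> X)\<^sup>2 \<partial>?P) = (\<integral>X. (\<integral>x. (?A X x)\<^sup>2 \<partial>Q) \<partial>?P)"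
    unfolding \<psi>L L2norm_power2 ..
  also have "\<dots> = (\<integral>x. (\<integral>X. (?A X x)\<^sup>2 \<partial>?P) \<partial>Q)"
    by (rule PQ.Fubini_integral[symmetric, OF A2])
  also have "\<dots> \<le> (\<integral>x. b\<^sup>2 / real N \<partial>Q)"
  proof (rule integral_mono)
    show "integrable Q (\<lambda>x. (\<integral>X. (?A X x)\<^sup>2 \<partial>?P))"
      using PQ.integrable_snd[OF A2] by simp
    fix x assume x: "x \<in> space Q"
    define h where "h z = G z x - g x" for z
    have hm: "h \<in> borel_measurable M" unfolding h_def using x by measurable
    have hb: "\<bar>h z\<bar> \<le> 2 * b" if "z \<in> space M" for z
      unfolding h_def using Gb[OF that x] gb[OF x] by linarith
    have h0: "expectation h = 0" unfolding h_def using Gint[OF x] by (simp add: prob_space g_def)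
    have eq: "?A X x = (1 / real N) * (\<Sum>j<N. h (X j))" for X
      using N by (simp add: h_def sum_subtractf field_simps)
    have G2: "integrable M (\<lambda>z. (G z x)\<^sup>2)"
      using L2_boundedI[OF Gx[OF x], of b] Gb x by (auto simp: L2_def)
    have "(\<integral>X. (?A X x)\<^sup>2 \<partial>?P) = (1 / real N)\<^sup>2 * (\<integral>X. (\<Sum>j<N. h (X j))\<^sup>2 \<partial>?P)"
      unfolding eq power_mult_distrib by simp
    also have "\<dots> = expectation (\<lambda>z. (h z)\<^sup>2) / real N"
      using N by (subst integral_iid_sum_power2[OF _ hm hb h0]) (auto simp: power2_eq_square)
    also have "expectation (\<lambda>z. (h z)\<^sup>2) = expectation (\<lambda>z. (G z x)\<^sup>2) - (g x)\<^sup>2"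
      unfolding h_def g_def by (rule variance_eq[OF Gint[OF x] G2])
    also have "\<dots> \<le> expectation (\<lambda>z. b\<^sup>2)"
    proof -
      have "expectation (\<lambda>z. (G z x)\<^sup>2) \<le> expectation (\<lambda>z. b\<^sup>2)"
        using Gb x b by (intro integral_mono G2) (auto simp: abs_le_square_iff[symmetric])
      then show ?thesis by (smt (verit) zero_le_power2)
    qed
    finally show "(\<integral>X. (?A X x)\<^sup>2 \<partial>?P) \<le> b\<^sup>2 / real N" using N by (simp add: prob_space divide_right_mono)
  qed simp
  finally show sq: "(\<integral>X. (\<psi> X)\<^sup>2 \<partial>?P) \<le> b\<^sup>2 / real N" by (simp add: Q.prob_space)
  have \<psi>0: "0 \<le> \<psi> X" for X unfolding \<psi>_def by simp
  have "integrable ?P \<psi>" "integrable ?P (\<lambda>X. (\<psi> X)\<^sup>2)"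
    using P.L2_boundedI[OF m, of "2 * b"] bd \<psi>0
    by (auto simp: L2_def intro!: P.integrable_const_bound[where B="2 * b"])
  \<comment> \<open>Jensen's inequality, in the form that the variance of \<psi> is
    nonnegative.\<close>
  then have "(\<integral>X. \<psi> X \<partial>?P)\<^sup>2 \<le> (\<integral>X. (\<psi> X)\<^sup>2 \<partial>?P)"
    using P.variance_eq[of \<psi>] P.variance_positive[of \<psi>] by simp
  then have "(\<integral>X. \<psi> X \<partial>?P)\<^sup>2 \<le> b\<^sup>2 / real N" using sq by linarith
  then have "\<bar>\<integral>X. \<psi> X \<partial>?P\<bar> \<le> sqrt (b\<^sup>2 / real N)" by (simp add: real_le_rsqrt)
  then show "(\<integral>X. \<psi> X \<partial>?P) \<le> b / sqrt (real N)" using b by (simp add: real_sqrt_divide)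
qed

text \<open>By the reverse triangle inequality, replacing one sample moves the distance by at most
  the norm of \<open>(G z - G (X i)) / N\<close>, hence by \<open>2 * b / N\<close>. The bounded
  differences inequality then adds its deviation term to the mean bound
  \<open>b / sqrt N\<close>.\<close>

lemma (in prob_space) L2norm_average_concentration:
  fixes G :: "'a \<Rightarrow> 'x \<Rightarrow> real"
  assumes Q: "prob_space Q" and N: "N > 0"
    and G: "(\<lambda>(z, x). G z x) \<in> borel_measurable (M \<Otimes>\<^sub>M Q)"
    and Gb: "\<And>z x. z \<in> space M \<Longrightarrow> x \<in> space Q \<Longrightarrow> \<bar>G z x\<bar> \<le> b"
    and \<eta>: "0 < \<eta>" "\<eta> < 1"
  shows "{X \<in> space (PiM {..<N} (\<lambda>_. M)).
            L2norm Q (\<lambda>x. (1 / real N) * (\<Sum>j<N. G (X j) x) - expectation (\<lambda>z. G z x))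
              > b / sqrt (real N) + 2 * b * sqrt (ln (1 / \<eta>) / (2 * real N))} \<in> sets (PiM {..<N} (\<lambda>_. M))"
    and "measure (PiM {..<N} (\<lambda>_. M)) {X \<in> space (PiM {..<N} (\<lambda>_. M)).
            L2norm Q (\<lambda>x. (1 / real N) * (\<Sum>j<N. G (X j) x) - expectation (\<lambda>z. G z x))
              > b / sqrt (real N) + 2 * b * sqrt (ln (1 / \<eta>) / (2 * real N))} \<le> \<eta>"
proof -
  interpret Q: prob_space Q by fact
  let ?P = "PiM {..<N} (\<lambda>_. M)"
  interpret P: prob_space ?P by (intro prob_space_PiM) unfold_locales
  define \<psi> where "\<psi> X = L2norm Q (\<lambda>x. (1 / real N) * (\<Sum>j<N. G (X j) x) - expectation (\<lambda>z. G z x))" for X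
  note ms = L2norm_average_mean_square[OF Q N G Gb, folded \<psi>_def]
  obtain z0 x0 where "z0 \<in> space M" "x0 \<in> space Q" using not_empty Q.not_empty by blast
  then have b: "b \<ge> 0" using Gb[of z0 x0] by linarith
  have Gz: "(\<lambda>x. G z x) \<in> L2 Q" if "z \<in> space M" for z
    using measurable_compose[OF measurable_Pair1'[OF that] G] Gb[OF that] by (intro Q.L2_boundedI[of _ b]) auto
  have gL: "(\<lambda>x. expectation (\<lambda>z. G z x)) \<in> L2 Q"
  proof (rule Q.L2_boundedI[of _ b])
    show "(\<lambda>x. expectation (\<lambda>z. G z x)) \<in> borel_measurable Q"
      using G by (intro borel_measurable_lebesgue_integral) simp
    fix x assume x: "x \<in> space Q"
    have Gi: "integrable M (\<lambda>z. G z x)"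
      using measurable_compose[OF measurable_Pair2'[OF x] G] Gb x by (intro integrable_const_bound[where B=b]) auto
    have "\<bar>expectation (\<lambda>z. G z x)\<bar> \<le> (\<integral>z. \<bar>G z x\<bar> \<partial>M)" by (rule integral_abs_bound)
    also have "\<dots> \<le> (\<integral>z. b \<partial>M)" using Gb x Gi by (intro integral_mono) auto
    finally show "\<bar>expectation (\<lambda>z. G z x)\<bar> \<le> b" by (simp add: prob_space)
  qed
  have AL: "(\<lambda>x. (1 / real N) * (\<Sum>j<N. G (X j) x) - expectation (\<lambda>z. G z x)) \<in> L2 Q" if "X \<in> space ?P" for X
    using that by (intro L2_diff L2_scale L2_sum gL Gz) (auto simp: space_PiM)
  have diff: "\<bar>\<psi> (X(i := z)) - \<psi> X\<bar> \<le> 2 * b / real N"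
    if X: "X \<in> space ?P" and i: "i \<in> {..<N}" and z: "z \<in> space M" for X i z
  proof -
    have X': "X(i := z) \<in> space ?P" using X i z by (auto simp: space_PiM PiE_iff extensional_def)
    have Xi: "X i \<in> space M" using X i by (auto simp: space_PiM)
    have sum: "(\<Sum>j<N. G ((X(i := z)) j) x) - (\<Sum>j<N. G (X j) x) = G z x - G (X i) x" for x
    proof -
      have "(\<Sum>j<N. G ((X(i := z)) j) x) - (\<Sum>j<N. G (X j) x) = (\<Sum>j<N. if j = i then G z x - G (X i) x else 0)"
        unfolding sum_subtractf[symmetric] by (intro sum.cong) auto
      then show ?thesis using i by simp
    qed
    have "\<bar>\<psi> (X(i := z)) - \<psi> X\<bar> \<le> L2norm Q (\<lambda>x. ((1 / real N) * (\<Sum>j<N. G ((X(i := z)) j) x) - expectation (\<lambda>z. G z x))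
        - ((1 / real N) * (\<Sum>j<N. G (X j) x) - expectation (\<lambda>z. G z x)))"
      unfolding \<psi>_def by (rule L2norm_abs_diff_le[OF AL[OF X'] AL[OF X]])
    also have "\<dots> = L2norm Q (\<lambda>x. (1 / real N) * (G z x - G (X i) x))"
      unfolding sum[symmetric] by (simp add: algebra_simps)
    also have "\<dots> = (1 / real N) * L2norm Q (\<lambda>x. G z x - G (X i) x)" unfolding L2norm_scale by simp
    also have "\<dots> \<le> (1 / real N) * (2 * b)"
    proof (intro mult_left_mono Q.L2norm_bounded)
      show "(\<lambda>x. G z x - G (X i) x) \<in> borel_measurable Q" using Gz[OF z] Gz[OF Xi] by (auto simp: L2_def)
      show "\<bar>G z x - G (X i) x\<bar> \<le> 2 * b" if "x \<in> space Q" for x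
        using Gb[OF z that] Gb[OF Xi that] by linarith
    qed (use b in auto)
    finally show ?thesis by simp
  qed
  have "measure ?P {X \<in> space ?P. \<psi> X > (\<integral>X. \<psi> X \<partial>?P) + sqrt ((\<Sum>i<N. (2 * b / real N)\<^sup>2) * ln (1 / \<eta>) / 2)} \<le> \<eta>"
    by (rule bounded_differences[where K="2 * b" and c="\<lambda>_. 2 * b / real N"])
       (use ms(1,2) diff \<eta> prob_space_axioms L2norm_nonneg in \<open>simp_all add: \<psi>_def\<close>)
  also have "sqrt ((\<Sum>i<N. (2 * b / real N)\<^sup>2) * ln (1 / \<eta>) / 2) = 2 * b * sqrt (ln (1 / \<eta>) / (2 * real N))"
  proof -
    have "(\<Sum>i<N. (2 * b / real N)\<^sup>2) * ln (1 / \<eta>) / 2 = (2 * b)\<^sup>2 * (ln (1 / \<eta>) / (2 * real N))"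
      using N by (simp add: power2_eq_square)
    then show ?thesis using b by (simp only: real_sqrt_mult real_sqrt_abs)
  qed
  finally have "measure ?P {X \<in> space ?P. \<psi> X > (\<integral>X. \<psi> X \<partial>?P) + 2 * b * sqrt (ln (1 / \<eta>) / (2 * real N))} \<le> \<eta>" .
  moreover have "measure ?P {X \<in> space ?P. \<psi> X > b / sqrt (real N) + 2 * b * sqrt (ln (1 / \<eta>) / (2 * real N))}
      \<le> measure ?P {X \<in> space ?P. \<psi> X > (\<integral>X. \<psi> X \<partial>?P) + 2 * b * sqrt (ln (1 / \<eta>) / (2 * real N))}"
    using ms(1,4) by (intro P.finite_measure_mono) auto
  ultimately show "measure ?P {X \<in> space ?P. L2norm Q (\<lambda>x. (1 / real N) * (\<Sum>j<N. G (X j) x) - expectation (\<lambda>z. G z x))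
      > b / sqrt (real N) + 2 * b * sqrt (ln (1 / \<eta>) / (2 * real N))} \<le> \<eta>"
    unfolding \<psi>_def by linarith
  have "{X \<in> space ?P. \<psi> X > b / sqrt (real N) + 2 * b * sqrt (ln (1 / \<eta>) / (2 * real N))} \<in> sets ?P"
    using ms(1) by measurable
  then show "{X \<in> space ?P. L2norm Q (\<lambda>x. (1 / real N) * (\<Sum>j<N. G (X j) x) - expectation (\<lambda>z. G z x))
      > b / sqrt (real N) + 2 * b * sqrt (ln (1 / \<eta>) / (2 * real N))} \<in> sets ?P"
    unfolding \<psi>_def .
qed

section \<open>Symmetrization and contraction\<close>

text \<open>A sign vector is encoded by the set of its positive entries, so an expectation over
  Rademacher signs becomes a sum over \<open>Pow {..<n}\<close> divided by \<open>2 ^ n\<close>, and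
  flipping all signs becomes complementation.\<close>

definition sgn_of :: "nat set \<Rightarrow> nat \<Rightarrow> real" where
  "sgn_of S i = (if i \<in> S then 1 else - 1)"

lemma Max_image_add_le:
  assumes "finite A" "A \<noteq> {}"
  shows "Max ((\<lambda>a. u a + v a) ` A) \<le> Max (u ` A) + (Max (v ` A) :: real)"
  using assms by (auto intro!: Max.boundedI add_mono Max_ge)

lemma Max_image_abs_le:
  assumes "finite A" "A \<noteq> {}" "\<And>a. a \<in> A \<Longrightarrow> \<bar>u a\<bar> \<le> (C :: real)"
  shows "\<bar>Max (u ` A)\<bar> \<le> C"
proof -
  have "Max (u ` A) \<in> u ` A" using assms by (intro Max_in) auto
  then show ?thesis using assms(3) by auto
qed

lemma Max_image_abs_diff_le:
  assumes "finite A" "A \<noteq> {}" "\<And>a. a \<in> A \<Longrightarrow> \<bar>u a - v a\<bar> \<le> (C :: real)"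
  shows "\<bar>Max (u ` A) - Max (v ` A)\<bar> \<le> C"
proof -
  have *: "Max (u ` A) \<le> Max (v ` A) + C" if "\<And>a. a \<in> A \<Longrightarrow> u a \<le> v a + C" for u v :: "'a \<Rightarrow> real"
  proof (rule Max.boundedI)
    fix y assume "y \<in> u ` A"
    then obtain a where a: "a \<in> A" "y = u a" by auto
    then have "v a \<le> Max (v ` A)" using assms(1) by auto
    then show "y \<le> Max (v ` A) + C" using that[OF a(1)] a by simp
  qed (use assms in auto)
  have "Max (u ` A) \<le> Max (v ` A) + C" "Max (v ` A) \<le> Max (u ` A) + C"
    using assms(3) by (intro *; force simp: abs_le_iff)+
  then show ?thesis by (simp add: abs_le_iff)
qed

lemma sum_Pow_insert:
  fixes X :: "'i set \<Rightarrow> real"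
  assumes "finite I" "i \<notin> I"
  shows "(\<Sum>S\<in>Pow (insert i I). X S) = (\<Sum>S\<in>Pow I. X S + X (insert i S))"
proof -
  have inj: "inj_on (insert i) (Pow I)" using assms by (auto simp: inj_on_def)
  have "(\<Sum>S\<in>Pow (insert i I). X S) = (\<Sum>S\<in>Pow I. X S) + (\<Sum>S\<in>insert i ` Pow I. X S)"
    unfolding Pow_insert using assms by (intro sum.union_disjoint) auto
  then show ?thesis by (simp add: sum.reindex[OF inj] sum.distrib)
qed

text \<open>If \<open>a\<close> and \<open>b\<close> attain the two maxima on the left, that side is
  \<open>v a + v b + (p b - p a)\<close>, which is at most
  \<open>v a + v b + \<bar>q a - q b\<bar>\<close>. Depending on the sign of
  \<open>q a - q b\<close>, one of the two ways of inserting \<open>a\<close> and \<open>b\<close>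
  into the maxima on the right reaches this value.\<close>

lemma contraction_step:
  fixes v p q :: "'f \<Rightarrow> real"
  assumes A: "finite A" "A \<noteq> {}"
    and pq: "\<And>a b. a \<in> A \<Longrightarrow> b \<in> A \<Longrightarrow> \<bar>p a - p b\<bar> \<le> \<bar>q a - q b\<bar>"
  shows "Max ((\<lambda>a. v a - p a) ` A) + Max ((\<lambda>a. v a + p a) ` A)
       \<le> Max ((\<lambda>a. v a - q a) ` A) + Max ((\<lambda>a. v a + q a) ` A)"
proof -
  have "Max ((\<lambda>a. v a - p a) ` A) \<in> (\<lambda>a. v a - p a) ` A" "Max ((\<lambda>a. v a + p a) ` A) \<in> (\<lambda>a. v a + p a) ` A"
    using A by (intro Max_in; simp)+
  then obtain a b where a: "a \<in> A" "Max ((\<lambda>a. v a - p a) ` A) = v a - p a"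
    and b: "b \<in> A" "Max ((\<lambda>a. v a + p a) ` A) = v b + p b" by auto
  have ub: "v x - q x \<le> Max ((\<lambda>a. v a - q a) ` A)" "v x + q x \<le> Max ((\<lambda>a. v a + q a) ` A)" if "x \<in> A" for x
    using A that by (intro Max_ge; simp)+
  show ?thesis using ub[OF a(1)] ub[OF b(1)] pq[OF a(1) b(1)] unfolding a(2) b(2) by linarith
qed

text \<open>One index is treated at a time: pairing the sign sets with and without \<open>i\<close>
  gives exactly the two maxima of the contraction step. The offset \<open>u\<close> is arbitrary so
  that the replaced term \<open>L * t a i\<close>, with either sign, can be absorbed into it before
  the induction hypothesis is applied.\<close>

lemma rademacher_contraction:
  fixes \<psi> :: "nat \<Rightarrow> real \<Rightarrow> real" and t :: "'f \<Rightarrow> nat \<Rightarrow> real"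
  assumes I: "finite I" and A: "finite A" "A \<noteq> {}"
    and lip: "\<And>i x y. \<bar>\<psi> i x - \<psi> i y\<bar> \<le> L * \<bar>x - y\<bar>"
  shows "(\<Sum>S\<in>Pow I. Max ((\<lambda>a. u a + (\<Sum>i\<in>I. sgn_of S i * \<psi> i (t a i))) ` A))
       \<le> (\<Sum>S\<in>Pow I. Max ((\<lambda>a. u a + L * (\<Sum>i\<in>I. sgn_of S i * t a i)) ` A))"
  using I
proof (induction I arbitrary: u rule: finite_induct)
  case (insert i I)
  have L: "L \<ge> 0" using order.trans[OF abs_ge_zero lip[of i 1 0]] by simp
  have sg: "sgn_of S i = - 1" "sgn_of (insert i S) i = 1" if "S \<in> Pow I" for S
    using that insert.hyps by (auto simp: sgn_of_def)
  have sI: "(\<Sum>j\<in>I. sgn_of (insert i S) j * w j) = (\<Sum>j\<in>I. sgn_of S j * w j)" for S w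
    using insert.hyps by (intro sum.cong) (auto simp: sgn_of_def)
  have sI': "(\<Sum>j\<in>I. w j * sgn_of (insert i S) j) = (\<Sum>j\<in>I. w j * sgn_of S j)" for S w
    using sI[of S w] by (simp add: mult.commute)
  have "(\<Sum>S\<in>Pow (insert i I). Max ((\<lambda>a. u a + (\<Sum>j\<in>insert i I. sgn_of S j * \<psi> j (t a j))) ` A))
      = (\<Sum>S\<in>Pow I. Max ((\<lambda>a. (u a + (\<Sum>j\<in>I. sgn_of S j * \<psi> j (t a j))) - \<psi> i (t a i)) ` A)
                 + Max ((\<lambda>a. (u a + (\<Sum>j\<in>I. sgn_of S j * \<psi> j (t a j))) + \<psi> i (t a i)) ` A))"
    unfolding sum_Pow_insert[OF insert.hyps] using insert.hyps
    by (intro sum.cong refl) (simp add: sg sI sI' algebra_simps)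
  also have "\<dots> \<le> (\<Sum>S\<in>Pow I. Max ((\<lambda>a. (u a + (\<Sum>j\<in>I. sgn_of S j * \<psi> j (t a j))) - L * t a i) ` A)
                 + Max ((\<lambda>a. (u a + (\<Sum>j\<in>I. sgn_of S j * \<psi> j (t a j))) + L * t a i) ` A))"
    using lip L by (intro sum_mono contraction_step A) (simp add: abs_mult flip: right_diff_distrib)
  also have "\<dots> = (\<Sum>S\<in>Pow I. Max ((\<lambda>a. (u a - L * t a i) + (\<Sum>j\<in>I. sgn_of S j * \<psi> j (t a j))) ` A))
                 + (\<Sum>S\<in>Pow I. Max ((\<lambda>a. (u a + L * t a i) + (\<Sum>j\<in>I. sgn_of S j * \<psi> j (t a j))) ` A))"
    by (simp add: sum.distrib algebra_simps)
  also have "\<dots> \<le> (\<Sum>S\<in>Pow I. Max ((\<lambda>a. (u a - L * t a i) + L * (\<Sum>j\<in>I. sgn_of S j * t a j)) ` A))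
                 + (\<Sum>S\<in>Pow I. Max ((\<lambda>a. (u a + L * t a i) + L * (\<Sum>j\<in>I. sgn_of S j * t a j)) ` A))"
    by (intro add_mono insert.IH)
  also have "\<dots> = (\<Sum>S\<in>Pow (insert i I). Max ((\<lambda>a. u a + L * (\<Sum>j\<in>insert i I. sgn_of S j * t a j)) ` A))"
    unfolding sum_Pow_insert[OF insert.hyps] sum.distrib[symmetric] using insert.hyps
    by (intro sum.cong refl) (simp add: sg sI sI' algebra_simps)
  finally show ?case .
qed simp

section \<open>Symmetrization and uniform deviations\<close>

lemma (in prob_space) integrable_boundedI:
  fixes f :: "'a \<Rightarrow> real"
  assumes "f \<in> borel_measurable M" "\<And>x. x \<in> space M \<Longrightarrow> \<bar>f x\<bar> \<le> C"
  shows "integrable M f"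
  using assms by (intro integrable_const_bound[where B=C]) auto

text \<open>Symmetrization uses this in two ways: with a permutation of the doubled sample, as
  exchangeability, and with the two embeddings of \<open>{..<n}\<close> into it, to read off the law
  of either half.\<close>

lemma (in prob_space) integral_PiM_reindex:
  fixes f :: "('i \<Rightarrow> 'a) \<Rightarrow> real"
  assumes "inj_on \<pi> I" "\<pi> \<in> I \<rightarrow> K" "f \<in> borel_measurable (PiM I (\<lambda>_. M))"
  shows "(\<integral>\<omega>. f (\<lambda>i\<in>I. \<omega> (\<pi> i)) \<partial>PiM K (\<lambda>_. M)) = (\<integral>\<omega>. f \<omega> \<partial>PiM I (\<lambda>_. M))"
proof -
  have "(\<lambda>\<omega>. \<lambda>i\<in>I. \<omega> (\<pi> i)) \<in> PiM K (\<lambda>_. M) \<rightarrow>\<^sub>M PiM I (\<lambda>_. M)"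
    using assms(2) by (intro measurable_restrict measurable_component_singleton) auto
  then have "(\<integral>\<omega>. f (\<lambda>i\<in>I. \<omega> (\<pi> i)) \<partial>PiM K (\<lambda>_. M))
      = (\<integral>\<omega>. f \<omega> \<partial>distr (PiM K (\<lambda>_. M)) (PiM I (\<lambda>_. M)) (\<lambda>\<omega>. \<lambda>i\<in>I. \<omega> (\<pi> i)))"
    using assms(3) by (simp add: integral_distr)
  also have "distr (PiM K (\<lambda>_. M)) (PiM I (\<lambda>_. M)) (\<lambda>\<omega>. \<lambda>i\<in>I. \<omega> (\<pi> i)) = PiM I (\<lambda>_. M)"
    by (rule distr_PiM_reindex[OF _ assms(1,2)]) unfold_locales
  finally show ?thesis .
qed

text \<open>The ghost sample occupies the coordinates \<open>{n..<2 * n}\<close> of a doubled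
  product space. The factor 2 arises when signed differences are split into two signed averages, one
  for each half.\<close>

lemma (in prob_space) rademacher_symmetrization:
  fixes loss :: "'f \<Rightarrow> 'a \<Rightarrow> real"
  assumes A: "finite A" "A \<noteq> {}" and n: "n > 0"
    and loss: "\<And>f. f \<in> A \<Longrightarrow> loss f \<in> borel_measurable M"
    and loss_bd: "\<And>f x. f \<in> A \<Longrightarrow> x \<in> space M \<Longrightarrow> \<bar>loss f x\<bar> \<le> B"
  shows "(\<integral>D. Max ((\<lambda>f. expectation (loss f) - (1 / real n) * (\<Sum>i<n. loss f (D i))) ` A) \<partial>PiM {..<n} (\<lambda>_. M))
      \<le> 2 * (\<integral>D. (1 / 2 ^ n) * (\<Sum>S\<in>Pow {..<n}. Max ((\<lambda>f. (1 / real n) * (\<Sum>i<n. sgn_of S i * loss f (D i))) ` A))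
              \<partial>PiM {..<n} (\<lambda>_. M))"
proof -
  let ?I = "{..<n}" and ?J = "{n..<2 * n}" and ?K = "{..<2 * n}"
  have K: "?K = ?I \<union> ?J" "?I \<inter> ?J = {}" by auto
  let ?P = "PiM ?I (\<lambda>_. M)" and ?PJ = "PiM ?J (\<lambda>_. M)" and ?PK = "PiM ?K (\<lambda>_. M)"
  interpret PS: product_prob_space "\<lambda>_. M" ?K by unfold_locales
  interpret P: prob_space ?P by (intro prob_space_PiM) unfold_locales
  interpret PJ: prob_space ?PJ by (intro prob_space_PiM) unfold_locales
  have PK: "prob_space ?PK" by (intro prob_space_PiM) unfold_locales
  note [measurable] = loss
  have B: "B \<ge> 0"
  proof -
    obtain f x where "f \<in> A" "x \<in> space M" using A not_empty by blast
    then show ?thesis using loss_bd[of f x] by linarith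
  qed
  have comp: "\<omega> i \<in> space M" if "\<omega> \<in> space (PiM J (\<lambda>_. M))" "i \<in> J" for \<omega> :: "nat \<Rightarrow> 'a" and J i
    using that by (auto simp: space_PiM)
  have loss_int: "integrable M (loss f)" if "f \<in> A" for f
    using loss[OF that] loss_bd[OF that] by (rule integrable_boundedI)
  define R where "R f = expectation (loss f)" for f
  have Rb: "\<bar>R f\<bar> \<le> B" if "f \<in> A" for f
  proof -
    have "\<bar>R f\<bar> \<le> (\<integral>x. \<bar>loss f x\<bar> \<partial>M)" unfolding R_def by (rule integral_abs_bound)
    also have "\<dots> \<le> (\<integral>x. B \<partial>M)" using loss_int[OF that] loss_bd[OF that] by (intro integral_mono) auto
    finally show ?thesis by (simp add: prob_space)
  qed
  have avgb: "\<bar>(1 / real n) * (\<Sum>i<n. w i)\<bar> \<le> C" if "\<And>i. i < n \<Longrightarrow> \<bar>w i\<bar> \<le> C" for w :: "nat \<Rightarrow> real" and C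
  proof -
    have "\<bar>\<Sum>i<n. w i\<bar> \<le> real n * C"
      using sum_bounded_above[of ?I "\<lambda>i. \<bar>w i\<bar>" C] that by (intro order.trans[OF sum_abs]) auto
    then show ?thesis using n by (simp add: abs_mult field_simps)
  qed
  define W where "W S D = Max ((\<lambda>f. (1 / real n) * (\<Sum>i<n. sgn_of S i * loss f (D i))) ` A)" for S and D :: "nat \<Rightarrow> 'a"
  \<comment> \<open>The signs of the full set \<open>{..<n}\<close> are all 1, so
    \<open>H {..<n}\<close> compares the ghost average with the sample average without
    signs.\<close>
  define H where "H S \<omega> = Max ((\<lambda>f. (1 / real n) * (\<Sum>i<n. sgn_of S i * (loss f (\<omega> (n + i)) - loss f (\<omega> i)))) ` A)"
    for S and \<omega> :: "nat \<Rightarrow> 'a"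
  define T where "T D = Max ((\<lambda>f. R f - (1 / real n) * (\<Sum>i<n. loss f (D i))) ` A)" for D :: "nat \<Rightarrow> 'a"
  have sgb: "\<bar>sgn_of S i * y\<bar> = \<bar>y\<bar>" for S i y by (simp add: sgn_of_def)
  have Wm [measurable]: "W S \<in> borel_measurable ?P" for S
    unfolding W_def using A by measurable
  have Hm [measurable]: "H S \<in> borel_measurable ?PK" for S
    unfolding H_def using A by measurable
  have Tm [measurable]: "T \<in> borel_measurable ?P"
    unfolding T_def using A by measurable
  have Wb: "\<bar>W S D\<bar> \<le> B" if "D \<in> space ?P" for S D
    unfolding W_def using that loss_bd comp[OF that] by (intro Max_image_abs_le A avgb) (auto simp: sgb)
  have Hb: "\<bar>H S \<omega>\<bar> \<le> 2 * B" if "\<omega> \<in> space ?PK" for S \<omega>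
    unfolding H_def
  proof (intro Max_image_abs_le A avgb)
    fix f i assume fi: "f \<in> A" "i < n"
    then have "\<bar>loss f (\<omega> (n + i))\<bar> \<le> B" "\<bar>loss f (\<omega> i)\<bar> \<le> B" using comp[OF that] by (auto intro!: loss_bd)
    then show "\<bar>sgn_of S i * (loss f (\<omega> (n + i)) - loss f (\<omega> i))\<bar> \<le> 2 * B" unfolding sgb by linarith
  qed
  have Tb: "\<bar>T D\<bar> \<le> 2 * B" if "D \<in> space ?P" for D
    unfolding T_def
  proof (intro Max_image_abs_le A)
    fix f assume f: "f \<in> A"
    have "\<bar>(1 / real n) * (\<Sum>i<n. loss f (D i))\<bar> \<le> B" using comp[OF that] f by (intro avgb loss_bd) auto
    then show "\<bar>R f - (1 / real n) * (\<Sum>i<n. loss f (D i))\<bar> \<le> 2 * B" using Rb[OF f] by linarith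
  qed
  have Wi: "integrable ?P (W S)" for S by (rule P.integrable_boundedI[OF Wm Wb])
  have Hi: "integrable ?PK (H S)" for S by (rule prob_space.integrable_boundedI[OF PK Hm Hb])

  have merge_space: "merge ?I ?J (x, y) \<in> space ?PK" if "x \<in> space ?P" "y \<in> space ?PJ" for x y :: "nat \<Rightarrow> 'a"
    using that K by (auto simp: space_PiM PiE_iff merge_def extensional_def)
  have HIm: "(\<lambda>(x, y). H ?I (merge ?I ?J (x, y))) \<in> borel_measurable (?P \<Otimes>\<^sub>M ?PJ)"
    using measurable_compose[OF measurable_merge Hm[of ?I, unfolded K(1)]] by (simp add: case_prod_unfold)
  \<comment> \<open>The risk is the mean of the ghost average, and a maximum of integrals is at most
    the integral of the maximum.\<close>
  have "(\<integral>D. T D \<partial>?P) \<le> (\<integral>x. (\<integral>y. H ?I (merge ?I ?J (x, y)) \<partial>?PJ) \<partial>?P)"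
  proof (rule integral_mono)
    show "integrable ?P T" by (rule P.integrable_boundedI[OF Tm Tb])
    have Hy: "integrable ?PJ (\<lambda>y. H ?I (merge ?I ?J (x, y)))" if "x \<in> space ?P" for x
      using measurable_compose[OF measurable_Pair1'[OF that] HIm] Hb[OF merge_space[OF that]]
      by (intro PJ.integrable_boundedI[where C="2 * B"]) auto
    show "integrable ?P (\<lambda>x. \<integral>y. H ?I (merge ?I ?J (x, y)) \<partial>?PJ)"
    proof (rule P.integrable_boundedI[where C="2 * B"])
      show "(\<lambda>x. \<integral>y. H ?I (merge ?I ?J (x, y)) \<partial>?PJ) \<in> borel_measurable ?P"
        by (rule PJ.borel_measurable_lebesgue_integral[OF HIm])
      fix x assume x: "x \<in> space ?P"
      have "\<bar>\<integral>y. H ?I (merge ?I ?J (x, y)) \<partial>?PJ\<bar> \<le> (\<integral>y. \<bar>H ?I (merge ?I ?J (x, y))\<bar> \<partial>?PJ)"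
        by (rule integral_abs_bound)
      also have "\<dots> \<le> (\<integral>y. 2 * B \<partial>?PJ)"
        using Hy[OF x] Hb merge_space[OF x] by (intro integral_mono) auto
      finally show "\<bar>\<integral>y. H ?I (merge ?I ?J (x, y)) \<partial>?PJ\<bar> \<le> 2 * B" by (simp add: PJ.prob_space)
    qed
    fix x assume x: "x \<in> space ?P"
    show "T x \<le> (\<integral>y. H ?I (merge ?I ?J (x, y)) \<partial>?PJ)"
      unfolding T_def
    proof (rule Max.boundedI)
      fix t assume "t \<in> (\<lambda>f. R f - (1 / real n) * (\<Sum>i<n. loss f (x i))) ` A"
      then obtain f where f: "f \<in> A" and t: "t = R f - (1 / real n) * (\<Sum>i<n. loss f (x i))" by auto
      have cm: "(\<lambda>y. loss f (y (n + i))) \<in> borel_measurable ?PJ" if "i < n" for i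
        by (rule measurable_PiM_component_rev[where M="\<lambda>_. M", OF _ loss[OF f]]) (use that in auto)
      have ci: "integrable ?PJ (\<lambda>y. loss f (y (n + i)))" if "i < n" for i
        using comp that f by (intro PJ.integrable_boundedI[OF cm[OF that], of B] loss_bd) auto
      have ce: "(\<integral>y. loss f (y (n + i)) \<partial>?PJ) = R f" if "i < n" for i
      proof -
        have "R f = (\<integral>z. loss f z \<partial>distr ?PJ M (\<lambda>\<omega>. \<omega> (n + i)))"
          unfolding R_def using that by (subst distr_PiM_component) (auto intro: prob_space_axioms)
        also have "\<dots> = (\<integral>y. loss f (y (n + i)) \<partial>?PJ)"
          using that f by (intro integral_distr) auto
        finally show ?thesis by simp
      qed
      have "t = (\<integral>y. (1 / real n) * (\<Sum>i<n. loss f (y (n + i)) - loss f (x i)) \<partial>?PJ)"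
      proof -
        have "integrable ?PJ (\<lambda>y. \<Sum>i<n. loss f (y (n + i)))" using ci by auto
        moreover have "(\<integral>y. (\<Sum>i<n. loss f (y (n + i))) \<partial>?PJ) = real n * R f"
          using ci by (simp add: ce)
        ultimately show ?thesis unfolding t sum_subtractf using n by (simp add: PJ.prob_space right_diff_distrib)
      qed
      also have "\<dots> \<le> (\<integral>y. H ?I (merge ?I ?J (x, y)) \<partial>?PJ)"
      proof (rule integral_mono)
        show "integrable ?PJ (\<lambda>y. (1 / real n) * (\<Sum>i<n. loss f (y (n + i)) - loss f (x i)))"
          using ci by (intro integrable_mult_right Bochner_Integration.integrable_sum Bochner_Integration.integrable_diff) auto
        fix y assume "y \<in> space ?PJ"
        have "(\<Sum>i<n. loss f (y (n + i)) - loss f (x i))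
            = (\<Sum>i<n. sgn_of ?I i * (loss f (merge ?I ?J (x, y) (n + i)) - loss f (merge ?I ?J (x, y) i)))"
          by (intro sum.cong) (auto simp: sgn_of_def merge_def)
        then show "(1 / real n) * (\<Sum>i<n. loss f (y (n + i)) - loss f (x i)) \<le> H ?I (merge ?I ?J (x, y))"
          unfolding H_def using A f by (intro Max_ge) auto
      qed (rule Hy[OF x])
      finally show "t \<le> (\<integral>y. H ?I (merge ?I ?J (x, y)) \<partial>?PJ)" .
    qed (use A in auto)
  qed
  also have "\<dots> = (\<integral>\<omega>. H ?I \<omega> \<partial>?PK)"
    using Hi[of ?I] unfolding K(1) by (intro PS.product_integral_fold[symmetric]) (auto simp: K)
  finally have step1: "(\<integral>D. T D \<partial>?P) \<le> (\<integral>\<omega>. H ?I \<omega> \<partial>?PK)" .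

  \<comment> \<open>\<pi> exchanges \<open>i\<close> and \<open>n + i\<close> exactly for the
    \<open>i\<close> outside \<open>S\<close>. The product measure is invariant under this
    involution, while the differences at those indices change sign.\<close>
  have swap: "(\<integral>\<omega>. H S \<omega> \<partial>?PK) = (\<integral>\<omega>. H ?I \<omega> \<partial>?PK)" for S
  proof -
    define \<pi> where "\<pi> i = (if i < n then (if i \<in> S then i else i + n) else (if i - n \<in> S then i else i - n))" for i
    have inv: "\<pi> (\<pi> i) = i" if "i < 2 * n" for i using that by (auto simp: \<pi>_def)
    have "inj_on \<pi> ?K" by (rule inj_on_inverseI[where g=\<pi>]) (simp add: inv)
    moreover have "\<pi> \<in> ?K \<rightarrow> ?K" by (auto simp: \<pi>_def)
    ultimately have "(\<integral>\<omega>. H ?I \<omega> \<partial>?PK) = (\<integral>\<omega>. H ?I (\<lambda>i\<in>?K. \<omega> (\<pi> i)) \<partial>?PK)"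
      by (rule integral_PiM_reindex[symmetric]) simp
    moreover have "H ?I (\<lambda>i\<in>?K. \<omega> (\<pi> i)) = H S \<omega>" for \<omega>
    proof -
      have "(\<Sum>i<n. sgn_of ?I i * (loss f ((\<lambda>i\<in>?K. \<omega> (\<pi> i)) (n + i)) - loss f ((\<lambda>i\<in>?K. \<omega> (\<pi> i)) i)))
          = (\<Sum>i<n. sgn_of S i * (loss f (\<omega> (n + i)) - loss f (\<omega> i)))" for f
        by (rule sum.cong) (auto simp: sgn_of_def \<pi>_def add.commute)
      then show ?thesis unfolding H_def by simp
    qed
    ultimately show ?thesis by simp
  qed

  \<comment> \<open>On \<open>{..<n}\<close> the complement of \<open>S\<close> carries the negated
    signs, so the subtracted half turns into a signed average for \<open>?I - S\<close>.\<close>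
  have HW: "(\<integral>\<omega>. H S \<omega> \<partial>?PK) \<le> (\<integral>D. W S D \<partial>?P) + (\<integral>D. W (?I - S) D \<partial>?P)" for S
  proof -
    let ?s = "\<lambda>\<omega>. \<lambda>i\<in>?I. \<omega> (n + i)" and ?r = "\<lambda>\<omega>. \<lambda>i\<in>?I. \<omega> i"
    have sm: "?s \<in> ?PK \<rightarrow>\<^sub>M ?P" "?r \<in> ?PK \<rightarrow>\<^sub>M ?P"
      by (intro measurable_restrict measurable_component_singleton; auto)+
    have i1: "integrable ?PK (\<lambda>\<omega>. W S (?s \<omega>))" "integrable ?PK (\<lambda>\<omega>. W (?I - S) (?r \<omega>))"
      using measurable_space[OF sm(1)] measurable_space[OF sm(2)] Wb
      by (intro prob_space.integrable_boundedI[OF PK, where C=B] measurable_compose[OF sm(1) Wm]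
           measurable_compose[OF sm(2) Wm]; blast)+
    have "(\<integral>\<omega>. H S \<omega> \<partial>?PK) \<le> (\<integral>\<omega>. W S (?s \<omega>) + W (?I - S) (?r \<omega>) \<partial>?PK)"
    proof (rule integral_mono)
      fix \<omega> assume "\<omega> \<in> space ?PK"
      have "(1 / real n) * (\<Sum>i<n. sgn_of S i * (loss f (\<omega> (n + i)) - loss f (\<omega> i)))
          = (1 / real n) * (\<Sum>i<n. sgn_of S i * loss f (?s \<omega> i)) + (1 / real n) * (\<Sum>i<n. sgn_of (?I - S) i * loss f (?r \<omega> i))" for f
        unfolding distrib_left[symmetric] sum.distrib[symmetric]
        by (intro arg_cong2[where f="(*)"] refl sum.cong) (auto simp: sgn_of_def)
      then show "H S \<omega> \<le> W S (?s \<omega>) + W (?I - S) (?r \<omega>)"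
        unfolding H_def W_def by (simp only:) (rule Max_image_add_le[OF A])
    qed (use Hi i1 in auto)
    also have "\<dots> = (\<integral>\<omega>. W S (?s \<omega>) \<partial>?PK) + (\<integral>\<omega>. W (?I - S) (?r \<omega>) \<partial>?PK)"
      using i1 by simp
    also have "(\<integral>\<omega>. W S (?s \<omega>) \<partial>?PK) = (\<integral>D. W S D \<partial>?P)"
      by (rule integral_PiM_reindex) auto
    also have "(\<integral>\<omega>. W (?I - S) (?r \<omega>) \<partial>?PK) = (\<integral>D. W (?I - S) D \<partial>?P)"
      by (rule integral_PiM_reindex) auto
    finally show ?thesis .
  qed
  have compl: "(\<Sum>S\<in>Pow ?I. \<integral>D. W (?I - S) D \<partial>?P) = (\<Sum>S\<in>Pow ?I. \<integral>D. W S D \<partial>?P)"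
    by (rule sum.reindex_bij_witness[where i="\<lambda>S. ?I - S" and j="\<lambda>S. ?I - S"]) auto
  \<comment> \<open>All integrals of \<open>H S\<close> agree, so the one for \<open>?I\<close> is
    their average over the \<open>2 ^ n\<close> sign sets; the complements run through the same sets
    once more.\<close>
  have "2 ^ n * (\<integral>\<omega>. H ?I \<omega> \<partial>?PK) = (\<Sum>S\<in>Pow ?I. \<integral>\<omega>. H S \<omega> \<partial>?PK)"
  proof -
    have "(\<Sum>S\<in>Pow ?I. \<integral>\<omega>. H S \<omega> \<partial>?PK) = (\<Sum>S\<in>Pow ?I. \<integral>\<omega>. H ?I \<omega> \<partial>?PK)"
      by (intro sum.cong refl swap)
    then show ?thesis by (simp add: card_Pow)
  qed
  also have "\<dots> \<le> (\<Sum>S\<in>Pow ?I. (\<integral>D. W S D \<partial>?P) + (\<integral>D. W (?I - S) D \<partial>?P))"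
    by (intro sum_mono HW)
  also have "\<dots> = 2 * (\<Sum>S\<in>Pow ?I. \<integral>D. W S D \<partial>?P)" by (simp add: sum.distrib compl)
  also have "\<dots> = 2 * (\<integral>D. (\<Sum>S\<in>Pow ?I. W S D) \<partial>?P)" using Wi by simp
  finally have "(\<integral>\<omega>. H ?I \<omega> \<partial>?PK) \<le> 2 * ((1 / 2 ^ n) * (\<integral>D. (\<Sum>S\<in>Pow ?I. W S D) \<partial>?P))"
    by (simp add: field_simps)
  also have "(1 / 2 ^ n) * (\<integral>D. (\<Sum>S\<in>Pow ?I. W S D) \<partial>?P) = (\<integral>D. (1 / 2 ^ n) * (\<Sum>S\<in>Pow ?I. W S D) \<partial>?P)"
    by (rule integral_mult_right_zero[symmetric])
  finally show ?thesis using step1 unfolding T_def W_def R_def by linarith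
qed

lemma (in prob_space) one_sided_uniform_deviation_finite:
  fixes loss :: "'f \<Rightarrow> 'a \<Rightarrow> real"
  assumes A: "finite A" "A \<noteq> {}" and n: "n > 0"
    and loss: "\<And>f. f \<in> insert f0 A \<Longrightarrow> loss f \<in> borel_measurable M"
    and loss_bd: "\<And>f x. f \<in> insert f0 A \<Longrightarrow> x \<in> space M \<Longrightarrow> loss f x \<in> {0..B}"
    and r: "(\<integral>D. (1 / 2 ^ n) * (\<Sum>S\<in>Pow {..<n}. Max ((\<lambda>f. (1 / real n) * (\<Sum>i<n. sgn_of S i * loss f (D i))) ` A))
              \<partial>PiM {..<n} (\<lambda>_. M)) \<le> r"
    and \<eta>: "0 < \<eta>" "\<eta> < 1"
  shows "measure (PiM {..<n} (\<lambda>_. M)) {D \<in> space (PiM {..<n} (\<lambda>_. M)). \<exists>f\<in>A.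
      (expectation (loss f) - (1 / real n) * (\<Sum>i<n. loss f (D i))) - (expectation (loss f0) - (1 / real n) * (\<Sum>i<n. loss f0 (D i)))
        > 2 * r + 2 * B * sqrt (ln (1 / \<eta>) / (2 * real n))} \<le> \<eta>"
proof -
  let ?P = "PiM {..<n} (\<lambda>_. M)"
  interpret P: prob_space ?P by (intro prob_space_PiM) unfold_locales
  note [measurable] = loss
  obtain x0 where "x0 \<in> space M" using not_empty by blast
  then have B: "B \<ge> 0" using loss_bd[of f0 x0] by auto
  have comp: "D i \<in> space M" if "D \<in> space ?P" "i < n" for D i using that by (auto simp: space_PiM)
  have f0m: "loss f0 \<in> borel_measurable M" and Am: "\<And>f. f \<in> A \<Longrightarrow> loss f \<in> borel_measurable M" by auto
  define dev where "dev f D = expectation (loss f) - (1 / real n) * (\<Sum>i<n. loss f (D i))" for f and D :: "nat \<Rightarrow> 'a"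
  have devm: "dev f \<in> borel_measurable ?P" if "f \<in> insert f0 A" for f
    unfolding dev_def using that by measurable
  have devb: "\<bar>dev f D\<bar> \<le> B" if f: "f \<in> insert f0 A" and D: "D \<in> space ?P" for f D
  proof -
    have i: "integrable M (loss f)" using loss_bd[OF f] by (intro integrable_boundedI[OF loss[OF f], of B]) force
    have "(\<integral>x. 0 \<partial>M) \<le> expectation (loss f)" "expectation (loss f) \<le> (\<integral>x. B \<partial>M)"
      using loss_bd[OF f] i by (intro integral_mono; force)+
    then have e: "0 \<le> expectation (loss f)" "expectation (loss f) \<le> B" by (auto simp: prob_space)
    have "0 \<le> (\<Sum>i<n. loss f (D i))" using loss_bd[OF f comp[OF D]] by (intro sum_nonneg) auto
    moreover have "(\<Sum>i<n. loss f (D i)) \<le> real n * B"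
      using sum_bounded_above[of "{..<n}" "\<lambda>i. loss f (D i)" B] loss_bd[OF f comp[OF D]] by auto
    ultimately have "0 \<le> (1 / real n) * (\<Sum>i<n. loss f (D i))" "(1 / real n) * (\<Sum>i<n. loss f (D i)) \<le> B"
      using n by (auto simp: field_simps)
    then show ?thesis unfolding dev_def using e by linarith
  qed
  define g where "g D = Max ((\<lambda>f. dev f D) ` A) - dev f0 D" for D
  have Mm [measurable]: "(\<lambda>D. Max ((\<lambda>f. dev f D) ` A)) \<in> borel_measurable ?P"
    using A devm by (intro borel_measurable_Max) auto
  have gm: "g \<in> borel_measurable ?P" unfolding g_def using devm[of f0] by measurable
  have Mb: "\<bar>Max ((\<lambda>f. dev f D) ` A)\<bar> \<le> B" if "D \<in> space ?P" for D
    using devb that by (intro Max_image_abs_le A) auto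
  have gb: "\<bar>g D\<bar> \<le> 2 * B" if "D \<in> space ?P" for D
    unfolding g_def using Mb[OF that] devb[OF _ that, of f0] by auto
  \<comment> \<open>As a single maximum of differences, \<open>g\<close> shows its bounded
    differences; as a maximum minus a centred term, it shows its expectation.\<close>
  have g_Max: "g D = Max ((\<lambda>f. dev f D - dev f0 D) ` A)" for D
  proof -
    have "(\<lambda>f. dev f D - dev f0 D) ` A = (\<lambda>y. y - dev f0 D) ` (\<lambda>f. dev f D) ` A" by (simp add: image_image)
    also have "Max \<dots> = Max ((\<lambda>f. dev f D) ` A) - dev f0 D"
      using A by (subst mono_Max_commute[symmetric]) (auto simp: mono_def)
    finally show ?thesis by (simp add: g_def)
  qed
  have gd: "\<bar>g (D(i := y)) - g D\<bar> \<le> 2 * B / real n"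
    if D: "D \<in> space ?P" and i: "i \<in> {..<n}" and y: "y \<in> space M" for D i y
    unfolding g_Max
  proof (rule Max_image_abs_diff_le[OF A])
    fix f assume f: "f \<in> A"
    have upd: "(\<Sum>j<n. loss h ((D(i := y)) j)) = (\<Sum>j<n. loss h (D j)) + (loss h y - loss h (D i))" for h
    proof -
      have "(\<Sum>j<n. loss h ((D(i := y)) j)) - (\<Sum>j<n. loss h (D j)) = (\<Sum>j<n. if j = i then loss h y - loss h (D i) else 0)"
        unfolding sum_subtractf[symmetric] by (intro sum.cong) auto
      then show ?thesis using i by simp
    qed
    \<comment> \<open>The exchanged observation enters the losses of both \<open>f\<close> and
      \<open>f0\<close>. Each has values in \<open>[0, B]\<close>, so the numerator stays within
      \<open>2 * B\<close>.\<close>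
    have "dev f (D(i := y)) - dev f0 (D(i := y)) - (dev f D - dev f0 D)
        = ((loss f (D i) - loss f y) + (loss f0 y - loss f0 (D i))) / real n"
      unfolding dev_def upd using n by (simp add: field_simps)
    also have "\<bar>\<dots>\<bar> \<le> 2 * B / real n"
    proof -
      have "\<bar>(loss f (D i) - loss f y) + (loss f0 y - loss f0 (D i))\<bar> \<le> 2 * B"
        using loss_bd[of f "D i"] loss_bd[of f y] loss_bd[of f0 "D i"] loss_bd[of f0 y] f y comp[OF D] i by auto
      then show ?thesis using n by (simp add: divide_right_mono)
    qed
    finally show "\<bar>dev f (D(i := y)) - dev f0 (D(i := y)) - (dev f D - dev f0 D)\<bar> \<le> 2 * B / real n" .
  qed
  have Eg: "(\<integral>D. g D \<partial>?P) \<le> 2 * r"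
  proof -
    have Mi: "integrable ?P (\<lambda>D. Max ((\<lambda>f. dev f D) ` A))" by (rule P.integrable_boundedI[OF Mm Mb])
    have ci: "integrable ?P (\<lambda>D. loss f0 (D i))" if "i < n" for i
    proof (rule P.integrable_boundedI[where C=B])
      show "(\<lambda>D. loss f0 (D i)) \<in> borel_measurable ?P"
        by (rule measurable_PiM_component_rev[where M="\<lambda>_. M", OF _ f0m]) (use that in auto)
      fix D assume "D \<in> space ?P"
      then show "\<bar>loss f0 (D i)\<bar> \<le> B" using loss_bd[of f0 "D i"] comp[OF _ that] by auto
    qed
    have ce: "(\<integral>D. loss f0 (D i) \<partial>?P) = expectation (loss f0)" if "i < n" for i
    proof -
      have "expectation (loss f0) = (\<integral>z. loss f0 z \<partial>distr ?P M (\<lambda>\<omega>. \<omega> i))"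
        using that by (subst distr_PiM_component) (auto intro: prob_space_axioms)
      also have "\<dots> = (\<integral>D. loss f0 (D i) \<partial>?P)" using that f0m by (intro integral_distr) auto
      finally show ?thesis by simp
    qed
    have d0: "integrable ?P (dev f0)" by (rule P.integrable_boundedI[OF devm devb]) auto
    have "(\<integral>D. dev f0 D \<partial>?P) = 0"
    proof -
      have "integrable ?P (\<lambda>D. \<Sum>i<n. loss f0 (D i))" using ci by auto
      moreover have "(\<integral>D. (\<Sum>i<n. loss f0 (D i)) \<partial>?P) = real n * expectation (loss f0)"
        using ci by (simp add: ce)
      ultimately show ?thesis unfolding dev_def using n by (simp add: P.prob_space)
    qed
    then have "(\<integral>D. g D \<partial>?P) = (\<integral>D. Max ((\<lambda>f. dev f D) ` A) \<partial>?P)"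
      unfolding g_def using Mi d0 by simp
    also have "\<dots> \<le> 2 * r"
      unfolding dev_def
    proof (rule order.trans[OF rademacher_symmetrization[where loss=loss and B=B, OF A n Am]])
      show "\<bar>loss f x\<bar> \<le> B" if "f \<in> A" "x \<in> space M" for f x using loss_bd[of f x] that by simp
    qed (use r in linarith)+
    finally show ?thesis .
  qed
  have "measure ?P {D \<in> space ?P. g D > (\<integral>D. g D \<partial>?P) + sqrt ((\<Sum>i<n. (2 * B / real n)\<^sup>2) * ln (1 / \<eta>) / 2)} \<le> \<eta>"
    by (rule bounded_differences[where K="2 * B" and c="\<lambda>_. 2 * B / real n"])
       (use gm gb gd \<eta> prob_space_axioms in simp_all)
  also have "sqrt ((\<Sum>i<n. (2 * B / real n)\<^sup>2) * ln (1 / \<eta>) / 2) = 2 * B * sqrt (ln (1 / \<eta>) / (2 * real n))"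
  proof -
    have "(\<Sum>i<n. (2 * B / real n)\<^sup>2) * ln (1 / \<eta>) / 2 = (2 * B)\<^sup>2 * (ln (1 / \<eta>) / (2 * real n))"
      using n by (simp add: power2_eq_square)
    then show ?thesis using B by (simp only: real_sqrt_mult real_sqrt_abs)
  qed
  finally have conc: "measure ?P {D \<in> space ?P. g D > (\<integral>D. g D \<partial>?P) + 2 * B * sqrt (ln (1 / \<eta>) / (2 * real n))} \<le> \<eta>" .
  have "measure ?P {D \<in> space ?P. \<exists>f\<in>A. dev f D - dev f0 D > 2 * r + 2 * B * sqrt (ln (1 / \<eta>) / (2 * real n))}
      \<le> measure ?P {D \<in> space ?P. g D > (\<integral>D. g D \<partial>?P) + 2 * B * sqrt (ln (1 / \<eta>) / (2 * real n))}"
  proof (rule P.finite_measure_mono)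
    show "{D \<in> space ?P. \<exists>f\<in>A. dev f D - dev f0 D > 2 * r + 2 * B * sqrt (ln (1 / \<eta>) / (2 * real n))}
        \<subseteq> {D \<in> space ?P. g D > (\<integral>D. g D \<partial>?P) + 2 * B * sqrt (ln (1 / \<eta>) / (2 * real n))}"
    proof safe
      fix D f assume f: "f \<in> A" and "dev f D - dev f0 D > 2 * r + 2 * B * sqrt (ln (1 / \<eta>) / (2 * real n))"
      moreover have "dev f D - dev f0 D \<le> g D" unfolding g_Max using A f by (intro Max_ge) auto
      ultimately show "g D > (\<integral>D. g D \<partial>?P) + 2 * B * sqrt (ln (1 / \<eta>) / (2 * real n))" using Eg by linarith
    qed
  qed (use gm in measurable)
  then show ?thesis using conc unfolding dev_def by linarith
qed

text \<open>An enumeration exhausts \<open>A\<close> by finite sets whose bad events increase to the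
  whole one. Because \<open>r\<close> bounds the average of every finite subclass, continuity from
  below gives the claim. Phrasing the event by an existential quantifier avoids forming a supremum
  over an infinite family.\<close>

lemma (in prob_space) one_sided_uniform_deviation:
  fixes loss :: "'f \<Rightarrow> 'a \<Rightarrow> real"
  assumes A: "countable A" and n: "n > 0"
    and loss: "\<And>f. f \<in> insert f0 A \<Longrightarrow> loss f \<in> borel_measurable M"
    and loss_bd: "\<And>f x. f \<in> insert f0 A \<Longrightarrow> x \<in> space M \<Longrightarrow> loss f x \<in> {0..B}"
    and r: "\<And>A'. finite A' \<Longrightarrow> A' \<noteq> {} \<Longrightarrow> A' \<subseteq> A \<Longrightarrow>
        (\<integral>D. (1 / 2 ^ n) * (\<Sum>S\<in>Pow {..<n}. Max ((\<lambda>f. (1 / real n) * (\<Sum>i<n. sgn_of S i * loss f (D i))) ` A'))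
              \<partial>PiM {..<n} (\<lambda>_. M)) \<le> r"
    and \<eta>: "0 < \<eta>" "\<eta> < 1"
  shows "{D \<in> space (PiM {..<n} (\<lambda>_. M)). \<exists>f\<in>A.
      (expectation (loss f) - (1 / real n) * (\<Sum>i<n. loss f (D i))) - (expectation (loss f0) - (1 / real n) * (\<Sum>i<n. loss f0 (D i)))
        > 2 * r + 2 * B * sqrt (ln (1 / \<eta>) / (2 * real n))} \<in> sets (PiM {..<n} (\<lambda>_. M))" (is "?E A \<in> _")
    and "measure (PiM {..<n} (\<lambda>_. M)) {D \<in> space (PiM {..<n} (\<lambda>_. M)). \<exists>f\<in>A.
      (expectation (loss f) - (1 / real n) * (\<Sum>i<n. loss f (D i))) - (expectation (loss f0) - (1 / real n) * (\<Sum>i<n. loss f0 (D i)))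
        > 2 * r + 2 * B * sqrt (ln (1 / \<eta>) / (2 * real n))} \<le> \<eta>"
proof -
  let ?P = "PiM {..<n} (\<lambda>_. M)"
  interpret P: prob_space ?P by (intro prob_space_PiM) unfold_locales
  define bad where "bad f D \<longleftrightarrow> (expectation (loss f) - (1 / real n) * (\<Sum>i<n. loss f (D i)))
        - (expectation (loss f0) - (1 / real n) * (\<Sum>i<n. loss f0 (D i)))
        > 2 * r + 2 * B * sqrt (ln (1 / \<eta>) / (2 * real n))" for f D
  have m: "?E A' \<in> sets ?P" if sub: "A' \<subseteq> A" for A'
  proof -
    have "{D \<in> space ?P. bad f D} \<in> sets ?P" if "f \<in> A'" for f
    proof -
      have [measurable]: "loss f \<in> borel_measurable M" "loss f0 \<in> borel_measurable M"
        using loss that sub by auto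
      show ?thesis unfolding bad_def by measurable
    qed
    then have "(\<Union>f\<in>A'. {D \<in> space ?P. bad f D}) \<in> sets ?P"
      using countable_subset[OF sub A] by (intro sets.countable_UN') auto
    also have "(\<Union>f\<in>A'. {D \<in> space ?P. bad f D}) = ?E A'" unfolding bad_def[symmetric] by blast
    finally show ?thesis .
  qed
  show "?E A \<in> sets ?P" by (rule m) simp
  show "measure ?P (?E A) \<le> \<eta>"
  proof (cases "A = {}")
    case False
    define e where "e = from_nat_into A"
    have e: "range e = A" unfolding e_def using range_from_nat_into[OF False A] .
    have sub: "e ` {..k} \<subseteq> A" for k unfolding e[symmetric] by (rule image_mono) simp
    have "(\<lambda>k. measure ?P (?E (e ` {..k}))) \<longlonglongrightarrow> measure ?P (\<Union>k. ?E (e ` {..k}))"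
    proof (rule P.finite_Lim_measure_incseq)
      show "incseq (\<lambda>k. ?E (e ` {..k}))"
        unfolding bad_def[symmetric] incseq_def by (intro allI impI Collect_mono) (auto dest: order.trans)
      show "range (\<lambda>k. ?E (e ` {..k})) \<subseteq> sets ?P"
        by (intro image_subsetI m sub)
    qed
    also have "(\<Union>k. ?E (e ` {..k})) = ?E A"
      unfolding e[symmetric] bad_def[symmetric] by blast
    finally show ?thesis
    proof (rule LIMSEQ_le_const2, intro exI allI impI)
      fix k :: nat
      have ins: "f \<in> insert f0 A" if "f \<in> insert f0 (e ` {..k})" for f using that sub by blast
      show "measure ?P (?E (e ` {..k})) \<le> \<eta>"
        by (rule one_sided_uniform_deviation_finite[OF _ _ n loss[OF ins] loss_bd[OF ins] r[OF _ _ sub] \<eta>]) simp_all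
    qed
  qed (use \<eta> in simp)
qed

text \<open>Boxes are an intersection-stable generator of the product, and on a box the measure is a
  finite product of measurable functions of \<open>x\<close>. Applied within each bag and again
  across bags, this makes the sampling stage a Markov kernel.\<close>

lemma measurable_PiM_prob_algebra:
  assumes I: "finite I" and K: "\<And>i. i \<in> I \<Longrightarrow> K i \<in> X \<rightarrow>\<^sub>M prob_algebra (N i)"
  shows "(\<lambda>x. PiM I (\<lambda>i. K i x)) \<in> X \<rightarrow>\<^sub>M prob_algebra (PiM I N)"
proof (rule measurable_prob_algebra_generated[OF sets_PiM Int_stable_prod_algebra prod_algebra_sets_into_space])
  have Kx: "prob_space (K i x)" "sets (K i x) = sets (N i)" if "x \<in> space X" "i \<in> I" for i x
    using measurable_space[OF K[OF that(2)] that(1)] by (auto simp: space_prob_algebra)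
  fix x assume x: "x \<in> space X"
  show "prob_space (PiM I (\<lambda>i. K i x))" using Kx[OF x] by (intro prob_space_PiM)
  show "sets (PiM I (\<lambda>i. K i x)) = sets (PiM I N)" using Kx[OF x] by (intro sets_PiM_cong) auto
next
  have Kx: "prob_space (K i x)" "sets (K i x) = sets (N i)" if "x \<in> space X" "i \<in> I" for i x
    using measurable_space[OF K[OF that(2)] that(1)] by (auto simp: space_prob_algebra)
  fix A assume "A \<in> prod_algebra I N"
  then obtain E where A: "A = (\<Pi>\<^sub>E i\<in>I. E i)" and E: "\<And>i. i \<in> I \<Longrightarrow> E i \<in> sets (N i)"
    unfolding prod_algebra_eq_finite[OF I] by auto
  have "emeasure (PiM I (\<lambda>i. K i x)) A = (\<Prod>i\<in>I. emeasure (K i x) (E i))" if x: "x \<in> space X" for x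
  proof -
    have sp: "E i \<subseteq> space (K i x)" if "i \<in> I" for i
      using sets.sets_into_space[OF E[OF that]] sets_eq_imp_space_eq[OF Kx(2)[OF x that]] by simp
    have "prod_emb I (\<lambda>i. K i x) I (Pi\<^sub>E I E) = Pi\<^sub>E I E"
      using sp by (rule prod_emb_PiE_same_index)
    then show ?thesis
      using emeasure_PiM_emb[of I "\<lambda>i. K i x" I E] I E Kx[OF x] A by simp
  qed
  moreover have "(\<lambda>x. \<Prod>i\<in>I. emeasure (K i x) (E i)) \<in> borel_measurable X"
    using measurable_prob_algebraD[OF K] E
    by (intro borel_measurable_prod_ennreal measurable_compose[OF _ measurable_emeasure_subprob_algebra]) auto
  ultimately show "(\<lambda>x. emeasure (PiM I (\<lambda>i. K i x)) A) \<in> borel_measurable X"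
    by (subst measurable_cong) auto
qed

text \<open>Each of the \<open>2 ^ n\<close> sign vectors is an atom of mass
  \<open>1 / 2 ^ n\<close>, and discarding everything off these atoms can only decrease the integral
  of a nonnegative function.\<close>

lemma rademacher_signs_lower_bound:
  assumes g: "g \<in> borel_measurable (rademacher_signs n)"
  shows "ennreal (1 / 2 ^ n) * (\<Sum>S\<in>Pow {..<n}. g (restrict (sgn_of S) {..<n})) \<le> (\<integral>\<^sup>+\<sigma>. g \<sigma> \<partial>rademacher_signs n)"
proof -
  let ?U = "measure_pmf (pmf_of_set {-1, 1 :: real})"
  \<comment> \<open>Points of the product space are extensional functions, so the signs are cut off
    outside \<open>{..<n}\<close>.\<close>
  define \<sigma> where "\<sigma> S = restrict (sgn_of S) {..<n}" for S
  have single: "{\<sigma> S} = Pi\<^sub>E {..<n} (\<lambda>i. {sgn_of S i})" for S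
  proof -
    have "Pi\<^sub>E {..<n} (\<lambda>i. {sgn_of S i}) = Pi\<^sub>E {..<n} (\<lambda>i. {\<sigma> S i})"
      by (rule PiE_cong) (simp add: \<sigma>_def)
    also have "\<dots> = {\<sigma> S}" by (rule PiE_singleton) (auto simp: \<sigma>_def extensional_def)
    finally show ?thesis ..
  qed
  have half: "emeasure ?U {sgn_of S i} = ennreal (1 / 2)" for S i
    unfolding emeasure_pmf_single by (subst pmf_of_set) (auto simp: sgn_of_def)
  interpret PS: product_prob_space "\<lambda>_. ?U" "{..<n}" by unfold_locales
  have em: "emeasure (rademacher_signs n) {\<sigma> S} = ennreal (1 / 2 ^ n)" for S
  proof -
    have "emeasure (rademacher_signs n) {\<sigma> S} = (\<Prod>i<n. ennreal (1 / 2))"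
      unfolding rademacher_signs_def single by (subst PS.emeasure_PiM) (simp_all only: half finite_lessThan, simp)
    also have "\<dots> = ennreal (\<Prod>i<n. 1 / 2)" by (rule prod_ennreal) simp
    finally show ?thesis by (simp add: power_one_over)
  qed
  have ms: "{\<sigma> S} \<in> sets (rademacher_signs n)" for S
    unfolding rademacher_signs_def single by (intro sets_PiM_I_finite) auto
  have inj: "S = T" if "S \<subseteq> {..<n}" "T \<subseteq> {..<n}" "\<sigma> S = \<sigma> T" for S T
  proof (rule set_eqI)
    fix i
    show "i \<in> S \<longleftrightarrow> i \<in> T"
    proof (cases "i < n")
      case True
      then have "sgn_of S i = sgn_of T i" using fun_cong[OF that(3), of i] by (simp add: \<sigma>_def)
      then show ?thesis by (auto simp: sgn_of_def split: if_splits)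
    qed (use that in auto)
  qed
  have "ennreal (1 / 2 ^ n) * (\<Sum>S\<in>Pow {..<n}. g (\<sigma> S)) = (\<Sum>S\<in>Pow {..<n}. g (\<sigma> S) * emeasure (rademacher_signs n) {\<sigma> S})"
    by (simp add: em sum_distrib_left mult.commute)
  also have "\<dots> = (\<Sum>S\<in>Pow {..<n}. \<integral>\<^sup>+\<tau>. g (\<sigma> S) * indicator {\<sigma> S} \<tau> \<partial>rademacher_signs n)"
    using ms by (intro sum.cong refl nn_integral_cmult_indicator[symmetric]) auto
  also have "\<dots> = (\<integral>\<^sup>+\<tau>. (\<Sum>S\<in>Pow {..<n}. g (\<sigma> S) * indicator {\<sigma> S} \<tau>) \<partial>rademacher_signs n)"
    using ms by (intro nn_integral_sum[symmetric]) auto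
  also have "\<dots> \<le> (\<integral>\<^sup>+\<tau>. g \<tau> \<partial>rademacher_signs n)"
  proof (rule nn_integral_mono)
    fix \<tau>
    show "(\<Sum>S\<in>Pow {..<n}. g (\<sigma> S) * indicator {\<sigma> S} \<tau>) \<le> g \<tau>"
    proof (cases "\<exists>S\<in>Pow {..<n}. \<tau> = \<sigma> S")
      case True
      then obtain S where S: "S \<in> Pow {..<n}" "\<tau> = \<sigma> S" by auto
      have "(\<Sum>T\<in>Pow {..<n}. g (\<sigma> T) * indicator {\<sigma> T} \<tau>) = (\<Sum>T\<in>Pow {..<n}. if T = S then g (\<sigma> S) else 0)"
        using S inj by (intro sum.cong refl) (auto simp: indicator_def)
      also have "\<dots> = g \<tau>" using S by (subst sum.delta) auto
      finally show ?thesis by simp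
    next
      case False
      then have "(\<Sum>T\<in>Pow {..<n}. g (\<sigma> T) * indicator {\<sigma> T} \<tau>) = 0"
        by (intro sum.neutral) (auto simp: indicator_def)
      then show ?thesis by simp
    qed
  qed
  finally show ?thesis unfolding \<sigma>_def .
qed

text \<open>For each sign vector separately, a maximum over \<open>A\<close> without absolute values
  lies below the supremum of absolute values over all of \<open>F\<close>; the atoms of the sign
  measure then turn the finite average into an integral.\<close>

lemma rademacher_lower_bound:
  assumes rad: "rad_sup k n F \<in> borel_measurable (PiM {..<n} (\<lambda>_. M) \<Otimes>\<^sub>M rademacher_signs n)"
    and A: "finite A" "A \<noteq> {}" "A \<subseteq> F" and D: "D \<in> space (PiM {..<n} (\<lambda>_. M))"
  shows "ennreal ((1 / 2 ^ n) * (\<Sum>S\<in>Pow {..<n}.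
             Max ((\<lambda>f. (1 / real n) * (\<Sum>i<n. sgn_of S i * f (kme k (fst (D i))))) ` A)))
         \<le> (\<integral>\<^sup>+\<sigma>. rad_sup k n F (D, \<sigma>) \<partial>rademacher_signs n)"
proof -
    let ?m = "\<lambda>S. Max ((\<lambda>f. (1 / real n) * (\<Sum>i<n. sgn_of S i * f (kme k (fst (D i))))) ` A)"
    have le: "ennreal (?m S) \<le> rad_sup k n F (D, restrict (sgn_of S) {..<n})" for S
    proof -
      have "?m S \<in> (\<lambda>f. (1 / real n) * (\<Sum>i<n. sgn_of S i * f (kme k (fst (D i))))) ` A"
        using A by (intro Max_in) auto
      then obtain f where f: "f \<in> A" "?m S = (1 / real n) * (\<Sum>i<n. sgn_of S i * f (kme k (fst (D i))))" by auto
      have "ennreal (?m S) \<le> ennreal \<bar>(1 / real n) * (\<Sum>i<n. restrict (sgn_of S) {..<n} i * f (kme k (fst (D i))))\<bar>"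
        unfolding f(2) by (intro ennreal_leI) (simp add: abs_mult divide_right_mono)
      also have "\<dots> \<le> rad_sup k n F (D, restrict (sgn_of S) {..<n})"
        unfolding rad_sup_def using f(1) A(3) by (auto intro!: SUP_upper2[of f])
      finally show ?thesis .
    qed
    have "ennreal ((1 / 2 ^ n) * (\<Sum>S\<in>Pow {..<n}. ?m S)) = ennreal (1 / 2 ^ n) * ennreal (\<Sum>S\<in>Pow {..<n}. ?m S)"
      by (rule ennreal_mult') simp
    also have "\<dots> \<le> ennreal (1 / 2 ^ n) * (\<Sum>S\<in>Pow {..<n}. ennreal (?m S))"
    proof (rule mult_left_mono)
      \<comment> \<open>A maximum may be negative, and \<open>ennreal\<close> sends it to 0. Passing
        to positive parts before converting makes the sum and the conversion commute.\<close>
      have "ennreal (\<Sum>S\<in>Pow {..<n}. ?m S) \<le> ennreal (\<Sum>S\<in>Pow {..<n}. max 0 (?m S))"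
        by (intro ennreal_leI sum_mono) simp
      also have "\<dots> = (\<Sum>S\<in>Pow {..<n}. ennreal (max 0 (?m S)))" by (rule sum_ennreal[symmetric]) simp
      also have "\<dots> = (\<Sum>S\<in>Pow {..<n}. ennreal (?m S))" by (intro sum.cong refl) (simp add: max_def ennreal_neg)
      finally show "ennreal (\<Sum>S\<in>Pow {..<n}. ?m S) \<le> (\<Sum>S\<in>Pow {..<n}. ennreal (?m S))" .
    qed simp
    also have "\<dots> \<le> ennreal (1 / 2 ^ n) * (\<Sum>S\<in>Pow {..<n}. rad_sup k n F (D, restrict (sgn_of S) {..<n}))"
      by (intro mult_left_mono sum_mono le) simp
    also have "\<dots> \<le> (\<integral>\<^sup>+\<sigma>. rad_sup k n F (D, \<sigma>) \<partial>rademacher_signs n)"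
      by (rule rademacher_signs_lower_bound[OF measurable_compose[OF measurable_Pair1'[OF D] rad]])
  finally show ?thesis .
qed

text \<open>Labels have absolute value 1, so \<open>x \<mapsto> \<phi> (- x * l i)\<close> is again
  \<open>L\<close>-Lipschitz. Contraction thus removes loss and label together and leaves the signs
  acting on \<open>f\<close> at the mean embeddings. The finite bound \<open>r\<close> lets the
  conclusion be an inequality between reals.\<close>

lemma rademacher_loss_bound:
  assumes M: "prob_space M" "\<And>x. x \<in> space M \<Longrightarrow> snd x \<in> {-1, 1 :: real}"
    and rad: "rad_sup k n F \<in> borel_measurable (PiM {..<n} (\<lambda>_. M) \<Otimes>\<^sub>M rademacher_signs n)"
    and A: "finite A" "A \<noteq> {}" "A \<subseteq> F"
    and L: "L \<ge> 0" and lip: "\<And>x y. \<bar>\<phi> x - \<phi> y\<bar> \<le> L * \<bar>x - y\<bar>"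
    and loss: "\<And>f. f \<in> A \<Longrightarrow> (\<lambda>x. \<phi> (- f (kme k (fst x)) * snd x)) \<in> borel_measurable M"
    and r: "ennreal L * rademacher M k n F \<le> ennreal r" "0 \<le> r"
  shows "(\<integral>D. (1 / 2 ^ n) * (\<Sum>S\<in>Pow {..<n}.
             Max ((\<lambda>f. (1 / real n) * (\<Sum>i<n. sgn_of S i * \<phi> (- f (kme k (fst (D i))) * snd (D i)))) ` A)) \<partial>PiM {..<n} (\<lambda>_. M)) \<le> r"
    (is "integral\<^sup>L ?P ?X \<le> r")
proof -
  interpret P: prob_space ?P using M by (intro prob_space_PiM)
  interpret R: prob_space "rademacher_signs n"
    unfolding rademacher_signs_def by (intro prob_space_PiM) unfold_locales
  let ?Y = "\<lambda>D. (1 / 2 ^ n) * (\<Sum>S\<in>Pow {..<n}.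
             Max ((\<lambda>f. (1 / real n) * (\<Sum>i<n. sgn_of S i * f (kme k (fst (D i))))) ` A))"
  have scale: "Max ((\<lambda>f. C * u f) ` A) = C * Max (u ` A)" if "C \<ge> 0" for C and u :: "_ \<Rightarrow> real"
  proof -
    have "(\<lambda>f. C * u f) ` A = (\<lambda>y. C * y) ` u ` A" by (simp add: image_image)
    also have "Max \<dots> = C * Max (u ` A)"
      using A that by (subst mono_Max_commute[symmetric]) (auto simp: mono_def mult_left_mono)
    finally show ?thesis .
  qed
  have XY: "?X D \<le> L * ?Y D" if D: "D \<in> space ?P" for D
  proof -
    \<comment> \<open>The contraction principle asks for a Lipschitz map at every natural number;
      off the sample the label is set to 1.\<close>
    define l where "l i = (if i < n then snd (D i) else 1)" for i
    have l: "l i \<in> {-1, 1}" for i using M(2)[of "D i"] D by (auto simp: l_def space_PiM PiE_iff)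
    have lp: "\<bar>\<phi> (- x * l i) - \<phi> (- y * l i)\<bar> \<le> L * \<bar>x - y\<bar>" for i x y
    proof -
      have "\<bar>\<phi> (- x * l i) - \<phi> (- y * l i)\<bar> \<le> L * \<bar>- x * l i - - y * l i\<bar>" by (rule lip)
      also have "\<bar>- x * l i - - y * l i\<bar> = \<bar>x - y\<bar>" using l[of i] by auto
      finally show ?thesis .
    qed
    let ?u = "\<lambda>S f. \<Sum>i<n. sgn_of S i * \<phi> (- f (kme k (fst (D i))) * snd (D i))"
    let ?v = "\<lambda>S f. \<Sum>i<n. sgn_of S i * f (kme k (fst (D i)))"
    have ul: "(\<Sum>i<n. sgn_of S i * \<phi> (- f (kme k (fst (D i))) * l i)) = ?u S f" for S f
      by (intro sum.cong) (auto simp: l_def)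
    have "(\<Sum>S\<in>Pow {..<n}. Max ((\<lambda>f. 0 + ?u S f) ` A)) \<le> (\<Sum>S\<in>Pow {..<n}. Max ((\<lambda>f. 0 + L * ?v S f) ` A))"
      unfolding ul[symmetric]
      by (rule rademacher_contraction[where \<psi>="\<lambda>i x. \<phi> (- x * l i)" and t="\<lambda>f i. f (kme k (fst (D i)))", OF _ A(1,2) lp]) simp
    also have "\<dots> = L * (\<Sum>S\<in>Pow {..<n}. Max (?v S ` A))"
      by (simp only: scale[OF L] add_0) (rule sum_distrib_left[symmetric])
    finally have "(\<Sum>S\<in>Pow {..<n}. Max (?u S ` A)) \<le> L * (\<Sum>S\<in>Pow {..<n}. Max (?v S ` A))" by simp
    then have "(1 / 2 ^ n * (1 / real n)) * (\<Sum>S\<in>Pow {..<n}. Max (?u S ` A))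
        \<le> (1 / 2 ^ n * (1 / real n)) * (L * (\<Sum>S\<in>Pow {..<n}. Max (?v S ` A)))"
      by (rule mult_left_mono) simp
    moreover have sc: "(\<Sum>S\<in>Pow {..<n}. Max ((\<lambda>f. (1 / real n) * w S f) ` A)) = (1 / real n) * (\<Sum>S\<in>Pow {..<n}. Max (w S ` A))" for w
      unfolding sum_distrib_left by (intro sum.cong refl scale) simp
    ultimately show ?thesis by (simp only: sc mult.assoc mult.left_commute)
  qed
  have Xm: "?X \<in> borel_measurable ?P"
  proof -
    have "(\<lambda>D. \<phi> (- f (kme k (fst (D i))) * snd (D i))) \<in> borel_measurable ?P" if "f \<in> A" "i < n" for f i
      using measurable_PiM_component_rev[where M="\<lambda>_. M", OF _ loss[OF that(1)], of i "{..<n}"] that by simp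
    then show ?thesis using A by (intro borel_measurable_times borel_measurable_sum borel_measurable_Max measurable_const) auto
  qed
  let ?Z = "\<lambda>D. \<integral>\<^sup>+\<sigma>. rad_sup k n F (D, \<sigma>) \<partial>rademacher_signs n"
  have "(\<integral>\<^sup>+D. ennreal (?X D) \<partial>?P) \<le> (\<integral>\<^sup>+D. ennreal L * ?Z D \<partial>?P)"
  proof (rule nn_integral_mono)
    fix D assume D: "D \<in> space ?P"
    have "ennreal (?X D) \<le> ennreal L * ennreal (?Y D)"
      using XY[OF D] L by (simp add: ennreal_leI flip: ennreal_mult')
    also have "\<dots> \<le> ennreal L * ?Z D"
      by (intro mult_left_mono rademacher_lower_bound[OF rad A D]) simp
    finally show "ennreal (?X D) \<le> ennreal L * ?Z D" .
  qed
  also have "\<dots> = ennreal L * (\<integral>\<^sup>+D. ?Z D \<partial>?P)"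
    using R.borel_measurable_nn_integral_fst[OF rad] by (intro nn_integral_cmult) simp
  also have "(\<integral>\<^sup>+D. ?Z D \<partial>?P) = rademacher M k n F"
    unfolding rademacher_def by (rule R.nn_integral_fst[OF rad])
  also have "ennreal L * rademacher M k n F \<le> ennreal r" by (rule r(1))
  finally have nn: "(\<integral>\<^sup>+D. ennreal (?X D) \<partial>?P) \<le> ennreal r" .
  show ?thesis
  proof (cases "integrable ?P ?X")
    case True
    have "integral\<^sup>L ?P ?X \<le> (\<integral>D. max 0 (?X D) \<partial>?P)"
      using True by (intro integral_mono) auto
    also have "\<dots> = enn2real (\<integral>\<^sup>+D. ennreal (max 0 (?X D)) \<partial>?P)"
      using Xm by (intro integral_eq_nn_integral) auto
    also have "(\<integral>\<^sup>+D. ennreal (max 0 (?X D)) \<partial>?P) = (\<integral>\<^sup>+D. ennreal (?X D) \<partial>?P)"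
      by (intro nn_integral_cong) (simp add: max_def ennreal_neg)
    also have "enn2real \<dots> \<le> r" using nn r(2) by (simp add: enn2real_leI)
    finally show ?thesis .
  next
    case False
    \<comment> \<open>A function that is not integrable has Bochner integral 0, so the claim reduces
      to \<open>0 \<le> r\<close>.\<close>
    show ?thesis unfolding not_integrable_integral_eq[OF False] by (rule r(2))
  qed
qed

section \<open>The two-stage sampling measure\<close>

lemma space_sample_space:
  "space (sample_space M n ns RF m) = space (PiM {..<n} (\<lambda>_. M)) \<times>
     (space (PiM {..<n} (\<lambda>i. PiM {..<ns i} (\<lambda>_. borel :: 'd::euclidean_space measure))) \<times> space (PiM {..<m} (\<lambda>_. RF)))"
  by (simp add: sample_space_def space_pair_measure)

locale two_stage_sampling =
  fixes M :: "('d::euclidean_space measure \<times> real) measure" and n m :: nat and ns :: "nat \<Rightarrow> nat"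
    and RF :: "('d \<times> real) measure"
  assumes M: "prob_space M" "sets M = sets (prob_algebra (borel :: 'd measure) \<Otimes>\<^sub>M count_space {-1, 1})"
    and RF: "prob_space RF"
begin

sublocale M: prob_space M by (fact M)
sublocale RF: prob_space RF by (fact RF)

abbreviation "DM \<equiv> PiM {..<n} (\<lambda>_. M)"
abbreviation "SB \<equiv> PiM {..<n} (\<lambda>i. PiM {..<ns i} (\<lambda>_. borel :: 'd measure))"
abbreviation "WM \<equiv> PiM {..<m} (\<lambda>_. RF)"
abbreviation "J \<equiv> joint_measure M n ns RF m"
abbreviation "SM D \<equiv> PiM {..<n} (\<lambda>i. PiM {..<ns i} (\<lambda>_. fst (D i)))"

sublocale DM: prob_space DM by (intro prob_space_PiM) unfold_locales
sublocale WM: prob_space WM by (intro prob_space_PiM) unfold_locales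

lemma M_space: "x \<in> space M \<longleftrightarrow> prob_space (fst x) \<and> sets (fst x) = sets borel \<and> snd x \<in> {-1, 1}"
  unfolding sets_eq_imp_space_eq[OF M(2)]
  by (simp only: space_pair_measure space_prob_algebra mem_Times_iff space_count_space mem_Collect_eq) blast

lemma D_space:
  assumes "D \<in> space DM" "i < n"
  shows "prob_space (fst (D i))" "sets (fst (D i)) = sets borel" "snd (D i) \<in> {-1, 1}"
  using assms M_space[of "D i"] by (auto simp: space_PiM)

lemma measurable_fst_M: "fst \<in> M \<rightarrow>\<^sub>M prob_algebra borel"
  unfolding measurable_cong_sets[OF M(2) refl] by (rule measurable_fst)

lemma measurable_fst_D: "i < n \<Longrightarrow> (\<lambda>D. fst (D i)) \<in> DM \<rightarrow>\<^sub>M prob_algebra borel"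
  by (rule measurable_PiM_component_rev[where M="\<lambda>_. M" and f=fst, OF _ measurable_fst_M]) simp

lemma SM_measurable: "SM \<in> DM \<rightarrow>\<^sub>M prob_algebra SB"
proof (rule measurable_PiM_prob_algebra[where K="\<lambda>i D. PiM {..<ns i} (\<lambda>_. fst (D i))"])
  show "(\<lambda>D. PiM {..<ns i} (\<lambda>_. fst (D i))) \<in> DM \<rightarrow>\<^sub>M prob_algebra (PiM {..<ns i} (\<lambda>_. borel))" if "i \<in> {..<n}" for i
  proof (rule measurable_PiM_prob_algebra[where K="\<lambda>_ D. fst (D i)"])
    show "(\<lambda>D. fst (D i)) \<in> DM \<rightarrow>\<^sub>M prob_algebra borel" by (rule measurable_fst_D) (use that in simp)
  qed simp
qed simp

lemma SM_space:
  assumes "D \<in> space DM"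
  shows "prob_space (SM D)" "sets (SM D) = sets SB" "space (SM D) = space SB"
proof -
  show "prob_space (SM D)" and *: "sets (SM D) = sets SB"
    using measurable_space[OF SM_measurable assms] unfolding space_prob_algebra by blast+
  show "space (SM D) = space SB" by (rule sets_eq_imp_space_eq[OF *])
qed

text \<open>Turns the nested binds into an iterated integral, through which all probability bounds
  below condition on the earlier stages. The kernels \<open>k2\<close> and \<open>k3\<close> that
  justify this also determine the sets of the joint law and its total mass.\<close>

lemma nn_integral_joint:
  assumes f: "f \<in> borel_measurable (sample_space M n ns RF m)"
  shows "(\<integral>\<^sup>+\<omega>. f \<omega> \<partial>J) = (\<integral>\<^sup>+D. (\<integral>\<^sup>+S. (\<integral>\<^sup>+W. f (D, S, W) \<partial>WM) \<partial>SM D) \<partial>DM)"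
    and "sets J = sets (sample_space M n ns RF m)" and "prob_space J"
proof -
  let ?SS = "sample_space M n ns RF m"
  have SS: "?SS = DM \<Otimes>\<^sub>M SB \<Otimes>\<^sub>M WM" by (simp add: sample_space_def)
  have wm: "(\<lambda>W. return ?SS (D, S, W)) \<in> WM \<rightarrow>\<^sub>M prob_algebra ?SS" if "D \<in> space DM" "S \<in> space SB" for D S
    by (rule measurable_compose[OF _ measurable_return_prob_space], unfold SS)
       (rule measurable_compose[OF measurable_Pair1'[OF that(2)] measurable_Pair1'[OF that(1)]])
  have WMc: "(\<lambda>_. WM) \<in> X \<rightarrow>\<^sub>M prob_algebra WM" for X
    by (intro measurable_const) (simp add: space_prob_algebra WM.prob_space_axioms)
  \<comment> \<open>The final outcome carries \<open>D\<close> along, so the innermost kernel must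
    be measurable jointly in \<open>D\<close> and \<open>S\<close>, and not only in \<open>S\<close>
    for fixed \<open>D\<close>.\<close>
  have k3: "(\<lambda>(D, S). WM \<bind> (\<lambda>W. return ?SS (D, S, W))) \<in> (DM \<Otimes>\<^sub>M SB) \<rightarrow>\<^sub>M prob_algebra ?SS"
    unfolding case_prod_unfold
  proof (rule measurable_bind_prob_space2[OF WMc])
    have "(\<lambda>x. (fst (fst x), snd (fst x), snd x)) \<in> (DM \<Otimes>\<^sub>M SB) \<Otimes>\<^sub>M WM \<rightarrow>\<^sub>M ?SS"
      unfolding SS by measurable
    then show "(\<lambda>x. case x of (x, W) \<Rightarrow> return ?SS (fst x, snd x, W)) \<in> (DM \<Otimes>\<^sub>M SB) \<Otimes>\<^sub>M WM \<rightarrow>\<^sub>M prob_algebra ?SS"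
      unfolding case_prod_unfold by (rule measurable_compose[OF _ measurable_return_prob_space])
  qed
  have k2: "(\<lambda>D. SM D \<bind> (\<lambda>S. WM \<bind> (\<lambda>W. return ?SS (D, S, W)))) \<in> DM \<rightarrow>\<^sub>M prob_algebra ?SS"
    by (rule measurable_bind_prob_space2[OF SM_measurable k3])
  have DMs: "DM \<in> space (prob_algebra DM)" by (simp add: space_prob_algebra DM.prob_space_axioms)
  show "sets J = sets ?SS" unfolding joint_measure_def by (rule sets_bind'[OF DMs k2])
  show "prob_space J" unfolding joint_measure_def by (rule prob_space_bind'[OF DMs k2])
  have "(\<integral>\<^sup>+\<omega>. f \<omega> \<partial>J) = (\<integral>\<^sup>+D. (\<integral>\<^sup>+\<omega>. f \<omega> \<partial>(SM D \<bind> (\<lambda>S. WM \<bind> (\<lambda>W. return ?SS (D, S, W))))) \<partial>DM)"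
    unfolding joint_measure_def by (rule nn_integral_bind[OF f measurable_prob_algebraD[OF k2]])
  also have "\<dots> = (\<integral>\<^sup>+D. (\<integral>\<^sup>+S. (\<integral>\<^sup>+W. f (D, S, W) \<partial>WM) \<partial>SM D) \<partial>DM)"
  proof (rule nn_integral_cong)
    fix D assume D: "D \<in> space DM"
    have k3D: "(\<lambda>S. WM \<bind> (\<lambda>W. return ?SS (D, S, W))) \<in> SM D \<rightarrow>\<^sub>M prob_algebra ?SS"
      using measurable_compose[OF measurable_Pair1'[OF D] k3]
      by (simp add: measurable_cong_sets[OF SM_space(2)[OF D] refl])
    have "(\<integral>\<^sup>+\<omega>. f \<omega> \<partial>(SM D \<bind> (\<lambda>S. WM \<bind> (\<lambda>W. return ?SS (D, S, W)))))
        = (\<integral>\<^sup>+S. (\<integral>\<^sup>+\<omega>. f \<omega> \<partial>(WM \<bind> (\<lambda>W. return ?SS (D, S, W)))) \<partial>SM D)"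
      by (rule nn_integral_bind[OF f measurable_prob_algebraD[OF k3D]])
    also have "\<dots> = (\<integral>\<^sup>+S. (\<integral>\<^sup>+W. f (D, S, W) \<partial>WM) \<partial>SM D)"
    proof (rule nn_integral_cong)
      fix S assume "S \<in> space (SM D)"
      then have S: "S \<in> space SB" using SM_space(3)[OF D] by simp
      have "(\<integral>\<^sup>+\<omega>. f \<omega> \<partial>(WM \<bind> (\<lambda>W. return ?SS (D, S, W)))) = (\<integral>\<^sup>+W. (\<integral>\<^sup>+\<omega>. f \<omega> \<partial>return ?SS (D, S, W)) \<partial>WM)"
        by (rule nn_integral_bind[OF f measurable_prob_algebraD[OF wm[OF D S]]])
      also have "\<dots> = (\<integral>\<^sup>+W. f (D, S, W) \<partial>WM)"
        using D S f by (intro nn_integral_cong nn_integral_return) (auto simp: space_sample_space)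
      finally show "(\<integral>\<^sup>+\<omega>. f \<omega> \<partial>(WM \<bind> (\<lambda>W. return ?SS (D, S, W)))) = (\<integral>\<^sup>+W. f (D, S, W) \<partial>WM)" .
    qed
    finally show "(\<integral>\<^sup>+\<omega>. f \<omega> \<partial>(SM D \<bind> (\<lambda>S. WM \<bind> (\<lambda>W. return ?SS (D, S, W)))))
        = (\<integral>\<^sup>+S. (\<integral>\<^sup>+W. f (D, S, W) \<partial>WM) \<partial>SM D)" .
  qed
  finally show "(\<integral>\<^sup>+\<omega>. f \<omega> \<partial>J) = (\<integral>\<^sup>+D. (\<integral>\<^sup>+S. (\<integral>\<^sup>+W. f (D, S, W) \<partial>WM) \<partial>SM D) \<partial>DM)" .
qed

text \<open>These two facts do not mention the integrand; the zero function discharges the premise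
  about it.\<close>

lemmas sets_J = nn_integral_joint(2)[OF measurable_const[of "0::ennreal"], simplified]
lemmas prob_J = nn_integral_joint(3)[OF measurable_const[of "0::ennreal"], simplified]

sublocale J: prob_space J by (rule prob_J)

lemma space_J: "space J = space DM \<times> (space SB \<times> space WM)"
  using sets_eq_imp_space_eq[OF sets_J] by (simp add: space_sample_space)

lemma emeasure_J:
  assumes "X \<in> sets J"
  shows "emeasure J X = (\<integral>\<^sup>+D. (\<integral>\<^sup>+S. (\<integral>\<^sup>+W. indicator X (D, S, W) \<partial>WM) \<partial>SM D) \<partial>DM)"
  using nn_integral_joint(1)[of "indicator X"] assms by (simp add: sets_J)

text \<open>Given \<open>D\<close>, the later stages are probability measures, so they integrate the
  indicator of an event in \<open>D\<close> to itself.\<close>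

lemma measure_J_le_DM:
  assumes E: "Collect P \<inter> space DM \<in> sets DM" "measure DM (Collect P \<inter> space DM) \<le> \<eta>"
    and X: "X \<in> sets J" "\<And>D S W. (D, S, W) \<in> X \<Longrightarrow> P D"
  shows "measure J X \<le> \<eta>"
proof -
  have "emeasure J X \<le> (\<integral>\<^sup>+D. indicator (Collect P \<inter> space DM) D \<partial>DM)"
    unfolding emeasure_J[OF X(1)]
  proof (rule nn_integral_mono)
    fix D assume D: "D \<in> space DM"
    interpret SD: prob_space "SM D" by (rule SM_space(1)[OF D])
    have "(\<integral>\<^sup>+S. (\<integral>\<^sup>+W. indicator X (D, S, W) \<partial>WM) \<partial>SM D)
        \<le> (\<integral>\<^sup>+S. (\<integral>\<^sup>+W. indicator (Collect P \<inter> space DM) D \<partial>WM) \<partial>SM D)"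
      using X(2) D by (intro nn_integral_mono) (auto simp: indicator_def)
    also have "\<dots> = indicator (Collect P \<inter> space DM) D"
      by (simp add: WM.emeasure_space_1 SD.emeasure_space_1)
    finally show "(\<integral>\<^sup>+S. (\<integral>\<^sup>+W. indicator X (D, S, W) \<partial>WM) \<partial>SM D) \<le> indicator (Collect P \<inter> space DM) D" .
  qed
  also have "\<dots> = emeasure DM (Collect P \<inter> space DM)" using E by simp
  also have "\<dots> \<le> ennreal \<eta>" using E(2) by (simp add: DM.emeasure_eq_measure ennreal_leI)
  finally have "ennreal (measure J X) \<le> ennreal \<eta>" by (simp add: J.emeasure_eq_measure)
  moreover have "0 \<le> \<eta>" using E(2) measure_nonneg[of DM] by (rule order.trans[rotated])
  ultimately show ?thesis by simp
qed

text \<open>Given \<open>D\<close>, bag \<open>i\<close> is a coordinate of a product measure and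
  has the i.i.d. law of its own distribution, so a bound valid for every fixed \<open>D\<close>
  survives averaging over \<open>D\<close>. Joint measurability is asked of \<open>X\<close>; the
  sets \<open>E D\<close> need it for each \<open>D\<close> separately.\<close>

lemma measure_J_le_S:
  assumes i: "i < n" and X: "X \<in> sets J" and \<eta>: "0 \<le> \<eta>"
    and E: "\<And>D. D \<in> space DM \<Longrightarrow> E D \<in> sets (PiM {..<ns i} (\<lambda>_. fst (D i)))"
      "\<And>D. D \<in> space DM \<Longrightarrow> measure (PiM {..<ns i} (\<lambda>_. fst (D i))) (E D) \<le> \<eta>"
    and XE: "\<And>D S W. (D, S, W) \<in> X \<Longrightarrow> S i \<in> E D"
  shows "measure J X \<le> \<eta>"
proof -
  have "emeasure J X \<le> (\<integral>\<^sup>+D. ennreal \<eta> \<partial>DM)"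
    unfolding emeasure_J[OF X(1)]
  proof (rule nn_integral_mono)
    fix D assume D: "D \<in> space DM"
    let ?Pi = "PiM {..<ns i} (\<lambda>_. fst (D i))"
    have pr: "prob_space (PiM {..<ns j} (\<lambda>_. fst (D j)))" if "j \<in> {..<n}" for j
      using D_space(1)[OF D] that by (intro prob_space_PiM) auto
    interpret Pi: prob_space ?Pi using pr[of i] i by simp
    have "(\<integral>\<^sup>+S. (\<integral>\<^sup>+W. indicator X (D, S, W) \<partial>WM) \<partial>SM D) \<le> (\<integral>\<^sup>+S. (\<integral>\<^sup>+W. indicator (E D) (S i) \<partial>WM) \<partial>SM D)"
      using XE by (intro nn_integral_mono) (auto simp: indicator_def)
    also have "\<dots> = (\<integral>\<^sup>+S. indicator (E D) (S i) \<partial>SM D)" by (simp add: WM.emeasure_space_1)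
    also have "\<dots> = (\<integral>\<^sup>+X. indicator (E D) X \<partial>distr (SM D) ?Pi (\<lambda>S. S i))"
      using i E(1)[OF D] by (intro nn_integral_distr[symmetric]) auto
    also have "distr (SM D) ?Pi (\<lambda>S. S i) = ?Pi"
      by (rule distr_PiM_component[OF pr]) (use i in auto)
    also have "(\<integral>\<^sup>+X. indicator (E D) X \<partial>?Pi) = ennreal (measure ?Pi (E D))"
      using E(1)[OF D] by (simp add: Pi.emeasure_eq_measure)
    also have "\<dots> \<le> ennreal \<eta>" using E(2)[OF D] by (rule ennreal_leI)
    finally show "(\<integral>\<^sup>+S. (\<integral>\<^sup>+W. indicator X (D, S, W) \<partial>WM) \<partial>SM D) \<le> ennreal \<eta>" .
  qed
  also have "\<dots> = ennreal \<eta>" by (simp add: DM.emeasure_space_1)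
  finally show ?thesis using \<eta> by (simp add: J.emeasure_eq_measure)
qed

text \<open>\<open>W\<close> is independent of \<open>D\<close> and \<open>S\<close>, so inside the
  innermost integral the sample points are constants. This permits evaluating one shared set of
  random features at random points.\<close>

lemma measure_J_le_WM:
  assumes X: "X \<in> sets J" and \<eta>: "0 \<le> \<eta>"
    and E: "\<And>S. S \<in> space SB \<Longrightarrow> E S \<in> sets WM" "\<And>S. S \<in> space SB \<Longrightarrow> measure WM (E S) \<le> \<eta>"
    and XE: "\<And>D S W. (D, S, W) \<in> X \<Longrightarrow> W \<in> E S"
  shows "measure J X \<le> \<eta>"
proof -
  have "emeasure J X \<le> (\<integral>\<^sup>+D. ennreal \<eta> \<partial>DM)"
    unfolding emeasure_J[OF X(1)]
  proof (rule nn_integral_mono)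
    fix D assume D: "D \<in> space DM"
    interpret SD: prob_space "SM D" by (rule SM_space(1)[OF D])
    have "(\<integral>\<^sup>+S. (\<integral>\<^sup>+W. indicator X (D, S, W) \<partial>WM) \<partial>SM D) \<le> (\<integral>\<^sup>+S. ennreal \<eta> \<partial>SM D)"
    proof (rule nn_integral_mono)
      fix S assume "S \<in> space (SM D)"
      then have S: "S \<in> space SB" using SM_space(3)[OF D] by simp
      have "(\<integral>\<^sup>+W. indicator X (D, S, W) \<partial>WM) \<le> (\<integral>\<^sup>+W. indicator (E S) W \<partial>WM)"
        using XE by (intro nn_integral_mono) (auto simp: indicator_def)
      also have "\<dots> = ennreal (measure WM (E S))" using E(1)[OF S] by (simp add: WM.emeasure_eq_measure)
      also have "\<dots> \<le> ennreal \<eta>" using E(2)[OF S] by (rule ennreal_leI)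
      finally show "(\<integral>\<^sup>+W. indicator X (D, S, W) \<partial>WM) \<le> ennreal \<eta>" .
    qed
    also have "\<dots> = ennreal \<eta>" by (simp add: SD.emeasure_space_1)
    finally show "(\<integral>\<^sup>+S. (\<integral>\<^sup>+W. indicator X (D, S, W) \<partial>WM) \<partial>SM D) \<le> ennreal \<eta>" .
  qed
  also have "\<dots> = ennreal \<eta>" by (simp add: DM.emeasure_space_1)
  finally show ?thesis using \<eta> by (simp add: J.emeasure_eq_measure)
qed

section \<open>Measurability of the coordinates of the joint sample\<close>

lemma measurable_J_D: "i < n \<Longrightarrow> (\<lambda>\<omega>. fst (fst \<omega> i)) \<in> J \<rightarrow>\<^sub>M prob_algebra borel"
  unfolding measurable_cong_sets[OF sets_J refl] sample_space_def
  by (rule measurable_compose[OF measurable_fst measurable_fst_D])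

lemma measurable_J_S:
  assumes "i < n" "j < ns i"
  shows "(\<lambda>\<omega>. fst (snd \<omega>) i j) \<in> J \<rightarrow>\<^sub>M borel"
proof -
  have 1: "(\<lambda>S. S i) \<in> SB \<rightarrow>\<^sub>M PiM {..<ns i} (\<lambda>_. borel)"
    by (rule measurable_component_singleton) (use assms in simp)
  have 2: "(\<lambda>X. X j) \<in> PiM {..<ns i} (\<lambda>_. borel) \<rightarrow>\<^sub>M borel"
    by (rule measurable_component_singleton) (use assms in simp)
  show ?thesis
    unfolding measurable_cong_sets[OF sets_J refl] sample_space_def
    by (rule measurable_compose[OF measurable_compose[OF measurable_snd measurable_fst] measurable_compose[OF 1 2]])
qed

lemma measurable_J_W:
  assumes "l < m"
  shows "(\<lambda>\<omega>. snd (snd \<omega>) l) \<in> J \<rightarrow>\<^sub>M RF"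
proof -
  have 1: "(\<lambda>W. W l) \<in> WM \<rightarrow>\<^sub>M RF"
    by (rule measurable_component_singleton) (use assms in simp)
  show ?thesis
    unfolding measurable_cong_sets[OF sets_J refl] sample_space_def
    by (rule measurable_compose[OF measurable_compose[OF measurable_snd measurable_snd] 1])
qed

lemma measurable_J_fst: "fst \<in> J \<rightarrow>\<^sub>M DM"
  unfolding measurable_cong_sets[OF sets_J refl] sample_space_def by (rule measurable_fst)

lemma space_S:
  assumes "S \<in> space SB" "D \<in> space DM" "i < n"
  shows "S i \<in> space (PiM {..<ns i} (\<lambda>_. fst (D i)))"
proof -
  have "space (PiM {..<ns i} (\<lambda>_. fst (D i))) = space (PiM {..<ns i} (\<lambda>_. borel :: 'd measure))"
    by (rule sets_eq_imp_space_eq[OF sets_PiM_cong[OF refl D_space(2)[OF assms(2,3)]]])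
  moreover have "S i \<in> space (PiM {..<ns i} (\<lambda>_. borel :: 'd measure))"
    using PiE_mem[OF assms(1)[unfolded space_PiM[of "{..<n}"]], of i] assms(3) by simp
  ultimately show ?thesis by simp
qed

end

section \<open>Kernels with a spectral density\<close>

text \<open>In the theorem, \<open>c_pos\<close> follows from injectivity of the mean embedding, and
  \<open>c_le_1\<close> from the bound on the kernel diagonal, which is constantly
  \<open>c\<close>.\<close>

locale spectral_kernel =
  fixes Q :: "'d::euclidean_space measure" and k :: "'d \<Rightarrow> 'd \<Rightarrow> real" and p :: "'d \<Rightarrow> real" and c :: real
  assumes Q: "prob_space Q" "sets Q = sets borel"
    and p_nonneg: "\<And>w. p w \<ge> 0" and p_int: "integrable lborel p"
    and c_def: "c = (LINT w|lborel. p w)"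
    and k_spectral: "\<And>z z'. k z z' = (LINT w|lborel. p w * cos (w \<bullet> (z - z')))"
    and k_cont: "continuous_on UNIV (\<lambda>(z, z'). k z z')"
    and c_pos: "c > 0" and c_le_1: "c \<le> 1"
begin

sublocale Q: prob_space Q by (rule Q)

lemma space_Q [simp]: "space Q = UNIV"
  using sets_eq_imp_space_eq[OF Q(2)] by simp

lemma p_measurable [measurable]: "p \<in> borel_measurable borel"
  using p_int by auto

lemma k_diag: "k z z = c"
  by (simp add: k_spectral c_def)

lemma k_abs_le: "\<bar>k z x\<bar> \<le> c"
proof -
  have i: "integrable lborel (\<lambda>w. p w * cos (w \<bullet> (z - x)))"
    by (rule Bochner_Integration.integrable_bound[OF p_int]) (auto simp: abs_mult p_nonneg intro!: mult_left_le)
  have "\<bar>k z x\<bar> \<le> (LINT w|lborel. \<bar>p w * cos (w \<bullet> (z - x))\<bar>)"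
    unfolding k_spectral by (rule integral_abs_bound)
  also have "\<dots> \<le> (LINT w|lborel. p w)"
    using integrable_abs[OF i] p_int by (intro integral_mono) (auto simp: abs_mult p_nonneg intro!: mult_left_le)
  finally show ?thesis by (simp add: c_def)
qed

lemma k_measurable: "(\<lambda>(z, x). k z x) \<in> borel_measurable (borel \<Otimes>\<^sub>M borel)"
  unfolding borel_prod by (rule borel_measurable_continuous_onI[OF k_cont])

lemma k_measurable_Q: "sets P = sets borel \<Longrightarrow> (\<lambda>(z, x). k z x) \<in> borel_measurable (P \<Otimes>\<^sub>M Q)"
  using k_measurable by (simp cong: measurable_cong_sets add: sets_pair_measure_cong[OF _ Q(2)])

lemma k_L2: "k z \<in> L2 Q"
proof (rule Q.L2_boundedI[of _ c])
  have "(\<lambda>x. (\<lambda>(z, x). k z x) (z, x)) \<in> borel_measurable borel"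
    by (rule measurable_compose[OF _ k_measurable]) measurable
  then show "k z \<in> borel_measurable Q" by (simp add: measurable_cong_sets[OF Q(2) refl])
qed (rule k_abs_le)

lemma kme_L2:
  assumes P: "prob_space P" "sets P = sets borel"
  shows "kme k P \<in> L2 Q"
proof (rule Q.L2_boundedI[of _ c])
  interpret P: prob_space P by (rule P)
  have m: "(\<lambda>(x, z). k z x) \<in> borel_measurable (Q \<Otimes>\<^sub>M P)"
    using measurable_compose[OF measurable_pair_swap' k_measurable_Q[OF P(2)]] by (simp add: case_prod_unfold)
  show "kme k P \<in> borel_measurable Q"
    unfolding kme_def by (rule P.borel_measurable_lebesgue_integral[OF m])
  fix x
  have km: "(\<lambda>z. k z x) \<in> borel_measurable P"
    using measurable_compose[OF measurable_Pair1'[of x Q P] m] by simp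
  have i: "integrable P (\<lambda>z. k z x)" by (rule P.integrable_boundedI[OF km k_abs_le])
  have "\<bar>kme k P x\<bar> \<le> (LINT z|P. \<bar>k z x\<bar>)" unfolding kme_def by (rule integral_abs_bound)
  also have "\<dots> \<le> (LINT z|P. c)" using i k_abs_le by (intro integral_mono) auto
  finally show "\<bar>kme k P x\<bar> \<le> c" by (simp add: P.prob_space)
qed

lemma kme_concentration:
  assumes P: "prob_space P" "sets P = sets borel" and N: "N > 0" and \<eta>: "0 < \<eta>" "\<eta> < 1"
  shows "{X \<in> space (PiM {..<N} (\<lambda>_. P)).
            L2norm Q (\<lambda>x. (1 / real N) * (\<Sum>j<N. k (X j) x) - kme k P x)
              > c / sqrt (real N) + 2 * c * sqrt (ln (1 / \<eta>) / (2 * real N))} \<in> sets (PiM {..<N} (\<lambda>_. P))"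
    and "measure (PiM {..<N} (\<lambda>_. P)) {X \<in> space (PiM {..<N} (\<lambda>_. P)).
            L2norm Q (\<lambda>x. (1 / real N) * (\<Sum>j<N. k (X j) x) - kme k P x)
              > c / sqrt (real N) + 2 * c * sqrt (ln (1 / \<eta>) / (2 * real N))} \<le> \<eta>"
  unfolding kme_def
  by (rule prob_space.L2norm_average_concentration[OF P(1) Q(1) N k_measurable_Q[OF P(2)] k_abs_le \<eta>])+

section \<open>Random Fourier features\<close>

definition rf_feature :: "'d \<Rightarrow> 'd \<times> real \<Rightarrow> 'd \<Rightarrow> real" where
  "rf_feature z w x = 2 * c * cos (fst w \<bullet> z + snd w) * cos (fst w \<bullet> x + snd w)"

lemma rf_feature_abs_le: "\<bar>rf_feature z w x\<bar> \<le> 2 * c"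
proof -
  have "\<bar>rf_feature z w x\<bar> = 2 * c * (\<bar>cos (fst w \<bullet> z + snd w)\<bar> * \<bar>cos (fst w \<bullet> x + snd w)\<bar>)"
    using c_pos by (simp add: rf_feature_def abs_mult)
  also have "\<dots> \<le> 2 * c * 1" using c_pos by (intro mult_left_mono mult_le_one) auto
  finally show ?thesis by simp
qed

lemma ghat_eq: "ghat c m W z x = (1 / real m) * (\<Sum>j<m. rf_feature z (W j) x)"
  by (simp add: ghat_def rf_feature_def)

abbreviation "RF \<equiv> rf_measure p c"

lemma sets_RF: "sets RF = sets borel"
  unfolding rf_measure_def borel_prod[symmetric] by (rule sets_pair_measure_cong) simp_all

lemma spectral_prob: "prob_space (density lborel (\<lambda>w. ennreal (p w / c)))"
proof (rule prob_spaceI)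
  have "(\<integral>\<^sup>+w. ennreal (p w / c) \<partial>lborel) = ennreal (LINT w|lborel. p w / c)"
    using p_int p_nonneg c_pos by (intro nn_integral_eq_integral) auto
  also have "(LINT w|lborel. p w / c) = 1" using c_pos by (simp add: c_def[symmetric])
  finally show "emeasure (density lborel (\<lambda>w. ennreal (p w / c))) (space (density lborel (\<lambda>w. ennreal (p w / c)))) = 1"
    by (simp add: emeasure_density)
qed

lemma phase_prob: "prob_space (uniform_measure lborel {0..2*pi})"
  by (rule prob_space_uniform_measure) auto

lemma prob_RF: "prob_space RF"
  unfolding rf_measure_def by (rule prob_space_pair[OF spectral_prob phase_prob])

lemma rf_feature_measurable: "(\<lambda>(w, x). rf_feature z w x) \<in> borel_measurable (RF \<Otimes>\<^sub>M Q)"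
proof -
  have "(\<lambda>(w, x). rf_feature z w x) \<in> borel_measurable (borel \<Otimes>\<^sub>M borel)"
    unfolding borel_prod rf_feature_def case_prod_unfold
    by (intro borel_measurable_continuous_onI continuous_intros)
  then show ?thesis by (simp cong: measurable_cong_sets add: sets_pair_measure_cong[OF sets_RF Q(2)])
qed

text \<open>As \<open>b\<close> runs through \<open>{0..2*pi}\<close>, the angle
  \<open>a + 2 * b\<close> covers exactly two periods of the cosine.\<close>

lemma integral_phase: "(LINT b|uniform_measure lborel {0..2*pi}. cos (a + 2 * b)) = 0"
proof -
  have "((\<lambda>b. sin (a + 2 * b) / 2) has_vector_derivative cos (a + 2 * b)) (at b within {0..2*pi})" for b
    by (auto intro!: derivative_eq_intros simp: has_real_derivative_iff_has_vector_derivative[symmetric])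
  then have "(LBINT b. indicator {0..2*pi} b *\<^sub>R cos (a + 2 * b)) = sin (a + 2 * (2 * pi)) / 2 - sin (a + 2 * 0) / 2"
    by (intro integral_FTC_atLeastAtMost) (auto intro!: continuous_intros)
  also have "sin (a + 2 * (2 * pi)) = sin a"
    using sin_periodic[of "a + 2 * pi"] sin_periodic[of a] by (simp add: algebra_simps)
  finally have *: "(LBINT b. indicator {0..2*pi} b *\<^sub>R cos (a + 2 * b)) = 0" by simp
  have "uniform_measure lborel {0..2*pi} = density lborel (\<lambda>b. ennreal (indicator {0..2*pi} b / (2 * pi)))"
    unfolding uniform_measure_def
    by (intro density_cong) (auto simp: indicator_def ennreal_1[symmetric] divide_ennreal simp del: ennreal_1)
  then have "(LINT b|uniform_measure lborel {0..2*pi}. cos (a + 2 * b))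
      = (LBINT b. (indicator {0..2*pi} b / (2 * pi)) *\<^sub>R cos (a + 2 * b))"
    by (simp add: integral_density)
  also have "\<dots> = (1 / (2 * pi)) * (LBINT b. indicator {0..2*pi} b *\<^sub>R cos (a + 2 * b))"
    by simp
  finally show ?thesis using * by simp
qed

text \<open>The random phase averages out the sum frequency in the product-to-sum formula
  \<open>2 cos (w \<bullet> z + b) cos (w \<bullet> x + b) = cos (w \<bullet> (z - x)) + cos (w \<bullet> (z + x) + 2 b)\<close>.\<close>
lemma rf_feature_mean: "(LINT w|RF. rf_feature z w x) = k z x"
proof -
  let ?W = "density lborel (\<lambda>w. ennreal (p w / c))" and ?U = "uniform_measure lborel {0..2*pi}"
  interpret W: prob_space ?W by (rule spectral_prob)
  interpret U: prob_space ?U by (rule phase_prob)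
  interpret WU: pair_sigma_finite ?W ?U by unfold_locales
  interpret R: prob_space RF by (rule prob_RF)
  have m: "(\<lambda>w. rf_feature z w x) \<in> borel_measurable RF"
    using measurable_compose[OF measurable_Pair2'[of x Q RF] rf_feature_measurable] by simp
  have i: "integrable (?W \<Otimes>\<^sub>M ?U) (\<lambda>(w, b). rf_feature z (w, b) x)"
    using R.integrable_boundedI[OF m rf_feature_abs_le] by (simp add: rf_measure_def case_prod_unfold)
  have "(LINT w|RF. rf_feature z w x) = (LINT w|?W. (LINT b|?U. rf_feature z (w, b) x))"
    using WU.integral_fst'[OF i] by (simp add: rf_measure_def case_prod_unfold)
  also have "\<dots> = (LINT w|?W. c * cos (w \<bullet> (z - x)))"
  proof (rule Bochner_Integration.integral_cong[OF refl])
    fix w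
    have "rf_feature z (w, b) x = c * cos (w \<bullet> (z - x)) + c * cos (w \<bullet> (z + x) + 2 * b)" for b
    proof -
      have "cos (w \<bullet> z + b) * cos (w \<bullet> x + b) = (cos (w \<bullet> (z - x)) + cos (w \<bullet> (z + x) + 2 * b)) / 2"
        unfolding cos_times_cos by (simp add: inner_diff_right inner_add_right algebra_simps)
      then have "2 * c * (cos (w \<bullet> z + b) * cos (w \<bullet> x + b)) = c * (cos (w \<bullet> (z - x)) + cos (w \<bullet> (z + x) + 2 * b))"
        by (simp only:)
      then show ?thesis by (simp add: rf_feature_def distrib_left mult.assoc)
    qed
    moreover have "integrable ?U (\<lambda>b. cos (w \<bullet> (z + x) + 2 * b))"
      by (rule U.integrable_boundedI[where C=1]) auto
    ultimately show "(LINT b|?U. rf_feature z (w, b) x) = c * cos (w \<bullet> (z - x))"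
      by (simp add: integral_phase U.prob_space[unfolded space_uniform_measure])
  qed
  also have "\<dots> = (LINT w|lborel. (p w / c) *\<^sub>R (c * cos (w \<bullet> (z - x))))"
    using p_nonneg c_pos by (intro integral_density) auto
  also have "\<dots> = k z x" unfolding k_spectral using c_pos by (intro Bochner_Integration.integral_cong) auto
  finally show ?thesis .
qed

lemma ghat_L2: "ghat c m W z \<in> L2 Q"
proof -
  have "rf_feature z (W j) \<in> L2 Q" for j
  proof (rule Q.L2_boundedI[OF _ rf_feature_abs_le])
    have "rf_feature z (W j) \<in> borel_measurable borel"
      unfolding rf_feature_def by (intro borel_measurable_continuous_onI continuous_intros)
    then show "rf_feature z (W j) \<in> borel_measurable Q" by (simp add: measurable_cong_sets[OF Q(2) refl])
  qed
  then have "(\<lambda>x. (1 / real m) * (\<Sum>j<m. rf_feature z (W j) x)) \<in> L2 Q"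
    by (intro L2_scale L2_sum)
  then show ?thesis unfolding ghat_eq[abs_def] .
qed

text \<open>Here \<open>z\<close> is fixed and the features are the i.i.d. sample; they are bounded
  by \<open>2 * c\<close> and have mean \<open>k z\<close>. The stated form pulls
  \<open>1 / sqrt m\<close> out of both terms by
  \<open>2 * sqrt (y / 2) = sqrt (2 * y)\<close>.\<close>

lemma ghat_concentration:
  assumes m: "m > 0" and \<eta>: "0 < \<eta>" "\<eta> < 1"
  shows "{W \<in> space (PiM {..<m} (\<lambda>_. RF)).
            L2norm Q (\<lambda>x. ghat c m W z x - k z x) > (2 * c / sqrt (real m)) * (1 + sqrt (2 * ln (1 / \<eta>)))}
              \<in> sets (PiM {..<m} (\<lambda>_. RF))"
    and "measure (PiM {..<m} (\<lambda>_. RF)) {W \<in> space (PiM {..<m} (\<lambda>_. RF)).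
            L2norm Q (\<lambda>x. ghat c m W z x - k z x) > (2 * c / sqrt (real m)) * (1 + sqrt (2 * ln (1 / \<eta>)))} \<le> \<eta>"
proof -
  have "2 * sqrt (ln (1 / \<eta>) / (2 * real m)) = sqrt (2 * ln (1 / \<eta>)) / sqrt (real m)"
  proof -
    have "2 * sqrt (ln (1 / \<eta>) / (2 * real m)) = sqrt (4 * (ln (1 / \<eta>) / (2 * real m)))"
      by (simp only: real_sqrt_mult real_sqrt_four)
    also have "4 * (ln (1 / \<eta>) / (2 * real m)) = (2 * ln (1 / \<eta>)) / real m" by simp
    finally show ?thesis by (simp only: real_sqrt_divide)
  qed
  then have "2 * c / sqrt (real m) + 2 * (2 * c) * sqrt (ln (1 / \<eta>) / (2 * real m))
      = (2 * c / sqrt (real m)) * (1 + sqrt (2 * ln (1 / \<eta>)))"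
  proof -
    assume *: "2 * sqrt (ln (1 / \<eta>) / (2 * real m)) = sqrt (2 * ln (1 / \<eta>)) / sqrt (real m)"
    have "2 * c / sqrt (real m) + 2 * (2 * c) * sqrt (ln (1 / \<eta>) / (2 * real m))
        = 2 * c / sqrt (real m) + 2 * c * (2 * sqrt (ln (1 / \<eta>) / (2 * real m)))" by simp
    also have "\<dots> = (2 * c / sqrt (real m)) * (1 + sqrt (2 * ln (1 / \<eta>)))"
      unfolding * by (simp add: distrib_left)
    finally show ?thesis .
  qed
  then show "{W \<in> space (PiM {..<m} (\<lambda>_. RF)).
            L2norm Q (\<lambda>x. ghat c m W z x - k z x) > (2 * c / sqrt (real m)) * (1 + sqrt (2 * ln (1 / \<eta>)))}
              \<in> sets (PiM {..<m} (\<lambda>_. RF))"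
    and "measure (PiM {..<m} (\<lambda>_. RF)) {W \<in> space (PiM {..<m} (\<lambda>_. RF)).
            L2norm Q (\<lambda>x. ghat c m W z x - k z x) > (2 * c / sqrt (real m)) * (1 + sqrt (2 * ln (1 / \<eta>)))} \<le> \<eta>"
    using prob_space.L2norm_average_concentration[OF prob_RF Q(1) m rf_feature_measurable[of z] rf_feature_abs_le \<eta>]
    by (simp_all only: rf_feature_mean ghat_eq)
qed

end

text \<open>A functional is recorded by its values on the sequence \<open>h\<close>. These records
  lie in a countable product of real lines, where every subset has a countable dense subset.
  Convergence at each \<open>h j\<close> spreads to the points they approximate, because the
  Lipschitz constant is common to all of \<open>F\<close>.\<close>

lemma lipschitz_countable_dense:
  fixes F :: "(('d \<Rightarrow> real) \<Rightarrow> real) set" and h :: "nat \<Rightarrow> 'd \<Rightarrow> real"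
  assumes lip: "\<And>f u v. f \<in> F \<Longrightarrow> u \<in> L2 Q \<Longrightarrow> v \<in> L2 Q \<Longrightarrow> \<bar>f u - f v\<bar> \<le> K * L2norm Q (\<lambda>x. u x - v x)"
    and K: "K \<ge> 0" and h: "\<And>j. h j \<in> L2 Q"
  obtains F' where "countable F'" "F' \<subseteq> F"
    "\<And>f. f \<in> F \<Longrightarrow> \<exists>s. range s \<subseteq> F' \<and>
       (\<forall>u\<in>L2 Q. (\<forall>e>0. \<exists>j. L2norm Q (\<lambda>x. u x - h j x) < e) \<longrightarrow> (\<lambda>r. s r u) \<longlonglongrightarrow> f u)"
proof -
  define \<Phi> where "\<Phi> f j = f (h j)" for f :: "('d \<Rightarrow> real) \<Rightarrow> real" and j
  obtain T where T: "countable T" "T \<subseteq> \<Phi> ` F" "\<Phi> ` F \<subseteq> closure T"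
    by (rule separable)
  show thesis
  proof
    show "countable (inv_into F \<Phi> ` T)" using T(1) by simp
    show "inv_into F \<Phi> ` T \<subseteq> F" using T(2) by (auto intro: inv_into_into)
    fix f assume f: "f \<in> F"
    then have "\<Phi> f \<in> closure T" using T(3) by auto
    then obtain t where t: "\<And>r. t r \<in> T" "t \<longlonglongrightarrow> \<Phi> f" unfolding closure_sequential by auto
    define s where "s r = inv_into F \<Phi> (t r)" for r
    have sF: "s r \<in> F" for r using t(1)[of r] T(2) unfolding s_def by (intro inv_into_into) auto
    have s: "\<Phi> (s r) = t r" for r
    proof -
      have "t r \<in> \<Phi> ` F" using t(1)[of r] T(2) by blast
      then show ?thesis unfolding s_def by (rule f_inv_into_f)
    qed
    have sh: "(\<lambda>r. s r (h j)) \<longlonglongrightarrow> f (h j)" for j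
    proof -
      have "(\<lambda>r. t r j) \<longlonglongrightarrow> \<Phi> f j"
        by (rule continuous_on_tendsto_compose[OF continuous_on_product_coordinates[of j] t(2)]) auto
      then show ?thesis unfolding s[symmetric] \<Phi>_def .
    qed
    have "(\<lambda>r. s r u) \<longlonglongrightarrow> f u" if u: "u \<in> L2 Q" and d: "\<forall>e>0. \<exists>j. L2norm Q (\<lambda>x. u x - h j x) < e" for u
    proof (rule LIMSEQ_I)
      fix e :: real assume e: "e > 0"
      \<comment> \<open>The two Lipschitz comparisons with \<open>h j\<close> cost
        \<open>e / 4\<close> each, and convergence at \<open>h j\<close> costs \<open>e / 2\<close>.
        Dividing by \<open>K + 1\<close> covers the case \<open>K = 0\<close>.\<close>
      obtain j where j: "L2norm Q (\<lambda>x. u x - h j x) < e / (4 * (K + 1))"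
        using d e K by (auto dest: spec[of _ "e / (4 * (K + 1))"])
      have Kj: "K * L2norm Q (\<lambda>x. u x - h j x) \<le> e / 4"
      proof -
        have "K * L2norm Q (\<lambda>x. u x - h j x) \<le> (K + 1) * (e / (4 * (K + 1)))"
          using j K by (intro mult_mono) auto
        also have "(K + 1) * (e / (4 * (K + 1))) = e / 4" using K by (simp add: field_simps)
        finally show ?thesis .
      qed
      obtain R where R: "\<And>r. r \<ge> R \<Longrightarrow> \<bar>s r (h j) - f (h j)\<bar> < e / 2"
        using LIMSEQ_D[OF sh[of j], of "e / 2"] e by auto
      have "norm (s r u - f u) < e" if "r \<ge> R" for r
        using lip[OF sF[of r] u h[of j]] lip[OF f u h[of j]] R[OF that] Kj unfolding real_norm_def by linarith
      then show "\<exists>R. \<forall>r\<ge>R. norm (s r u - f u) < e" by blast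
    qed
    then show "\<exists>s. range s \<subseteq> inv_into F \<Phi> ` T \<and>
       (\<forall>u\<in>L2 Q. (\<forall>e>0. \<exists>j. L2norm Q (\<lambda>x. u x - h j x) < e) \<longrightarrow> (\<lambda>r. s r u) \<longlonglongrightarrow> f u)"
      using t(1) by (intro exI[of _ s]) (auto simp: s_def)
  qed
qed

context spectral_kernel
begin

text \<open>Averages of kernel sections at finitely many points of a countable dense set
  \<open>Z\<close> suffice. The probabilistic method shows that some average comes close to
  \<open>kme k P\<close>: the mean error of \<open>N\<close> independent samples is at most
  \<open>c / sqrt N\<close>, so some sample does no worse than that allows. Continuity of
  \<open>k\<close> then moves its points into \<open>Z\<close>.\<close>

lemma kme_countable_dense:
  obtains h :: "nat \<Rightarrow> 'd \<Rightarrow> real" where "\<And>j. h j \<in> L2 Q"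
    "\<And>P e. prob_space P \<Longrightarrow> sets P = sets borel \<Longrightarrow> e > 0 \<Longrightarrow> \<exists>j. L2norm Q (\<lambda>x. kme k P x - h j x) < e"
proof -
  obtain Z :: "'d set" where Z: "countable Z" "\<And>X. open X \<Longrightarrow> X \<noteq> {} \<Longrightarrow> \<exists>z\<in>Z. z \<in> X"
    by (rule countable_dense_setE) blast
  define avg where "avg zs = (\<lambda>x. (1 / real (length zs)) * (\<Sum>j<length zs. k (zs ! j) x))" for zs :: "'d list"
  define h where "h = from_nat_into (avg ` lists Z)"
  have ne: "avg ` lists Z \<noteq> {}" by auto
  have "countable (avg ` lists Z)" using Z(1) by (intro countable_image countable_lists)
  then have h: "range h = avg ` lists Z" unfolding h_def by (rule range_from_nat_into[OF ne])
  have avgL: "avg zs \<in> L2 Q" for zs unfolding avg_def by (intro L2_scale L2_sum k_L2)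
  show thesis
  proof
    show "h j \<in> L2 Q" for j
    proof -
      have "h j \<in> avg ` lists Z" using h by blast
      then obtain zs where "h j = avg zs" by auto
      then show ?thesis by (simp only: avgL)
    qed
    fix P :: "'d measure" and e :: real assume P: "prob_space P" "sets P = sets borel" and e: "e > 0"
    interpret P: prob_space P by (rule P)
    \<comment> \<open>This choice makes \<open>c / sqrt N\<close> smaller than \<open>e / 2\<close>,
      leaving the other half for moving the points.\<close>
    obtain N :: nat where N: "(2 * c / e)\<^sup>2 < real N" using reals_Archimedean2 by blast
    have N0: "N > 0" using N by (cases N) (auto simp: not_less[symmetric])
    have "2 * c / e < sqrt (real N)" using N by (rule real_less_rsqrt)
    then have cN: "c / sqrt (real N) < e / 2" using e N0 by (simp add: field_simps)
    let ?PN = "PiM {..<N} (\<lambda>_. P)"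
    interpret PN: prob_space ?PN by (intro prob_space_PiM) unfold_locales
    define \<psi> where "\<psi> X = L2norm Q (\<lambda>x. (1 / real N) * (\<Sum>j<N. k (X j) x) - (LINT z|P. k z x))" for X
    note ms = P.L2norm_average_mean_square[OF Q(1) N0 k_measurable_Q[OF P(2)] k_abs_le, folded \<psi>_def]
    have \<psi>0: "0 \<le> \<psi> X" for X unfolding \<psi>_def by simp
    have "\<exists>X\<in>space ?PN. \<psi> X < e / 2"
    proof (rule ccontr)
      assume "\<not> (\<exists>X\<in>space ?PN. \<psi> X < e / 2)"
      moreover have "integrable ?PN \<psi>"
        using ms(1,2) by (intro PN.integrable_boundedI[where C="2 * c"]) (auto simp: abs_of_nonneg \<psi>0)
      ultimately have "e / 2 \<le> (\<integral>X. \<psi> X \<partial>?PN)" by (intro PN.integral_ge_const AE_I2) (auto simp: not_less)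
      then show False using ms(4) cN by linarith
    qed
    then obtain X where X: "\<psi> X < e / 2" by auto
    have "\<exists>z\<in>Z. dist z (X j) < inverse (real (Suc r))" for j r
      using Z(2)[of "ball (X j) (inverse (real (Suc r)))"] by (auto simp: dist_commute)
    then have "\<forall>r j. \<exists>z. z \<in> Z \<and> dist z (X j) < inverse (real (Suc r))" by blast
    then obtain q where "\<forall>r j. q r j \<in> Z \<and> dist (q r j) (X j) < inverse (real (Suc r))" by metis
    then have q: "\<And>j r. q r j \<in> Z" "\<And>j r. dist (q r j) (X j) < inverse (real (Suc r))" by blast+
    have qX: "(\<lambda>r. q r j) \<longlonglongrightarrow> X j" for j
    proof (rule metric_LIMSEQ_I)
      fix d :: real assume "d > 0"
      then obtain R where R: "inverse (real (Suc R)) < d" using reals_Archimedean by blast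
      have "dist (q r j) (X j) < d" if "r \<ge> R" for r
      proof -
        have "inverse (real (Suc r)) \<le> inverse (real (Suc R))" using that by (intro le_imp_inverse_le) auto
        then show ?thesis using q(2)[of r j] R by linarith
      qed
      then show "\<exists>R. \<forall>r\<ge>R. dist (q r j) (X j) < d" by blast
    qed
    define a where "a r x = (1 / real N) * (\<Sum>j<N. k (X j) x) - (1 / real N) * (\<Sum>j<N. k (q r j) x)" for r x
    have am: "a r \<in> L2 Q" for r unfolding a_def by (intro L2_diff L2_scale L2_sum k_L2)
    have ab: "\<bar>a r x\<bar> \<le> 2 * c" for r x
    proof -
      have "\<bar>\<Sum>j<N. k (y j) x\<bar> \<le> real N * c" for y
        using sum_bounded_above[of "{..<N}" "\<lambda>j. \<bar>k (y j) x\<bar>" c] k_abs_le by (intro order.trans[OF sum_abs]) auto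
      then have "\<bar>(1 / real N) * (\<Sum>j<N. k (y j) x)\<bar> \<le> c" for y using N0 by (simp add: abs_mult field_simps)
      from this[of X] this[of "q r"] show ?thesis unfolding a_def by linarith
    qed
    have k_tend: "(\<lambda>r. k (q r j) x) \<longlonglongrightarrow> k (X j) x" for j x
    proof -
      have "(\<lambda>r. (\<lambda>(z, z'). k z z') (q r j, x)) \<longlonglongrightarrow> (\<lambda>(z, z'). k z z') (X j, x)"
        by (rule continuous_on_tendsto_compose[OF k_cont tendsto_Pair[OF qX tendsto_const]]) auto
      then show ?thesis by simp
    qed
    \<comment> \<open>Moving the points costs nothing in the limit: \<open>a r\<close> tends to 0
      pointwise by continuity of \<open>k\<close>, and its square is dominated by a
      constant.\<close>
    have "(\<lambda>r. LINT x|Q. (a r x)\<^sup>2) \<longlonglongrightarrow> (LINT x|Q. 0)"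
    proof (rule integral_dominated_convergence[where w="\<lambda>_. (2 * c)\<^sup>2"])
      show "(\<lambda>x. (a r x)\<^sup>2) \<in> borel_measurable Q" for r using am[of r] by (auto simp: L2_def)
      show "AE x in Q. norm ((a r x)\<^sup>2) \<le> (2 * c)\<^sup>2" for r
        using power_mono[OF ab, of r _ 2] by (intro AE_I2) (simp only: power2_abs, simp)
      show "AE x in Q. (\<lambda>r. (a r x)\<^sup>2) \<longlonglongrightarrow> 0"
      proof (rule AE_I2)
        fix x
        have "(\<lambda>r. (a r x)\<^sup>2) \<longlonglongrightarrow> ((1 / real N) * (\<Sum>j<N. k (X j) x) - (1 / real N) * (\<Sum>j<N. k (X j) x))\<^sup>2"
          unfolding a_def by (intro tendsto_intros k_tend)
        then show "(\<lambda>r. (a r x)\<^sup>2) \<longlonglongrightarrow> 0" by simp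
      qed
    qed auto
    then have "(\<lambda>r. L2norm Q (a r)) \<longlonglongrightarrow> sqrt 0" unfolding L2norm_def by (intro tendsto_intros) simp
    then obtain r where r: "L2norm Q (a r) < e / 2"
      using LIMSEQ_D[of "\<lambda>r. L2norm Q (a r)" 0 "e / 2"] e by auto
    have av: "avg (map (q r) [0..<N]) x = (1 / real N) * (\<Sum>j<N. k (q r j) x)" for x
      unfolding avg_def by simp
    have "avg (map (q r) [0..<N]) \<in> avg ` lists Z" using q(1) by (intro imageI) auto
    then obtain i where i: "h i = avg (map (q r) [0..<N])" unfolding h[symmetric] by (metis imageE)
    have "L2norm Q (\<lambda>x. kme k P x - h i x) \<le> L2norm Q (\<lambda>x. kme k P x - (1 / real N) * (\<Sum>j<N. k (X j) x))
        + L2norm Q (\<lambda>x. (1 / real N) * (\<Sum>j<N. k (X j) x) - h i x)"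
      unfolding i by (intro L2norm_diff_le kme_L2 P avgL L2_scale L2_sum k_L2)
    also have "L2norm Q (\<lambda>x. kme k P x - (1 / real N) * (\<Sum>j<N. k (X j) x)) = \<psi> X"
      unfolding \<psi>_def kme_def by (rule L2norm_minus_commute)
    also have "L2norm Q (\<lambda>x. (1 / real N) * (\<Sum>j<N. k (X j) x) - h i x) = L2norm Q (a r)"
      unfolding i av a_def ..
    finally show "\<exists>j. L2norm Q (\<lambda>x. kme k P x - h j x) < e" using X r by (intro exI[of _ i]) linarith
  qed
qed

section \<open>Joint measurability of the approximation errors\<close>

lemma L2norm_measurable:
  assumes "(\<lambda>(y, x). f y x) \<in> borel_measurable (Y \<Otimes>\<^sub>M Q)"
  shows "(\<lambda>y. L2norm Q (f y)) \<in> borel_measurable Y"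
proof -
  have "(\<lambda>(y, x). (f y x)\<^sup>2) \<in> borel_measurable (Y \<Otimes>\<^sub>M Q)"
    using borel_measurable_power[OF assms, of 2] by (simp add: case_prod_unfold)
  then have "(\<lambda>y. LINT x|Q. (f y x)\<^sup>2) \<in> borel_measurable Y" by (rule Q.borel_measurable_lebesgue_integral)
  then show ?thesis unfolding L2norm_def by measurable
qed

lemma snd_Q_measurable: "snd \<in> Y \<Otimes>\<^sub>M Q \<rightarrow>\<^sub>M borel"
  using measurable_snd[of Y Q] by (simp only: measurable_cong_sets[OF refl Q(2)])

lemma k_comp_measurable:
  assumes "g \<in> Y \<rightarrow>\<^sub>M borel"
  shows "(\<lambda>(y, x). k (g y) x) \<in> borel_measurable (Y \<Otimes>\<^sub>M Q)"
proof -
  have "(\<lambda>q. (g (fst q), snd q)) \<in> Y \<Otimes>\<^sub>M Q \<rightarrow>\<^sub>M borel \<Otimes>\<^sub>M borel"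
    by (intro measurable_Pair measurable_compose[OF measurable_fst assms] snd_Q_measurable)
  from measurable_compose[OF this k_measurable] show ?thesis by (simp add: case_prod_unfold)
qed

text \<open>Integration against a measure that itself varies measurably is handled for nonnegative
  integrands, so \<open>k\<close> is shifted up by its bound \<open>c\<close>. Subtracting
  \<open>c\<close> afterwards is exact because each \<open>L y\<close> has total mass 1.\<close>

lemma kme_comp_measurable:
  assumes L: "L \<in> Y \<rightarrow>\<^sub>M prob_algebra borel"
  shows "(\<lambda>(y, x). kme k (L y) x) \<in> borel_measurable (Y \<Otimes>\<^sub>M Q)"
proof -
  have "(\<lambda>(q, z). (z, snd q)) \<in> (Y \<Otimes>\<^sub>M Q) \<Otimes>\<^sub>M borel \<rightarrow>\<^sub>M borel \<Otimes>\<^sub>M borel"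
    unfolding case_prod_unfold
    by (intro measurable_Pair measurable_snd measurable_compose[OF measurable_fst snd_Q_measurable])
  from measurable_compose[OF this k_measurable]
  have "(\<lambda>(q, z). k z (snd q)) \<in> borel_measurable ((Y \<Otimes>\<^sub>M Q) \<Otimes>\<^sub>M borel)"
    by (simp add: case_prod_unfold)
  then have m: "(\<lambda>(q, z). ennreal (k z (snd q) + c)) \<in> borel_measurable ((Y \<Otimes>\<^sub>M Q) \<Otimes>\<^sub>M borel)"
    unfolding case_prod_unfold by measurable
  have "(\<lambda>q. \<integral>\<^sup>+z. ennreal (k z (snd q) + c) \<partial>L (fst q)) \<in> borel_measurable (Y \<Otimes>\<^sub>M Q)"
    by (rule nn_integral_measurable_subprob_algebra2[OF m])
       (rule measurable_compose[OF measurable_fst measurable_prob_algebraD[OF L]])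
  then have "(\<lambda>q. enn2real (\<integral>\<^sup>+z. ennreal (k z (snd q) + c) \<partial>L (fst q)) - c) \<in> borel_measurable (Y \<Otimes>\<^sub>M Q)"
    by measurable
  moreover have "kme k (L (fst q)) (snd q) = enn2real (\<integral>\<^sup>+z. ennreal (k z (snd q) + c) \<partial>L (fst q)) - c"
    if "q \<in> space (Y \<Otimes>\<^sub>M Q)" for q
  proof -
    have P: "prob_space (L (fst q))" "sets (L (fst q)) = sets borel"
      using measurable_space[OF L, of "fst q"] that by (auto simp: space_pair_measure space_prob_algebra)
    interpret P: prob_space "L (fst q)" by (rule P)
    have "(\<lambda>z. (\<lambda>(z, x). k z x) (z, snd q)) \<in> borel_measurable borel"
      by (rule measurable_compose[OF _ k_measurable]) measurable
    then have km: "(\<lambda>z. k z (snd q)) \<in> borel_measurable (L (fst q))"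
      by (simp add: measurable_cong_sets[OF P(2) refl])
    have i: "integrable (L (fst q)) (\<lambda>z. k z (snd q))" by (rule P.integrable_boundedI[OF km k_abs_le])
    have nonneg: "0 \<le> k z (snd q) + c" for z using k_abs_le[of z "snd q"] by linarith
    have "enn2real (\<integral>\<^sup>+z. ennreal (k z (snd q) + c) \<partial>L (fst q)) = (LINT z|L (fst q). k z (snd q) + c)"
      using km nonneg by (intro integral_eq_nn_integral[symmetric]) auto
    also have "\<dots> = kme k (L (fst q)) (snd q) + c"
      using i by (simp add: kme_def P.prob_space)
    finally show ?thesis by simp
  qed
  ultimately show ?thesis
    unfolding case_prod_unfold by (subst measurable_cong) auto
qed

lemma ghat_comp_measurable:
  assumes W: "\<And>l. l < m \<Longrightarrow> (\<lambda>y. W y l) \<in> Y \<rightarrow>\<^sub>M borel" and g: "g \<in> Y \<rightarrow>\<^sub>M borel"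
  shows "(\<lambda>(y, x). ghat c m (W y) (g y) x) \<in> borel_measurable (Y \<Otimes>\<^sub>M Q)"
proof -
  have "(\<lambda>q. rf_feature (g (fst q)) (W (fst q) l) (snd q)) \<in> borel_measurable (Y \<Otimes>\<^sub>M Q)" if "l < m" for l
  proof -
    have *: "(\<lambda>t. rf_feature (fst t) (fst (snd t)) (snd (snd t))) \<in> borel_measurable borel"
      unfolding rf_feature_def by (intro borel_measurable_continuous_onI continuous_intros)
    have "(\<lambda>q. (g (fst q), W (fst q) l, snd q)) \<in> Y \<Otimes>\<^sub>M Q \<rightarrow>\<^sub>M borel \<Otimes>\<^sub>M (borel \<Otimes>\<^sub>M borel)"
      by (intro measurable_Pair measurable_compose[OF measurable_fst g] measurable_compose[OF measurable_fst W[OF that]]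
          snd_Q_measurable)
    then have "(\<lambda>q. (g (fst q), W (fst q) l, snd q)) \<in> Y \<Otimes>\<^sub>M Q \<rightarrow>\<^sub>M borel" by (simp add: borel_prod)
    from measurable_compose[OF this *] show ?thesis by simp
  qed
  then show ?thesis unfolding ghat_eq case_prod_unfold by (intro borel_measurable_times borel_measurable_sum measurable_const) auto
qed

text \<open>A Lipschitz class on a separable subset of \<open>L2 Q\<close> is separable for pointwise convergence, so
  the suprema over \<open>F\<close> below are suprema over a countable subclass.\<close>
lemma deviation_le_of_countable:
  assumes F_lip: "\<And>f h h'. f \<in> F \<Longrightarrow> h \<in> L2 Q \<Longrightarrow> h' \<in> L2 Q \<Longrightarrow> \<bar>f h - f h'\<bar> \<le> LQ * L2norm Q (\<lambda>x. h x - h' x)"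
    and LQ: "LQ \<ge> 0"
    and M: "prob_space M" "\<And>x. x \<in> space M \<Longrightarrow> prob_space (fst x) \<and> sets (fst x) = sets borel \<and> snd x \<in> {-1, 1 :: real}"
    and \<phi>_nonneg: "\<And>x. \<phi> x \<ge> 0" and \<phi>_lip: "\<And>x y. \<bar>\<phi> x - \<phi> y\<bar> \<le> L\<phi> * \<bar>x - y\<bar>"
    and \<phi>_B: "\<And>f h l. f \<in> F \<Longrightarrow> h \<in> L2 Q \<Longrightarrow> l \<in> {-1, 1} \<Longrightarrow> \<phi> (- f h * l) \<le> B"
    and meas_loss: "\<And>f. f \<in> F \<Longrightarrow> (\<lambda>x. \<phi> (- f (kme k (fst x)) * snd x)) \<in> borel_measurable M"
  obtains F' where "countable F'" "F' \<subseteq> F"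
    "\<And>D a f. D \<in> space (PiM {..<n} (\<lambda>_. M)) \<Longrightarrow> f \<in> F \<Longrightarrow>
        (\<And>f. f \<in> F' \<Longrightarrow> risk M \<phi> k f - (1 / real n) * (\<Sum>i<n. \<phi> (- f (kme k (fst (D i))) * snd (D i))) \<le> a) \<Longrightarrow>
        risk M \<phi> k f - (1 / real n) * (\<Sum>i<n. \<phi> (- f (kme k (fst (D i))) * snd (D i))) \<le> a"
proof -
  interpret M: prob_space M by (rule M)
  obtain h :: "nat \<Rightarrow> 'd \<Rightarrow> real" where h: "\<And>j. h j \<in> L2 Q"
    "\<And>P e. prob_space P \<Longrightarrow> sets P = sets borel \<Longrightarrow> e > 0 \<Longrightarrow> \<exists>j. L2norm Q (\<lambda>x. kme k P x - h j x) < e"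
    by (rule kme_countable_dense) blast
  obtain F' where F': "countable F'" "F' \<subseteq> F" and
    dense: "\<And>f. f \<in> F \<Longrightarrow> \<exists>s. range s \<subseteq> F' \<and>
       (\<forall>u\<in>L2 Q. (\<forall>e>0. \<exists>j. L2norm Q (\<lambda>x. u x - h j x) < e) \<longrightarrow> (\<lambda>r. s r u) \<longlonglongrightarrow> f u)"
    by (rule lipschitz_countable_dense[where h=h, OF F_lip LQ h(1)]) blast+
  show thesis
  proof (rule that[OF F'])
    fix D a f assume D: "D \<in> space (PiM {..<n} (\<lambda>_. M))" and f: "f \<in> F"
      and le: "\<And>f. f \<in> F' \<Longrightarrow> risk M \<phi> k f - (1 / real n) * (\<Sum>i<n. \<phi> (- f (kme k (fst (D i))) * snd (D i))) \<le> a"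
    obtain s where s: "range s \<subseteq> F'" and
      lim: "\<And>u. u \<in> L2 Q \<Longrightarrow> (\<forall>e>0. \<exists>j. L2norm Q (\<lambda>x. u x - h j x) < e) \<Longrightarrow> (\<lambda>r. s r u) \<longlonglongrightarrow> f u"
      using dense[OF f] by blast
    have sF: "s r \<in> F" for r using s F'(2) by auto
    have loss_lim: "(\<lambda>r. \<phi> (- s r (kme k (fst x)) * snd x)) \<longlonglongrightarrow> \<phi> (- f (kme k (fst x)) * snd x)" if x: "x \<in> space M" for x
    proof -
      have P: "prob_space (fst x)" "sets (fst x) = sets borel" using M(2)[OF x] by auto
      have sl: "(\<lambda>r. s r (kme k (fst x))) \<longlonglongrightarrow> f (kme k (fst x))"
        using lim[OF kme_L2[OF P]] h(2)[OF P] by blast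
      have "(\<lambda>r. L\<phi> * \<bar>(- s r (kme k (fst x)) * snd x) - (- f (kme k (fst x)) * snd x)\<bar>)
          \<longlonglongrightarrow> L\<phi> * \<bar>(- f (kme k (fst x)) * snd x) - (- f (kme k (fst x)) * snd x)\<bar>"
        by (intro tendsto_intros sl)
      then have "(\<lambda>r. L\<phi> * \<bar>(- s r (kme k (fst x)) * snd x) - (- f (kme k (fst x)) * snd x)\<bar>) \<longlonglongrightarrow> 0" by simp
      then have "(\<lambda>r. \<phi> (- s r (kme k (fst x)) * snd x) - \<phi> (- f (kme k (fst x)) * snd x)) \<longlonglongrightarrow> 0"
        by (rule Lim_null_comparison[rotated]) (simp only: real_norm_def \<phi>_lip eventually_True)
      then show ?thesis by (rule LIM_zero_cancel)
    qed
    \<comment> \<open>The losses lie in \<open>[0, B]\<close>, so the risks converge by dominated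
      convergence; with the finitely many losses at the sample, the whole deviation passes to the
      limit.\<close>
    have "(\<lambda>r. risk M \<phi> k (s r)) \<longlonglongrightarrow> risk M \<phi> k f"
      unfolding risk_def
    proof (rule integral_dominated_convergence[where w="\<lambda>_. B"])
      show "AE x in M. norm (\<phi> (- s r (kme k (fst x)) * snd x)) \<le> B" for r
      proof (rule AE_I2)
        fix x assume "x \<in> space M"
        then have "kme k (fst x) \<in> L2 Q" "snd x \<in> {-1, 1}" using M(2) kme_L2 by blast+
        then show "norm (\<phi> (- s r (kme k (fst x)) * snd x)) \<le> B"
          using \<phi>_B[OF sF[of r]] \<phi>_nonneg by (simp only: real_norm_def abs_of_nonneg)
      qed
    qed (use meas_loss f sF loss_lim in auto)
    moreover have "D i \<in> space M" if "i < n" for i using D that by (auto simp: space_PiM)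
    ultimately have "(\<lambda>r. risk M \<phi> k (s r) - (1 / real n) * (\<Sum>i<n. \<phi> (- s r (kme k (fst (D i))) * snd (D i))))
        \<longlonglongrightarrow> risk M \<phi> k f - (1 / real n) * (\<Sum>i<n. \<phi> (- f (kme k (fst (D i))) * snd (D i)))"
      by (intro tendsto_diff tendsto_mult tendsto_const tendsto_sum loss_lim) auto
    then show "risk M \<phi> k f - (1 / real n) * (\<Sum>i<n. \<phi> (- f (kme k (fst (D i))) * snd (D i))) \<le> a"
    proof (rule LIMSEQ_le_const2, intro exI allI impI)
      show "risk M \<phi> k (s r) - (1 / real n) * (\<Sum>i<n. \<phi> (- s r (kme k (fst (D i))) * snd (D i))) \<le> a" for r
        by (rule le) (use s in blast)
    qed
  qed
qed

end

section \<open>The generalization bound\<close>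

theorem theorem6p4:
  fixes Q :: "'d::euclidean_space measure"
    and k :: "'d \<Rightarrow> 'd \<Rightarrow> real"
    and p :: "'d \<Rightarrow> real" and c :: real
    and M :: "('d measure \<times> real) measure"
    and n m :: nat and ns :: "nat \<Rightarrow> nat"
    and F :: "(('d \<Rightarrow> real) \<Rightarrow> real) set"
    and LQ L\<phi> B \<delta> :: real and \<phi> :: "real \<Rightarrow> real"
    and fstar :: "('d \<Rightarrow> real) \<Rightarrow> real"
    and fsel :: "(nat \<Rightarrow> 'd measure \<times> real) \<times> (nat \<Rightarrow> nat \<Rightarrow> 'd) \<times> (nat \<Rightarrow> 'd \<times> real)
                  \<Rightarrow> (('d \<Rightarrow> real) \<Rightarrow> real)"
  assumes Q: "prob_space Q" "sets Q = sets borel"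
    and p_nonneg: "\<And>w. p w \<ge> 0" and p_int: "integrable lborel p"
    and c_def: "c = (LINT w|lborel. p w)"
    and k_spectral: "\<And>z z'. k z z' = (LINT w|lborel. p w * cos (w \<bullet> (z - z')))"
    and k_bounded: "bounded (range (\<lambda>(z, z'). k z z'))"
    and k_cont: "continuous_on UNIV (\<lambda>(z, z'). k z z')"
    and k_diag: "\<And>z. k z z \<le> 1"
    and k_char: "characteristic k"
    and M: "prob_space M" "sets M = sets (prob_algebra (borel :: 'd measure) \<Otimes>\<^sub>M count_space {-1, 1})"
    and n_pos: "n > 0" and ns_pos: "\<And>i. i < n \<Longrightarrow> ns i > 0" and m_pos: "m > 0"
    and LQ: "LQ \<ge> 0"
    and F_lip: "\<And>f h h'. f \<in> F \<Longrightarrow> h \<in> L2 Q \<Longrightarrow> h' \<in> L2 Q \<Longrightarrow>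
                  \<bar>f h - f h'\<bar> \<le> LQ * L2norm Q (\<lambda>x. h x - h' x)"
    and \<phi>_nonneg: "\<And>x. \<phi> x \<ge> 0"
    and L\<phi>: "L\<phi> \<ge> 0" and \<phi>_lip: "\<And>x y. \<bar>\<phi> x - \<phi> y\<bar> \<le> L\<phi> * \<bar>x - y\<bar>"
    and \<phi>_ind: "\<And>x. \<phi> x \<ge> (if x > 0 then 1 else 0)"
    and \<phi>_B: "\<And>f h l. f \<in> F \<Longrightarrow> h \<in> L2 Q \<Longrightarrow> l \<in> {-1, 1} \<Longrightarrow> \<phi> (- f h * l) \<le> B"
    and fstar: "fstar \<in> F" "\<And>f. f \<in> F \<Longrightarrow> risk M \<phi> k fstar \<le> risk M \<phi> k f"
    and fsel: "\<And>\<omega>. \<omega> \<in> space (sample_space M n ns (rf_measure p c) m) \<Longrightarrow>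
                 fsel \<omega> \<in> F \<and>
                 (\<forall>f\<in>F. emp_obj \<phi> c m n ns (fst \<omega>) (fst (snd \<omega>)) (snd (snd \<omega>)) (fsel \<omega>)
                          \<le> emp_obj \<phi> c m n ns (fst \<omega>) (fst (snd \<omega>)) (snd (snd \<omega>)) f)"
    and meas_loss: "\<And>f. f \<in> F \<Longrightarrow> (\<lambda>x. \<phi> (- f (kme k (fst x)) * snd x)) \<in> borel_measurable M"
    and meas_rad: "rad_sup k n F \<in> borel_measurable (PiM {..<n} (\<lambda>_. M) \<Otimes>\<^sub>M rademacher_signs n)"
    and meas_dev: "(\<lambda>D. \<Squnion>f\<in>F. ennreal \<bar>risk M \<phi> k f
                      - (1 / real n) * (\<Sum>i<n. \<phi> (- f (kme k (fst (D i))) * snd (D i)))\<bar>)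
                   \<in> borel_measurable (PiM {..<n} (\<lambda>_. M))"
    and meas_sel: "(\<lambda>\<omega>. risk M \<phi> k (fsel \<omega>)) \<in> borel_measurable (sample_space M n ns (rf_measure p c) m)"
    and \<delta>: "0 < \<delta>" "\<delta> < 1"
  shows "\<exists>A \<in> sets (joint_measure M n ns (rf_measure p c) m).
           measure (joint_measure M n ns (rf_measure p c) m) A \<ge> 1 - \<delta> \<and>
           (\<forall>\<omega>\<in>A.
              ereal (risk M \<phi> k (fsel \<omega>) - risk M \<phi> k fstar)
              \<le> ereal (4 * L\<phi>) * enn2ereal (rademacher M k n F)
                + ereal (2 * B * sqrt (ln (3 / \<delta>) / (2 * real n))
                  + (4 * L\<phi> * LQ / real n) *
                      (\<Sum>i<n. sqrt ((LINT z|fst (fst \<omega> i). k z z) / real (ns i))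
                              + sqrt (ln (3 * real n / \<delta>) / (2 * real (ns i))))
                  + (2 * L\<phi> * LQ / real n) *
                      (\<Sum>i<n. (2 * c / sqrt (real m)) * (1 + sqrt (2 * ln (3 * real n * real (ns i) / \<delta>))))))"
proof -
  have c_nonneg: "0 \<le> c" unfolding c_def using p_nonneg by simp
  \<comment> \<open>With spectral mass 0 the kernel vanishes and all mean embeddings coincide, so
    the point masses at 0 and at a basis vector contradict injectivity.\<close>
  have c0: "c \<noteq> 0"
  proof
    assume c: "c = 0"
    have k0: "k z z' = 0" for z z'
    proof -
      have i: "integrable lborel (\<lambda>w. p w * cos (w \<bullet> (z - z')))"
        by (rule Bochner_Integration.integrable_bound[OF p_int])
           (use p_int p_nonneg in \<open>auto simp: abs_mult intro!: mult_left_le\<close>)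
      have "\<bar>k z z'\<bar> \<le> (LINT w|lborel. \<bar>p w * cos (w \<bullet> (z - z'))\<bar>)"
        unfolding k_spectral by (rule integral_abs_bound)
      also have "\<dots> \<le> (LINT w|lborel. p w)"
        using integrable_abs[OF i] p_int p_nonneg by (intro integral_mono) (auto simp: abs_mult intro!: mult_left_le)
      finally show ?thesis using c c_def by simp
    qed
    obtain a :: 'd where a: "a \<in> Basis" using nonempty_Basis by blast
    then have "a \<noteq> 0" by auto
    have "return borel (0::'d) = return borel a"
    proof (rule inj_onD[OF k_char[unfolded characteristic_def]])
      show "kme k (return borel 0) = kme k (return borel a)" unfolding kme_def k0 by simp
    qed (simp_all add: space_prob_algebra prob_space_return)
    then have "emeasure (return borel (0::'d)) {0} = emeasure (return borel a) {0}" by simp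
    then show False using \<open>a \<noteq> 0\<close> by simp
  qed
  have c_le: "c \<le> 1" using k_diag[of 0] by (simp add: k_spectral c_def)
  have c_pos: "0 < c" using c0 c_nonneg by simp
  interpret SK: spectral_kernel Q k p c
    by (rule spectral_kernel.intro[OF Q p_nonneg p_int c_def k_spectral k_cont c_pos c_le])
  interpret TS: two_stage_sampling M n m ns "rf_measure p c"
    by (rule two_stage_sampling.intro[OF M SK.prob_RF])
  let ?J = "joint_measure M n ns (rf_measure p c) m"
  let ?t1 = "sqrt (ln (3 / \<delta>) / (2 * real n))"
  let ?t2 = "\<lambda>i. sqrt (ln (3 * real n / \<delta>) / (2 * real (ns i)))"
  let ?t3 = "\<lambda>i. (2 * c / sqrt (real m)) * (1 + sqrt (2 * ln (3 * real n * real (ns i) / \<delta>)))"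
  show ?thesis
  \<comment> \<open>If this product is infinite, so is the claimed bound, and the whole space serves
    as \<open>A\<close>. When \<open>L\<phi> = 0\<close> the product is 0 even for an infinite
    Rademacher average, so that situation falls into the finite case.\<close>
  proof (cases "ennreal L\<phi> * rademacher M k n F = top")
    case True
    then have "L\<phi> > 0" "rademacher M k n F = top" using L\<phi> by (auto simp: ennreal_mult_eq_top_iff)
    then have inf: "ereal (4 * L\<phi>) * enn2ereal (rademacher M k n F) = \<infinity>" by simp
    show ?thesis
      by (rule bexI[of _ "space ?J"]) (use \<delta> in \<open>simp_all add: TS.J.prob_space inf\<close>)
  next
    case False
    define r where "r = enn2real (ennreal L\<phi> * rademacher M k n F)"
    have r0: "r \<ge> 0" and r: "ennreal L\<phi> * rademacher M k n F = ennreal r"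
      using False by (simp_all add: r_def top.not_eq_extremum)
    define loss where "loss f x = \<phi> (- f (kme k (fst x)) * snd x)" for f and x :: "'d measure \<times> real"
    define Rn where "Rn D f = (1 / real n) * (\<Sum>i<n. loss f (D i))" for D :: "nat \<Rightarrow> 'd measure \<times> real" and f
    have risk_loss: "risk M \<phi> k f = TS.M.expectation (loss f)" for f unfolding risk_def loss_def ..
    have M': "prob_space (fst x) \<and> sets (fst x) = sets borel \<and> snd x \<in> {-1, 1}" if "x \<in> space M" for x
      using that TS.M_space by blast
    have loss_meas: "loss f \<in> borel_measurable M" if "f \<in> F" for f
      unfolding loss_def[abs_def] by (rule meas_loss[OF that])
    have loss_bd: "loss f x \<in> {0..B}" if "f \<in> F" "x \<in> space M" for f x
      unfolding loss_def using M'[OF that(2)] \<phi>_nonneg \<phi>_B[OF that(1) SK.kme_L2, of "fst x" "snd x"] by auto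
    obtain F' where F': "countable F'" "F' \<subseteq> F" and
      F'_dense: "\<And>D a f. D \<in> space TS.DM \<Longrightarrow> f \<in> F \<Longrightarrow>
        (\<And>f. f \<in> F' \<Longrightarrow> risk M \<phi> k f - Rn D f \<le> a) \<Longrightarrow> risk M \<phi> k f - Rn D f \<le> a"
      unfolding Rn_def loss_def
      by (rule SK.deviation_le_of_countable[where n=n and F=F and M=M and \<phi>=\<phi> and B=B and LQ=LQ and L\<phi>=L\<phi>])
         ((rule F_lip LQ M(1) M' \<phi>_nonneg \<phi>_lip \<phi>_B meas_loss; assumption) | blast)+
    \<comment> \<open>Quantifying over the countable \<open>F'\<close> makes the event measurable;
      \<open>F'_dense\<close> later extends its complement to every member of
      \<open>F\<close>.\<close>
    define bad where "bad D \<longleftrightarrow> (\<exists>f\<in>F'. (risk M \<phi> k f - Rn D f) - (risk M \<phi> k fstar - Rn D fstar) > 2 * r + 2 * B * ?t1)" for D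
    have \<delta>3: "0 < \<delta> / 3" "\<delta> / 3 < 1" using \<delta> by auto
    have F'_ins: "f \<in> F" if "f \<in> insert fstar F'" for f using that F'(2) fstar(1) by blast
    have rad_r: "(\<integral>D. (1 / 2 ^ n) * (\<Sum>S\<in>Pow {..<n}. Max ((\<lambda>f. (1 / real n) * (\<Sum>i<n. sgn_of S i * loss f (D i))) ` A)) \<partial>TS.DM) \<le> r"
      if A: "finite A" "A \<noteq> {}" "A \<subseteq> F'" for A
      unfolding loss_def
    proof (rule rademacher_loss_bound[where \<phi>=\<phi> and F=F and L=L\<phi>])
      show "snd x \<in> {-1, 1}" if "x \<in> space M" for x using M'[OF that] by blast
      show "A \<subseteq> F" using A(3) F'(2) by blast
      then show "(\<lambda>x. \<phi> (- f (kme k (fst x)) * snd x)) \<in> borel_measurable M" if "f \<in> A" for f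
        using that by (intro meas_loss) blast
      show "ennreal L\<phi> * rademacher M k n F \<le> ennreal r" by (simp only: r)
    qed (rule M(1) meas_rad A(1) A(2) L\<phi> \<phi>_lip r0)+
    have bad_eq: "{D \<in> space TS.DM. \<exists>f\<in>F'. (TS.M.expectation (loss f) - (1 / real n) * (\<Sum>i<n. loss f (D i)))
          - (TS.M.expectation (loss fstar) - (1 / real n) * (\<Sum>i<n. loss fstar (D i)))
          > 2 * r + 2 * B * sqrt (ln (1 / (\<delta> / 3)) / (2 * real n))} = Collect bad \<inter> space TS.DM"
      unfolding bad_def risk_loss Rn_def by auto
    have bad: "Collect bad \<inter> space TS.DM \<in> sets TS.DM" "measure TS.DM (Collect bad \<inter> space TS.DM) \<le> \<delta> / 3"
    proof -
      note dev = TS.M.one_sided_uniform_deviation[where loss=loss and A=F' and ?f0.0=fstar and B=B and r=r and \<eta>="\<delta> / 3" and n=n]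
      show "Collect bad \<inter> space TS.DM \<in> sets TS.DM"
        unfolding bad_eq[symmetric]
        by (rule dev(1)) (rule F'(1) n_pos \<delta>3 | erule loss_meas[OF F'_ins] loss_bd[OF F'_ins] rad_r; assumption)+
      show "measure TS.DM (Collect bad \<inter> space TS.DM) \<le> \<delta> / 3"
        unfolding bad_eq[symmetric]
        by (rule dev(2)) (rule F'(1) n_pos \<delta>3 | erule loss_meas[OF F'_ins] loss_bd[OF F'_ins] rad_r; assumption)+
    qed

    \<comment> \<open>The threshold of the mean embedding concentration at level
      \<open>\<delta> / (3 * n)\<close>, the share of a single bag.\<close>
    define t where "t i = c / sqrt (real (ns i)) + 2 * c * ?t2 i" for i
    define V2 where "V2 i \<omega> = L2norm Q (\<lambda>x. (1 / real (ns i)) * (\<Sum>j<ns i. k (fst (snd \<omega>) i j) x) - kme k (fst (fst \<omega> i)) x)"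
      for i and \<omega> :: "(nat \<Rightarrow> 'd measure \<times> real) \<times> (nat \<Rightarrow> nat \<Rightarrow> 'd) \<times> (nat \<Rightarrow> 'd \<times> real)"
    define V3 where "V3 i j \<omega> = L2norm Q (\<lambda>x. ghat c m (snd (snd \<omega>)) (fst (snd \<omega>) i j) x - k (fst (snd \<omega>) i j) x)"
      for i j and \<omega> :: "(nat \<Rightarrow> 'd measure \<times> real) \<times> (nat \<Rightarrow> nat \<Rightarrow> 'd) \<times> (nat \<Rightarrow> 'd \<times> real)"
    define X1 where "X1 = {\<omega> \<in> space ?J. bad (fst \<omega>)}"
    define X2 where "X2 i = {\<omega> \<in> space ?J. V2 i \<omega> > t i}" for i
    define X3 where "X3 i j = {\<omega> \<in> space ?J. V3 i j \<omega> > ?t3 i}" for i j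
    have X1s: "X1 \<in> sets ?J"
    proof -
      have "fst -` (Collect bad \<inter> space TS.DM) \<inter> space ?J \<in> sets ?J"
        by (rule measurable_sets[OF TS.measurable_J_fst bad(1)])
      also have "fst -` (Collect bad \<inter> space TS.DM) \<inter> space ?J = X1"
        using measurable_space[OF TS.measurable_J_fst] unfolding X1_def by blast
      finally show ?thesis .
    qed
    have X2s: "X2 i \<in> sets ?J" if i: "i < n" for i
    proof -
      have km: "(\<lambda>q. k (fst (snd (fst q)) i j) (snd q)) \<in> borel_measurable (?J \<Otimes>\<^sub>M Q)" if "j < ns i" for j
        using SK.k_comp_measurable[OF TS.measurable_J_S[OF i that]] by (simp add: case_prod_unfold)
      have em: "(\<lambda>q. kme k (fst (fst (fst q) i)) (snd q)) \<in> borel_measurable (?J \<Otimes>\<^sub>M Q)"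
        using SK.kme_comp_measurable[OF TS.measurable_J_D[OF i]] by (simp add: case_prod_unfold)
      have "V2 i \<in> borel_measurable ?J"
        unfolding V2_def[abs_def]
      proof (rule SK.L2norm_measurable)
        show "(\<lambda>(\<omega>, x). (1 / real (ns i)) * (\<Sum>j<ns i. k (fst (snd \<omega>) i j) x) - kme k (fst (fst \<omega> i)) x)
            \<in> borel_measurable (?J \<Otimes>\<^sub>M Q)"
          unfolding case_prod_unfold
          by (intro borel_measurable_diff borel_measurable_times measurable_const borel_measurable_sum km em) simp_all
      qed
      then show ?thesis unfolding X2_def by measurable
    qed
    have X3s: "X3 i j \<in> sets ?J" if ij: "i < n" "j < ns i" for i j
    proof -
      have W: "(\<lambda>\<omega>. snd (snd \<omega>) l) \<in> ?J \<rightarrow>\<^sub>M borel" if "l < m" for l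
        using TS.measurable_J_W[OF that] by (simp only: measurable_cong_sets[OF refl SK.sets_RF])
      have km: "(\<lambda>q. k (fst (snd (fst q)) i j) (snd q)) \<in> borel_measurable (?J \<Otimes>\<^sub>M Q)"
        using SK.k_comp_measurable[OF TS.measurable_J_S[OF ij]] by (simp add: case_prod_unfold)
      have gm: "(\<lambda>q. ghat c m (snd (snd (fst q))) (fst (snd (fst q)) i j) (snd q)) \<in> borel_measurable (?J \<Otimes>\<^sub>M Q)"
        using SK.ghat_comp_measurable[where W="\<lambda>\<omega>. snd (snd \<omega>)", OF W TS.measurable_J_S[OF ij]]
        by (simp add: case_prod_unfold)
      have "V3 i j \<in> borel_measurable ?J"
        unfolding V3_def[abs_def]
      proof (rule SK.L2norm_measurable)
        show "(\<lambda>(\<omega>, x). ghat c m (snd (snd \<omega>)) (fst (snd \<omega>) i j) x - k (fst (snd \<omega>) i j) x)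
            \<in> borel_measurable (?J \<Otimes>\<^sub>M Q)"
          unfolding case_prod_unfold by (intro borel_measurable_diff km gm)
      qed
      then show ?thesis unfolding X3_def by measurable
    qed
    have X1m: "measure ?J X1 \<le> \<delta> / 3"
      by (rule TS.measure_J_le_DM[OF bad X1s]) (simp add: X1_def)
    have X2m: "measure ?J (X2 i) \<le> \<delta> / (3 * real n)" if i: "i < n" for i
    proof -
      have "\<delta> < 3 * real n * 1" using \<delta> n_pos by (simp add: less_le_trans)
      then have e: "0 < \<delta> / (3 * real n)" "\<delta> / (3 * real n) < 1" using \<delta> n_pos by (auto simp: field_simps)
      have inv: "1 / (\<delta> / (3 * real n)) = 3 * real n / \<delta>" by simp
      show ?thesis
      proof (rule TS.measure_J_le_S[OF i X2s[OF i] less_imp_le[OF e(1)]])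
        let ?E = "\<lambda>D. {X \<in> space (PiM {..<ns i} (\<lambda>_. fst (D i))).
            L2norm Q (\<lambda>x. (1 / real (ns i)) * (\<Sum>j<ns i. k (X j) x) - kme k (fst (D i)) x) > t i}"
        fix D assume "D \<in> space TS.DM"
        note conc = SK.kme_concentration[OF TS.D_space(1,2)[OF this i] ns_pos[OF i] e, unfolded inv, folded t_def]
        show "?E D \<in> sets (PiM {..<ns i} (\<lambda>_. fst (D i)))" by (rule conc(1))
        show "measure (PiM {..<ns i} (\<lambda>_. fst (D i))) (?E D) \<le> \<delta> / (3 * real n)" by (rule conc(2))
      next
        fix D S W assume "(D, S, W) \<in> X2 i"
        then have "D \<in> space TS.DM" "S \<in> space TS.SB" "V2 i (D, S, W) > t i"
          unfolding X2_def TS.space_J by auto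
        then show "S i \<in> {X \<in> space (PiM {..<ns i} (\<lambda>_. fst (D i))).
            L2norm Q (\<lambda>x. (1 / real (ns i)) * (\<Sum>j<ns i. k (X j) x) - kme k (fst (D i)) x) > t i}"
          using TS.space_S[OF _ _ i] unfolding V2_def by simp
      qed
    qed
    \<comment> \<open>The share of bag \<open>i\<close> is divided once more among its
      \<open>ns i\<close> points, so that the double union sums back to \<open>\<delta> / 3\<close>.
      The point \<open>S i j\<close> is held fixed while \<open>W\<close> varies.\<close>
    have X3m: "measure ?J (X3 i j) \<le> \<delta> / (3 * real n * real (ns i))" if ij: "i < n" "j < ns i" for i j
    proof -
      have nn: "1 \<le> real n * real (ns i)" using n_pos ns_pos[OF ij(1)] by (metis of_nat_1 of_nat_mult of_nat_le_iff Suc_leI One_nat_def nat_0_less_mult_iff)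
      then have "\<delta> < 3 * real n * real (ns i)" using \<delta> by linarith
      then have e: "0 < \<delta> / (3 * real n * real (ns i))" "\<delta> / (3 * real n * real (ns i)) < 1"
        using \<delta> n_pos ns_pos[OF ij(1)] by (auto simp: field_simps)
      have inv: "1 / (\<delta> / (3 * real n * real (ns i))) = 3 * real n * real (ns i) / \<delta>" by simp
      note conc = SK.ghat_concentration[OF m_pos e, unfolded inv]
      show ?thesis
      proof (rule TS.measure_J_le_WM[OF X3s[OF ij] less_imp_le[OF e(1)]])
        let ?E = "\<lambda>S. {W \<in> space TS.WM. L2norm Q (\<lambda>x. ghat c m W (S i j) x - k (S i j) x) > ?t3 i}"
        show "?E S \<in> sets TS.WM" for S by (rule conc(1))
        show "measure TS.WM (?E S) \<le> \<delta> / (3 * real n * real (ns i))" for S by (rule conc(2))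
        fix D S W assume "(D, S, W) \<in> X3 i j"
        then have "W \<in> space TS.WM" "V3 i j (D, S, W) > ?t3 i" unfolding X3_def TS.space_J by auto
        then show "W \<in> ?E S" unfolding V3_def by simp
      qed
    qed
    define X where "X = X1 \<union> (\<Union>i<n. X2 i) \<union> (\<Union>i<n. \<Union>j<ns i. X3 i j)"
    have U2s: "(\<Union>i<n. X2 i) \<in> sets ?J" using X2s by (intro sets.finite_UN) auto
    have U3s: "(\<Union>j<ns i. X3 i j) \<in> sets ?J" if "i < n" for i using X3s[OF that] by (intro sets.finite_UN) auto
    have U3s': "(\<Union>i<n. \<Union>j<ns i. X3 i j) \<in> sets ?J" by (rule sets.finite_UN) (simp_all add: U3s)
    have Xs: "X \<in> sets ?J" unfolding X_def using X1s U2s U3s' by blast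
    have "measure ?J X \<le> \<delta>"
    proof -
      have "measure ?J X \<le> measure ?J X1 + measure ?J (\<Union>i<n. X2 i) + measure ?J (\<Union>i<n. \<Union>j<ns i. X3 i j)"
        unfolding X_def using measure_Un_le[OF X1s U2s] measure_Un_le[OF sets.Un[OF X1s U2s] U3s'] by linarith
      moreover have "measure ?J (\<Union>i<n. X2 i) \<le> \<delta> / 3"
      proof -
        have "measure ?J (\<Union>i<n. X2 i) \<le> (\<Sum>i<n. measure ?J (X2 i))" by (rule measure_UNION_le) (use X2s in auto)
        also have "\<dots> \<le> (\<Sum>i<n. \<delta> / (3 * real n))" by (intro sum_mono X2m) simp
        finally show ?thesis using n_pos by simp
      qed
      moreover have "measure ?J (\<Union>i<n. \<Union>j<ns i. X3 i j) \<le> \<delta> / 3"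
      proof -
        have "measure ?J (\<Union>i<n. \<Union>j<ns i. X3 i j) \<le> (\<Sum>i<n. measure ?J (\<Union>j<ns i. X3 i j))"
          by (rule measure_UNION_le) (simp_all add: U3s)
        also have "\<dots> \<le> (\<Sum>i<n. \<delta> / (3 * real n))"
        proof (rule sum_mono)
          fix i assume "i \<in> {..<n}"
          then have i: "i < n" by simp
          have "measure ?J (\<Union>j<ns i. X3 i j) \<le> (\<Sum>j<ns i. measure ?J (X3 i j))"
            by (rule measure_UNION_le) (use X3s[OF i] in auto)
          also have "\<dots> \<le> (\<Sum>j<ns i. \<delta> / (3 * real n * real (ns i)))" by (intro sum_mono X3m[OF i]) simp
          also have "\<dots> = \<delta> / (3 * real n)" using ns_pos[OF i] by simp
          finally show "measure ?J (\<Union>j<ns i. X3 i j) \<le> \<delta> / (3 * real n)" .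
        qed
        finally show ?thesis using n_pos by simp
      qed
      ultimately show ?thesis using X1m by linarith
    qed
    then have Am: "measure ?J (space ?J - X) \<ge> 1 - \<delta>" using TS.J.prob_compl[OF Xs] by simp
    have As: "space ?J - X \<in> sets ?J" using Xs by (rule sets.compl_sets)
    \<comment> \<open>Off the exceptional set, \<open>E\<close> bounds the gap between the empirical
      risks at the random feature estimates and at the true embeddings, uniformly over
      \<open>F\<close>.\<close>
    define E where "E = L\<phi> * LQ * ((1 / real n) * (\<Sum>i<n. t i + ?t3 i))"
    have main: "risk M \<phi> k (fsel \<omega>) - risk M \<phi> k fstar \<le> 2 * r + 2 * B * ?t1 + 2 * E" if \<omega>: "\<omega> \<in> space ?J - X" for \<omega>
    proof -
      obtain D S W where \<omega>_eq: "\<omega> = (D, S, W)" by (cases \<omega>)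
      have sp: "D \<in> space TS.DM" "S \<in> space TS.SB" "W \<in> space TS.WM" using \<omega> unfolding \<omega>_eq TS.space_J by auto
      have J: "\<omega> \<in> space ?J" and nX: "\<omega> \<notin> X" using \<omega> by auto
      have nbad: "\<not> bad D" using nX J unfolding X_def X1_def by (simp add: \<omega>_eq)
      have v2: "L2norm Q (\<lambda>x. (1 / real (ns i)) * (\<Sum>j<ns i. k (S i j) x) - kme k (fst (D i)) x) \<le> t i" if "i < n" for i
      proof -
        have "\<omega> \<notin> X2 i" using nX that unfolding X_def by blast
        then show ?thesis using J unfolding X2_def V2_def by (simp add: \<omega>_eq)
      qed
      have v3: "L2norm Q (\<lambda>x. ghat c m W (S i j) x - k (S i j) x) \<le> ?t3 i" if "i < n" "j < ns i" for i j
      proof -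
        have "\<omega> \<notin> X3 i j" using nX that unfolding X_def by blast
        then show ?thesis using J unfolding X3_def V3_def by (simp add: \<omega>_eq)
      qed
      define v where "v i = (\<lambda>x. (1 / real (ns i)) * (\<Sum>j<ns i. ghat c m W (S i j) x))" for i
      have vL: "v i \<in> L2 Q" for i unfolding v_def by (intro L2_scale L2_sum SK.ghat_L2)
      have uL: "kme k (fst (D i)) \<in> L2 Q" if "i < n" for i by (rule SK.kme_L2[OF TS.D_space(1,2)[OF sp(1) that]])
      have vu: "L2norm Q (\<lambda>x. v i x - kme k (fst (D i)) x) \<le> t i + ?t3 i" if i: "i < n" for i
      proof -
        \<comment> \<open>The sample average of exact kernel sections sits between the estimate
          \<open>v i\<close> and the mean embedding. Its distance to \<open>v i\<close> is at most
          the average of the feature errors at the points of the bag.\<close>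
        let ?w = "\<lambda>x. (1 / real (ns i)) * (\<Sum>j<ns i. k (S i j) x)"
        have wL: "?w \<in> L2 Q" by (intro L2_scale L2_sum SK.k_L2)
        have "L2norm Q (\<lambda>x. v i x - ?w x) = L2norm Q (\<lambda>x. (1 / real (ns i)) * (\<Sum>j<ns i. ghat c m W (S i j) x - k (S i j) x))"
          unfolding v_def by (simp add: sum_subtractf right_diff_distrib diff_divide_distrib)
        also have "\<dots> = (1 / real (ns i)) * L2norm Q (\<lambda>x. \<Sum>j<ns i. ghat c m W (S i j) x - k (S i j) x)"
          unfolding L2norm_scale by simp
        also have "\<dots> \<le> (1 / real (ns i)) * (\<Sum>j<ns i. L2norm Q (\<lambda>x. ghat c m W (S i j) x - k (S i j) x))"
          by (intro mult_left_mono L2norm_sum L2_diff SK.ghat_L2 SK.k_L2) simp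
        also have "\<dots> \<le> (1 / real (ns i)) * (\<Sum>j<ns i. ?t3 i)"
          by (intro mult_left_mono sum_mono v3[OF i]) simp_all
        also have "\<dots> = ?t3 i" using ns_pos[OF i] by simp
        finally have "L2norm Q (\<lambda>x. v i x - ?w x) \<le> ?t3 i" .
        then show ?thesis using L2norm_diff_le[OF vL wL uL[OF i], of i] v2[OF i] by linarith
      qed
      define emp where "emp g = emp_obj \<phi> c m n ns D S W g" for g
      have emp_eq: "emp g = (1 / real n) * (\<Sum>i<n. \<phi> (- g (v i) * snd (D i)))" for g
        unfolding emp_def emp_obj_def v_def ..
      have emp_diff: "\<bar>emp g - Rn D g\<bar> \<le> E" if g: "g \<in> F" for g
      proof -
        have pt: "\<bar>\<phi> (- g (v i) * snd (D i)) - loss g (D i)\<bar> \<le> L\<phi> * (LQ * (t i + ?t3 i))" if i: "i < n" for i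
        proof -
          have l: "\<bar>snd (D i)\<bar> = 1" using TS.D_space(3)[OF sp(1) i] by auto
          have "\<bar>\<phi> (- g (v i) * snd (D i)) - loss g (D i)\<bar>
              \<le> L\<phi> * \<bar>- g (v i) * snd (D i) - - g (kme k (fst (D i))) * snd (D i)\<bar>"
            unfolding loss_def by (rule \<phi>_lip)
          also have "\<bar>- g (v i) * snd (D i) - - g (kme k (fst (D i))) * snd (D i)\<bar> = \<bar>(g (kme k (fst (D i))) - g (v i)) * snd (D i)\<bar>"
            by (simp add: algebra_simps)
          also have "\<dots> = \<bar>g (v i) - g (kme k (fst (D i)))\<bar>" by (simp add: abs_mult l)
          also have "L\<phi> * \<dots> \<le> L\<phi> * (LQ * L2norm Q (\<lambda>x. v i x - kme k (fst (D i)) x))"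
            by (intro mult_left_mono F_lip g vL uL i L\<phi>)
          also have "\<dots> \<le> L\<phi> * (LQ * (t i + ?t3 i))" by (intro mult_left_mono vu i LQ L\<phi>)
          finally show ?thesis .
        qed
        have "emp g - Rn D g = (1 / real n) * (\<Sum>i<n. \<phi> (- g (v i) * snd (D i)) - loss g (D i))"
          unfolding emp_eq Rn_def by (simp add: sum_subtractf diff_divide_distrib)
        also have "\<bar>\<dots>\<bar> \<le> (1 / real n) * (\<Sum>i<n. \<bar>\<phi> (- g (v i) * snd (D i)) - loss g (D i)\<bar>)"
          by (simp add: abs_mult divide_right_mono)
        also have "\<dots> \<le> (1 / real n) * (\<Sum>i<n. L\<phi> * (LQ * (t i + ?t3 i)))"
          by (intro mult_left_mono sum_mono pt) simp_all
        also have "\<dots> = E" unfolding E_def by (simp add: sum_distrib_left mult_ac)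
        finally show ?thesis .
      qed
      have "\<omega> \<in> space (sample_space M n ns (rf_measure p c) m)"
        using J sets_eq_imp_space_eq[OF TS.sets_J] by simp
      from fsel[OF this] have fs: "fsel \<omega> \<in> F" and opt: "emp (fsel \<omega>) \<le> emp fstar"
        using fstar(1) unfolding emp_def \<omega>_eq by auto
      have "risk M \<phi> k f - Rn D f \<le> 2 * r + 2 * B * ?t1 + (risk M \<phi> k fstar - Rn D fstar)" if "f \<in> F'" for f
        using nbad that unfolding bad_def by force
      \<comment> \<open>The selected functional depends on the sample and need not lie in
        \<open>F'\<close>; density transfers the bound to it at the present
        \<open>D\<close>.\<close>
      from F'_dense[OF sp(1) fs this]
      have "risk M \<phi> k (fsel \<omega>) - Rn D (fsel \<omega>) \<le> 2 * r + 2 * B * ?t1 + (risk M \<phi> k fstar - Rn D fstar)" .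
      \<comment> \<open>Optimality is known for the approximate objective, so the gap
        \<open>E\<close> is paid twice: once at \<open>fsel \<omega>\<close> and once at
        \<open>fstar\<close>.\<close>
      then show ?thesis using emp_diff[OF fs] emp_diff[OF fstar(1)] opt by linarith
    qed
    have kint: "(LINT z|fst (fst \<omega> i). k z z) = c" if "\<omega> \<in> space ?J" "i < n" for \<omega> i
    proof -
      have "fst \<omega> \<in> space TS.DM" using that(1) unfolding TS.space_J by auto
      then interpret P: prob_space "fst (fst \<omega> i)" by (rule TS.D_space(1)[OF _ that(2)])
      show ?thesis by (simp add: SK.k_diag P.prob_space)
    qed
    have final: "2 * E \<le> (4 * L\<phi> * LQ / real n) * (\<Sum>i<n. sqrt ((LINT z|fst (fst \<omega> i). k z z) / real (ns i)) + ?t2 i)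
        + (2 * L\<phi> * LQ / real n) * (\<Sum>i<n. ?t3 i)" if \<omega>: "\<omega> \<in> space ?J" for \<omega>
    proof -
      \<comment> \<open>\<open>c \<le> 1\<close> yields both \<open>c \<le> sqrt c\<close>, with
        \<open>c\<close> the kernel diagonal, and \<open>2 * c \<le> 2\<close>. Doubling the first
        summand as well gives a common factor 2, which turns the prefactor 2 into 4.\<close>
      have t: "t i \<le> 2 * (sqrt ((LINT z|fst (fst \<omega> i). k z z) / real (ns i)) + ?t2 i)" if i: "i < n" for i
      proof -
        have "c\<^sup>2 \<le> c" using c_pos c_le by (simp add: power2_eq_square)
        then have "c \<le> sqrt c" by (rule real_le_rsqrt)
        then have "c / sqrt (real (ns i)) \<le> sqrt (c / real (ns i))" by (simp add: real_sqrt_divide divide_right_mono)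
        moreover have "0 \<le> sqrt (c / real (ns i))" using c_nonneg by simp
        moreover have "0 \<le> ?t2 i"
        proof -
          have "\<delta> \<le> 3 * real n" using \<delta> n_pos by (simp add: less_imp_le less_le_trans)
          then show ?thesis using \<delta> by simp
        qed
        then have "2 * c * ?t2 i \<le> 2 * ?t2 i" using c_le by (intro mult_right_mono) auto
        ultimately show ?thesis unfolding t_def kint[OF \<omega> i] distrib_left by linarith
      qed
      have "2 * E = (2 * L\<phi> * LQ / real n) * (\<Sum>i<n. t i) + (2 * L\<phi> * LQ / real n) * (\<Sum>i<n. ?t3 i)"
        unfolding E_def sum.distrib by (simp add: algebra_simps add_divide_distrib)
      also have "(2 * L\<phi> * LQ / real n) * (\<Sum>i<n. t i)
          \<le> (2 * L\<phi> * LQ / real n) * (\<Sum>i<n. 2 * (sqrt ((LINT z|fst (fst \<omega> i). k z z) / real (ns i)) + ?t2 i))"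
        using L\<phi> LQ by (intro mult_left_mono sum_mono t) auto
      also have "\<dots> = (4 * L\<phi> * LQ / real n) * (\<Sum>i<n. sqrt ((LINT z|fst (fst \<omega> i). k z z) / real (ns i)) + ?t2 i)"
        unfolding sum_distrib_left[symmetric] by simp
      finally show ?thesis by simp
    qed
    have rad: "ereal (4 * L\<phi>) * enn2ereal (rademacher M k n F) = ereal (4 * r)"
    proof -
      have "ereal (4 * L\<phi>) * enn2ereal (rademacher M k n F) = ereal 4 * enn2ereal (ennreal L\<phi> * rademacher M k n F)"
        using L\<phi> by (simp add: times_ennreal.rep_eq mult.assoc flip: times_ereal.simps(1))
      then show ?thesis using r0 by (simp add: r)
    qed
    show ?thesis
    proof (rule bexI[OF _ As], intro conjI ballI)
      fix \<omega> assume \<omega>: "\<omega> \<in> space ?J - X"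
      then have "\<omega> \<in> space ?J" by simp
      \<comment> \<open>The argument produces \<open>2 * r\<close>, and nonnegativity of
        \<open>r\<close> raises this to the \<open>4 * r\<close> of the claim.\<close>
      from main[OF \<omega>] final[OF this] r0 show "ereal (risk M \<phi> k (fsel \<omega>) - risk M \<phi> k fstar)
              \<le> ereal (4 * L\<phi>) * enn2ereal (rademacher M k n F)
                + ereal (2 * B * ?t1
                  + (4 * L\<phi> * LQ / real n) *
                      (\<Sum>i<n. sqrt ((LINT z|fst (fst \<omega> i). k z z) / real (ns i)) + ?t2 i)
                  + (2 * L\<phi> * LQ / real n) * (\<Sum>i<n. ?t3 i))"
        unfolding rad plus_ereal.simps(1) ereal_less_eq(3) by linarith
    qed (rule Am)
  qed
qed

end
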